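(* Consider the algebra $B$ of shifted symmetric functions with basis of shifted Schur functions $s_\lambda=s^*_\lambda$, the family $h^{(r)}_k=\phi^r h^*_{k+r}$, and the associated operators $\psi_k,\psi^*_k,D_p,D^{(p)}$. For $m\in\mathbb Z$ set $$\Psi(u,m)=\sum_{k\in\mathbb Z}\psi_k|_{\mathcal B^{(m)}}u^k,\qquad \Psi^*(u,m)=\sum_{k\in\mathbb Z}\psi^*_k|_{\mathcal B^{(m)}}u^{-k},$$ $$\tilde\Psi(u,m)=\sum_{k\in\mathbb Z}\psi_k|_{\mathcal B^{(m)}}\frac1{(u|k-1)},\qquad \tilde\Psi^*(u,m)=\sum_{k\in\mathbb Z}\psi^*_k|_{\mathcal B^{(m)}}(-u|k+1).$$ Then $$\Psi(1/u,m)=z\,u^{-m-1}\sum_{p\ge0}(\partial_u-1)^p\bigl(H(1/u)\bigr)\,D_p\,u^p,$$ $$\Psi^*(1/u,m)=z^{-1}u^m\sum_{p\ge0}(\partial_u+1)^p\bigl(E(-1/u)\bigr)\,D^{(-p-1)}\,u^p,$$ $$\tilde\Psi(u,m)=z\,\frac1{(u|m)}\,\tilde H(u-m)\,D\tilde E(u-m),$$ $$\tilde\Psi^*(u,m)=z^{-1}(-u|m)\,\tilde E(u+m)\,D\tilde H(u+m-1),$$ where $$E(u)=\sum_{r\in\mathbb Z}e^*_ru^r,\quad H(u)=\sum_{r\in\mathbb Z}h^*_ru^r,\quad \tilde E(u)=\sum_{r\in\mathbb Z}\frac{e^*_r}{(u|r)},\quad \tilde H(u)=\sum_{r\in\mathbb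 Z}\frac{h^*_r}{(u|r)},$$ $$D\tilde E(u)=\sum_{p\in\mathbb Z}D_p\frac{(-1)^p}{(u|-p)},\qquad D\tilde H(u)=\sum_{p\in\mathbb Z}D^{(p)}\frac{(-1)^p}{(u|p)}.$$
   Context: Shifted powers: $(x|k)=x(x-1)\cdots(x-k+1)$ for $k\ge1$, $(x|0)=1$, and $(x|k)=\dfrac1{(x+1)(x+2)\cdots(x+(-k))}$ for $k\le-1$. Shifted Schur functions: the shifted Schur polynomial of a partition $\lambda$ is $s^*_\lambda(x_1,\dots,x_n)=\dfrac{\det[(x_i+n-i\,|\,\lambda_j+n-j)]_{1\le i,j\le n}}{\det[(x_i+n-i\,|\,n-j)]_{1\le i,j\le n}}$; these are stable under setting $x_{n+1}=0$ and define shifted Schur functions $s^*_\lambda=s^*_\lambda(x_1,x_2,\dots)$. Put $h^*_r=s^*_{(r)}=\sum_{i_1\le\dots\le i_r}(x_{i_1}-r+1)(x_{i_2}-r+2)\cdots x_{i_r}$ and $e^*_r=s^*_{(1^r)}=\sum_{i_1<\dots<i_r}(x_{i_1}+r-1)(x_{i_2}+r-2)\cdots x_{i_r}$ for $r\ge 1$, $h^*_0=e^*_0=1$, $h^*_r=e^*_r=0$ for $r<0$. The algebra $B$ of shifted symmetric functions over $\mathbb C$ is the polynomial ring $\mathbb C[h^*_1,h^*_2,\dots]$, and the $s^*_\lambda$ (all partitions $\lambda$) form a linear basis (known facts). Let $\phi$ be the automorphism of $B$ with $\phi(h^*_k)=h^*_k+(k-1)h^*_{k-1}$, and set $h^{(r)}_k=\phi^r(h^*_{k+r})$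 for $k,r\in\mathbb Z$. It is known (Okounkov–Olshanski) that $s^*_\lambda=\det[\phi^{j-1}h^*_{\lambda_i-i+j}]_{1\le i,j\le l}=\det[h^{(j-1)}_{\lambda_i-i+1}]_{1\le i,j\le l}$. For any integer vector $\lambda=(\lambda_1,\dots,\lambda_l)$ (parts may be negative and in any order), extended by $\lambda_i=0$ for $i>l$, let $s_\lambda$ be the stable value, for large $N$, of $\det[h^{(j-1)}_{\lambda_i-i+1}]_{1\le i,j\le N}$ (the same for all $N\ge l$); for partitions $s_\lambda=s^*_\lambda$. Let $z$ be a variable, $\mathcal B^{(m)}=z^mB$, $\mathcal B=\bigoplus_{m\in\mathbb Z}\mathcal B^{(m)}=B[z,z^{-1}]$. Linear operators $\psi_k,\psi_k^*$ on $\mathcal B$ are defined on the basis $\{s_\lambda z^m\}$ ($\lambda$ a partition, $m\in\mathbb Z$) by $$\psi_k(s_\lambda z^m)=s_{(k-m-1,\lambda_1,\lambda_2,\dots)}z^{m+1},$$ $$\psi^*_k(s_\lambda z^m)=\sum_{t=1}^\infty(-1)^{t+1}\delta_{k-m-1,\,\lambda_t-t}\;s_{(\lambda_1+1,\dots,\lambda_{t-1}+1,\lambda_{t+1},\lambda_{t+2},\dots)}z^{m-1}.$$ Linear operators $D_p$ and $D^{(p)}$ ($p\in\mathbb Z$) on $B$ are defined on $s_\lambda$, $\lambda=(\lambda_1\ge\dots\ge\lambda_l\ge0)$ a partition, by $$D_p(s_\lambda)=\det\left[h^{(j)}_{\lambda_i-i}\right]_{i=1,\dots,l;\;j=0,1,\dots,\widehat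 p,\dots,l}\ \text{ if }0\le p\le l,\qquad D_p(s_\lambda)=0\ \text{ otherwise}$$ (the column $j=p$ is omitted), and $$D^{(p)}(s_\lambda)=\sum_{t=1}^\infty(-1)^{t+1}h^{(p)}_{\lambda_t-t+2}\,s_{(\lambda_1+1,\dots,\lambda_{t-1}+1,\lambda_{t+1},\lambda_{t+2},\dots)},$$ where $\lambda_t=0$ for $t>l$ (a finite sum). They are extended to $\mathcal B$ by commuting with $z^{\pm1}$. For each fixed element of $B$ only finitely many $D_p$ and finitely many $D^{(p)}$ are nonzero on it ($D_p=0$ for $p<0$, $D^{(p)}=0$ for $p\ge0$, $D^{(p)}(s_\lambda)=0$ for $-p>\lambda_1+1$). Conventions: elements of $B$ act by multiplication, after the operators $D_p,D^{(p)}$. $\partial_u=\partial/\partial u$ acts coefficientwise, only on the series $H(1/u)=\sum_r h^*_ru^{-r}$, resp. $E(-1/u)=\sum_r e^*_r(-u)^{-r}$. All expressions are formal series; the functions $1/(u|k)$ and $(\pm u|k)$, and their shifts in $u$, are expanded as formal Laurent series in $u^{-1}$, so that each side applied to an element of $\mathcal B^{(m)}$ is a well-defined formal Laurent series in $u^{-1}$. *)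

theory Defs
  imports
    "HOL-Library.Function_Algebras"
    "HOL-Library.Poly_Mapping"
    "HOL-Computational_Algebra.Formal_Laurent_Series"
    "HOL-Analysis.Infinite_Sum"
    "Jordan_Normal_Form.Determinant"
begin

section \<open>Shifted Schur functions\<close>

text \<open>
  \<open>cpoly\<close> is the ring of polynomials over the complex numbers in variables \<open>x\<^sub>1, x\<^sub>2, \<dots>\<close>.
  A stable family of polynomials is represented by \<open>f :: sfun\<close>, where \<open>f n\<close> is the polynomial in
  \<open>x\<^sub>1, \<dots>, x\<^sub>n\<close> obtained by setting \<open>x\<^sub>i = 0\<close> for all \<open>i > n\<close>; the ring operations of
  \<open>sfun\<close> are the pointwise ones.
\<close>

type_synonym cpoly = "(nat \<Rightarrow>\<^sub>0 nat) \<Rightarrow>\<^sub>0 complex"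

type_synonym sfun = "nat \<Rightarrow> cpoly"

definition xvar :: "nat \<Rightarrow> cpoly" where
  "xvar i = Poly_Mapping.single (Poly_Mapping.single i 1) 1"

definition sconst :: "complex \<Rightarrow> sfun" where
  "sconst c = (\<lambda>n. Poly_Mapping.single 0 c)"

text \<open>The determinant of \<open>(A i j)\<close> with indices \<open>1 \<le> i, j \<le> n\<close>.\<close>

definition detn :: "nat \<Rightarrow> (nat \<Rightarrow> nat \<Rightarrow> 'a :: comm_ring_1) \<Rightarrow> 'a" where
  "detn n A = det (mat n n (\<lambda>(i, j). A (Suc i) (Suc j)))"

definition shifted_power :: "'a :: comm_ring_1 \<Rightarrow> nat \<Rightarrow> 'a" where
  "shifted_power x k = (\<Prod>i<k. x - of_nat i)"

definition shifted_power_int :: "'a :: field \<Rightarrow> int \<Rightarrow> 'a" where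
  "shifted_power_int x k =
     (if k \<ge> 0 then shifted_power x (nat k) else 1 / (\<Prod>i=1..nat (- k). x + of_nat i))"

text \<open>The \<open>i\<close>-th entry (\<open>i \<ge> 1\<close>) of a vector, extended by zeros.\<close>

definition part :: "'a :: zero list \<Rightarrow> nat \<Rightarrow> 'a" where
  "part l i = (if 1 \<le> i \<and> i \<le> length l then l ! (i - 1) else 0)"

text \<open>
  The quotient of determinants is taken in the integral domain \<open>cpoly\<close>: it is the unique polynomial
  whose product with the denominator is the numerator.
\<close>

definition shifted_schur_poly :: "nat \<Rightarrow> nat list \<Rightarrow> cpoly" where
  "shifted_schur_poly n l =
     (THE p. p * detn n (\<lambda>i j. shifted_power (xvar i + of_nat (n - i)) (n - j))
               = detn n (\<lambda>i j. shifted_power (xvar i + of_nat (n - i)) (part l j + (n - j))))"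

text \<open>
  For a list \<open>l\<close> of positive parts; the restriction to fewer than \<open>length l\<close> variables is \<open>0\<close>
  (put \<open>x\<^sub>n = 0\<close> for \<open>n = length l\<close>: the last row of the numerator vanishes).
\<close>

definition sstar :: "nat list \<Rightarrow> sfun" where
  "sstar l = (\<lambda>n. if length l \<le> n then shifted_schur_poly n l else 0)"

definition hstar :: "int \<Rightarrow> sfun" where
  "hstar r = (if r > 0 then sstar [nat r] else if r = 0 then 1 else 0)"

definition estar :: "int \<Rightarrow> sfun" where
  "estar r = (if r > 0 then sstar (replicate (nat r) 1) else if r = 0 then 1 else 0)"

inductive_set shifted_symmetric :: "sfun set" where
  const: "sconst c \<in> shifted_symmetric"
| hstar: "hstar r \<in> shifted_symmetric"
| add: "f \<in> shifted_symmetric \<Longrightarrow> g \<in> shifted_symmetric \<Longrightarrow> f + g \<in> shifted_symmetric"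
| mult: "f \<in> shifted_symmetric \<Longrightarrow> g \<in> shifted_symmetric \<Longrightarrow> f * g \<in> shifted_symmetric"

definition is_shift_automorphism :: "(sfun \<Rightarrow> sfun) \<Rightarrow> bool" where
  "is_shift_automorphism \<phi> \<longleftrightarrow>
     bij_betw \<phi> shifted_symmetric shifted_symmetric \<and>
     (\<forall>c. \<phi> (sconst c) = sconst c) \<and>
     (\<forall>f\<in>shifted_symmetric. \<forall>g\<in>shifted_symmetric. \<phi> (f + g) = \<phi> f + \<phi> g) \<and>
     (\<forall>f\<in>shifted_symmetric. \<forall>g\<in>shifted_symmetric. \<phi> (f * g) = \<phi> f * \<phi> g) \<and>
     (\<forall>k. \<phi> (hstar k) = hstar k + of_int (k - 1) * hstar (k - 1))"

definition hshift :: "(sfun \<Rightarrow> sfun) \<Rightarrow> int \<Rightarrow> int \<Rightarrow> sfun" where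
  "hshift \<phi> r k =
     (if r \<ge> 0 then (\<phi> ^^ nat r) (hstar (k + r))
      else (the_inv_into shifted_symmetric \<phi> ^^ nat (- r)) (hstar (k + r)))"

text \<open>
  \<open>s\<^sub>\<lambda>\<close> for an arbitrary integer vector; enlarging the determinant by zero entries of \<open>\<lambda>\<close> does not
  change its value.  For a partition this is the Jacobi-Trudi determinant of the shifted Schur function.
\<close>

definition svec :: "(sfun \<Rightarrow> sfun) \<Rightarrow> int list \<Rightarrow> sfun" where
  "svec \<phi> l = detn (length l) (\<lambda>i j. hshift \<phi> (int j - 1) (part l i - int i + 1))"

definition is_partition :: "int list \<Rightarrow> bool" where
  "is_partition l \<longleftrightarrow> sorted_wrt (\<ge>) l \<and> (\<forall>a\<in>set l. a \<ge> 0)"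

text \<open>\<open>(\<lambda>\<^sub>1 + 1, \<dots>, \<lambda>\<^bsub>t-1\<^esub> + 1, \<lambda>\<^bsub>t+1\<^esub>, \<lambda>\<^bsub>t+2\<^esub>, \<dots>)\<close>, for \<open>t \<ge> 1\<close>\<close>

definition remove_part :: "int list \<Rightarrow> nat \<Rightarrow> int list" where
  "remove_part l t = map (\<lambda>i. part l i + 1) [1..<t] @ drop t l"

section \<open>Operators\<close>

text \<open>Laurent polynomials in \<open>z\<close>; \<open>z ^ m * f\<close> is \<open>Poly_Mapping.single m f\<close>.\<close>

type_synonym fock = "int \<Rightarrow>\<^sub>0 sfun"

definition fock_space :: "fock set" where
  "fock_space = {F. \<forall>m. Poly_Mapping.lookup F m \<in> shifted_symmetric}"

definition charge_space :: "int \<Rightarrow> fock set" where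
  "charge_space m = Poly_Mapping.single m ` shifted_symmetric"

definition linear_operator :: "(complex \<Rightarrow> 'a) \<Rightarrow> 'a set \<Rightarrow> ('a :: comm_ring_1 \<Rightarrow> 'a) \<Rightarrow> bool" where
  "linear_operator \<iota> V T \<longleftrightarrow>
     (\<forall>v\<in>V. T v \<in> V) \<and>
     (\<forall>v\<in>V. \<forall>w\<in>V. T (v + w) = T v + T w) \<and>
     (\<forall>c. \<forall>v\<in>V. T (\<iota> c * v) = \<iota> c * T v)"

abbreviation linear_on_B :: "(sfun \<Rightarrow> sfun) \<Rightarrow> bool" where
  "linear_on_B \<equiv> linear_operator sconst shifted_symmetric"

abbreviation linear_on_fock :: "(fock \<Rightarrow> fock) \<Rightarrow> bool" where
  "linear_on_fock \<equiv> linear_operator (\<lambda>c. Poly_Mapping.single 0 (sconst c)) fock_space"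

definition is_psi :: "(sfun \<Rightarrow> sfun) \<Rightarrow> (int \<Rightarrow> fock \<Rightarrow> fock) \<Rightarrow> bool" where
  "is_psi \<phi> \<psi> \<longleftrightarrow>
     (\<forall>k. linear_on_fock (\<psi> k) \<and>
        (\<forall>l m. is_partition l \<longrightarrow>
           \<psi> k (Poly_Mapping.single m (svec \<phi> l)) =
             Poly_Mapping.single (m + 1) (svec \<phi> ((k - m - 1) # l))))"

text \<open>The index set of the sum encodes the Kronecker delta; it has at most one element.\<close>

definition is_psi_star :: "(sfun \<Rightarrow> sfun) \<Rightarrow> (int \<Rightarrow> fock \<Rightarrow> fock) \<Rightarrow> bool" where
  "is_psi_star \<phi> \<psi>' \<longleftrightarrow>
     (\<forall>k. linear_on_fock (\<psi>' k) \<and>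
        (\<forall>l m. is_partition l \<longrightarrow>
           \<psi>' k (Poly_Mapping.single m (svec \<phi> l)) =
             Poly_Mapping.single (m - 1)
               (\<Sum>t\<in>{t. 1 \<le> t \<and> k - m - 1 = part l t - int t}.
                  (- 1) ^ (t + 1) * svec \<phi> (remove_part l t))))"

text \<open>The \<open>j\<close>-th of the columns \<open>0, 1, \<dots>, p - 1, p + 1, \<dots>\<close> (\<open>j \<ge> 1\<close>) is \<open>j - 1\<close> or \<open>j\<close>.\<close>

definition is_D_lower :: "(sfun \<Rightarrow> sfun) \<Rightarrow> (int \<Rightarrow> sfun \<Rightarrow> sfun) \<Rightarrow> bool" where
  "is_D_lower \<phi> D \<longleftrightarrow>
     (\<forall>p. linear_on_B (D p) \<and>
        (\<forall>l. is_partition l \<longrightarrow>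
           D p (svec \<phi> l) =
             (if 0 \<le> p \<and> p \<le> int (length l)
              then detn (length l)
                     (\<lambda>i j. hshift \<phi> (if int j - 1 < p then int j - 1 else int j)
                               (part l i - int i))
              else 0)))"

definition is_D_upper :: "(sfun \<Rightarrow> sfun) \<Rightarrow> (int \<Rightarrow> sfun \<Rightarrow> sfun) \<Rightarrow> bool" where
  "is_D_upper \<phi> D' \<longleftrightarrow>
     (\<forall>p. linear_on_B (D' p) \<and>
        (\<forall>l. is_partition l \<longrightarrow>
           D' p (svec \<phi> l) =
             Sum_any (\<lambda>t. if 1 \<le> t
                then (- 1) ^ (t + 1) * hshift \<phi> p (part l t - int t + 2)
                       * svec \<phi> (remove_part l t)
                else 0)))"

section \<open>Generating series\<close>

text \<open>
  Formal Laurent series in \<open>u\<^sup>-\<^sup>1\<close>: the formal variable of type \<open>fls\<close> is \<open>1 / u\<close>.  Infinite sums of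
  such series are taken in the topology of \<open>fls\<close>, in which summability says that for each \<open>n\<close> only
  finitely many summands have a nonzero coefficient in a degree \<open>\<le> n\<close>; so these are the
  formal, coefficientwise sums.
\<close>

abbreviation u :: "complex fls" where
  "u \<equiv> fls_X_inv"

text \<open>Complex Laurent series and elements of \<open>B[z, z\<^sup>-\<^sup>1]\<close> or \<open>B\<close> as series over \<open>B[z, z\<^sup>-\<^sup>1]\<close>.\<close>

definition scalar :: "complex fls \<Rightarrow> fock fls" where
  "scalar a = Abs_fls (\<lambda>n. Poly_Mapping.single 0 (sconst (fls_nth a n)))"

abbreviation elt :: "fock \<Rightarrow> fock fls" where
  "elt \<equiv> fls_const"

abbreviation elt_B :: "sfun \<Rightarrow> fock fls" where
  "elt_B b \<equiv> fls_const (Poly_Mapping.single 0 b)"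

abbreviation z_power :: "int \<Rightarrow> fock fls" where
  "z_power m \<equiv> fls_const (Poly_Mapping.single m 1)"

text \<open>\<open>d/du = - x\<^sup>2 d/dx\<close> for \<open>x = 1 / u\<close>.\<close>

definition deriv_u :: "fock fls \<Rightarrow> fock fls" where
  "deriv_u G = - (fls_X ^ 2 * fls_deriv G)"

text \<open>The extension to \<open>B[z, z\<^sup>-\<^sup>1]\<close> of an operator on \<open>B\<close>, commuting with \<open>z\<close>.\<close>

abbreviation extend :: "(sfun \<Rightarrow> sfun) \<Rightarrow> fock \<Rightarrow> fock" where
  "extend \<equiv> Poly_Mapping.map"

text \<open>
  Operator-valued series are given by their values on an element \<open>F\<close>.  The argument \<open>v\<close> is the Laurent
  series that is substituted for the variable, for example \<open>1 / u\<close> or \<open>u - of_int m\<close>.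
\<close>

definition Psi :: "(int \<Rightarrow> fock \<Rightarrow> fock) \<Rightarrow> complex fls \<Rightarrow> fock \<Rightarrow> fock fls" where
  "Psi \<psi> v F = (\<Sum>\<^sub>\<infinity>k\<in>UNIV. elt (\<psi> k F) * scalar (v powi k))"

definition Psi_star :: "(int \<Rightarrow> fock \<Rightarrow> fock) \<Rightarrow> complex fls \<Rightarrow> fock \<Rightarrow> fock fls" where
  "Psi_star \<psi>' v F = (\<Sum>\<^sub>\<infinity>k\<in>UNIV. elt (\<psi>' k F) * scalar (v powi (- k)))"

definition Psi_tilde :: "(int \<Rightarrow> fock \<Rightarrow> fock) \<Rightarrow> complex fls \<Rightarrow> fock \<Rightarrow> fock fls" where
  "Psi_tilde \<psi> v F = (\<Sum>\<^sub>\<infinity>k\<in>UNIV. elt (\<psi> k F) * scalar (1 / shifted_power_int v (k - 1)))"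

definition Psi_star_tilde :: "(int \<Rightarrow> fock \<Rightarrow> fock) \<Rightarrow> complex fls \<Rightarrow> fock \<Rightarrow> fock fls" where
  "Psi_star_tilde \<psi>' v F = (\<Sum>\<^sub>\<infinity>k\<in>UNIV. elt (\<psi>' k F) * scalar (shifted_power_int (- v) (k + 1)))"

definition E_series :: "complex fls \<Rightarrow> fock fls" where
  "E_series v = (\<Sum>\<^sub>\<infinity>r\<in>UNIV. elt_B (estar r) * scalar (v powi r))"

definition H_series :: "complex fls \<Rightarrow> fock fls" where
  "H_series v = (\<Sum>\<^sub>\<infinity>r\<in>UNIV. elt_B (hstar r) * scalar (v powi r))"

definition E_tilde :: "complex fls \<Rightarrow> fock fls" where
  "E_tilde v = (\<Sum>\<^sub>\<infinity>r\<in>UNIV. elt_B (estar r) * scalar (1 / shifted_power_int v r))"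

definition H_tilde :: "complex fls \<Rightarrow> fock fls" where
  "H_tilde v = (\<Sum>\<^sub>\<infinity>r\<in>UNIV. elt_B (hstar r) * scalar (1 / shifted_power_int v r))"

definition DE_tilde :: "(int \<Rightarrow> sfun \<Rightarrow> sfun) \<Rightarrow> complex fls \<Rightarrow> fock \<Rightarrow> fock fls" where
  "DE_tilde D v F =
     (\<Sum>\<^sub>\<infinity>p\<in>UNIV. elt (extend (D p) F) * scalar ((- 1) powi p / shifted_power_int v (- p)))"

definition DH_tilde :: "(int \<Rightarrow> sfun \<Rightarrow> sfun) \<Rightarrow> complex fls \<Rightarrow> fock \<Rightarrow> fock fls" where
  "DH_tilde D' v F =
     (\<Sum>\<^sub>\<infinity>p\<in>UNIV. elt (extend (D' p) F) * scalar ((- 1) powi p / shifted_power_int v p))"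

end

theory Submission
  imports Defs
begin

text \<open>
  Put \<open>h\<^bsup>(r)\<^esup>\<^bsub>k\<^esub> = \<phi>\<^sup>r h\<^sup>*\<^bsub>k+r\<^esub>\<close>, so that
  \<open>h\<^bsup>(r+1)\<^esup>\<^bsub>k\<^esub> = h\<^bsup>(r)\<^esup>\<^bsub>k+1\<^esub> + (k + r) h\<^bsup>(r)\<^esup>\<^bsub>k\<^esub>\<close>.
  Expanding \<open>s\<^bsub>(a,\<lambda>)\<^esub>\<close> along its first row gives
  \<open>\<Sum>\<^sub>p (-1)\<^sup>p h\<^bsup>(p)\<^esup>\<^sub>a D\<^sub>p(s\<^sub>\<lambda>)\<close>, and each of the series
  \<open>\<Sum>\<^sub>a h\<^bsup>(p)\<^esup>\<^sub>a u\<^bsup>-a\<^esup>\<close> and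
  \<open>\<Sum>\<^sub>a h\<^bsup>(p)\<^esup>\<^sub>a / (u|a)\<close> is computed by induction on \<open>p\<close> from the recurrence.

  For the starred operators, \<open>D\<^bsup>(-q-1)\<^esup>(s\<^sub>\<lambda>) = \<Sum>\<^sub>c h\<^bsup>(-q-1)\<^esup>\<^sub>c Y\<^sub>c\<close>,
  where \<open>Y\<^sub>c\<close> is the part of the sum defining the \<open>\<psi>\<^sup>*\<^sub>k(s\<^sub>\<lambda>)\<close> with \<open>\<lambda>\<^sub>t - t + 2 = c\<close>; this vanishes for
  \<open>q < 0\<close>, being a determinant with a repeated column. The unitriangular matrix
  \<open>h\<^bsup>(-q-1)\<^esup>\<^sub>c\<close> is inverted by means of shifted \<open>e\<^sup>*\<close>'s that satisfy the same kind of
  recurrence. The inversion reduces to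
  \<open>\<Sum>\<^sub>s (-1)\<^sup>s e\<^sup>*\<^sub>s \<phi>\<^bsup>n-1\<^esup> h\<^sup>*\<^bsub>n-s\<^esub> = 0\<close> for \<open>n \<ge> 1\<close>. In \<open>N\<close> variables, with
  \<open>y\<^sub>i = x\<^sub>i + N - i\<close>, this holds because the determinant whose first column is \<open>f(y\<^sub>i)\<close> and whose other
  columns are \<open>(y\<^sub>i|N - j)\<close> is zero for every multiple \<open>f\<close> of \<open>\<Prod>\<^sub>i (v - y\<^sub>i)\<close>.
\<close>

section \<open>Determinants of shifted powers\<close>

lemma detn_cong:
  "(\<And>i j. 1 \<le> i \<Longrightarrow> i \<le> n \<Longrightarrow> 1 \<le> j \<Longrightarrow> j \<le> n \<Longrightarrow> A i j = B i j) \<Longrightarrow> detn n A = detn n B"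
  unfolding detn_def by (intro arg_cong[of _ _ det] cong_mat) auto

lemma detn_0 [simp]: "detn 0 A = 1"
  unfolding detn_def by (simp add: det_dim_zero)

text \<open>The increasing enumeration of the positive integers other than \<open>i\<close>:
  composing an index with it deletes row or column \<open>i\<close>, so that a minor is again a
  \<open>detn\<close>.\<close>

definition skip :: "nat \<Rightarrow> nat \<Rightarrow> nat" where
  "skip i k = (if k < i then k else Suc k)"

lemma detn_expand_col:
  assumes "1 \<le> j" "j \<le> n"
  shows "detn n A = (\<Sum>i=1..n. (-1) ^ (i + j) * A i j * detn (n - 1) (\<lambda>k l. A (skip i k) (skip j l)))"
proof -
  let ?M = "mat n n (\<lambda>(i, j). A (Suc i) (Suc j))"
  have "detn n A = (\<Sum>i<n. ?M $$ (i, j - 1) * cofactor ?M i (j - 1))"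
    unfolding detn_def by (rule laplace_expansion_column) (use assms in auto)
  also have "\<dots> = (\<Sum>i<n. (-1) ^ (Suc i + j) * A (Suc i) j
      * detn (n - 1) (\<lambda>k l. A (skip (Suc i) k) (skip j l)))"
  proof (intro sum.cong refl)
    fix i assume i: "i \<in> {..<n}"
    have "mat_delete ?M i (j - 1)
        = mat (n - 1) (n - 1) (\<lambda>(k, l). A (skip (Suc i) (Suc k)) (skip j (Suc l)))"
      unfolding mat_delete_def using assms i
      by (intro eq_matI) (auto simp: skip_def)
    moreover have "(-1 :: 'a) ^ (Suc i + j) = (-1) ^ (i + (j - 1))"
      using assms(1) by (cases j) auto
    ultimately show "?M $$ (i, j - 1) * cofactor ?M i (j - 1) = (-1) ^ (Suc i + j) * A (Suc i) j
      * detn (n - 1) (\<lambda>k l. A (skip (Suc i) k) (skip j l))"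
      using assms i by (simp add: cofactor_def detn_def mult_ac)
  qed
  also have "\<dots> = (\<Sum>i=1..n. (-1) ^ (i + j) * A i j * detn (n - 1) (\<lambda>k l. A (skip i k) (skip j l)))"
    by (simp add: sum.atLeast1_atMost_eq)
  finally show ?thesis .
qed

lemma detn_transpose: "detn n (\<lambda>i j. A j i) = detn n A"
proof -
  have "mat n n (\<lambda>(i, j). A (Suc j) (Suc i)) = transpose_mat (mat n n (\<lambda>(i, j). A (Suc i) (Suc j)))"
    by (intro eq_matI) auto
  then show ?thesis
    unfolding detn_def by (metis det_transpose mat_carrier)
qed

lemma detn_expand_row:
  assumes "1 \<le> i" "i \<le> n"
  shows "detn n A = (\<Sum>j=1..n. (-1) ^ (i + j) * A i j * detn (n - 1) (\<lambda>k l. A (skip i k) (skip j l)))"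
proof -
  have "detn n A = (\<Sum>j=1..n. (-1) ^ (j + i) * A i j
      * detn (n - 1) (\<lambda>k l. A (skip i l) (skip j k)))"
    by (subst detn_transpose[symmetric], subst detn_expand_col[OF assms]) simp
  also have "\<dots> = (\<Sum>j=1..n. (-1) ^ (i + j) * A i j
      * detn (n - 1) (\<lambda>k l. A (skip i k) (skip j l)))"
    by (intro sum.cong refl, subst detn_transpose[of _ "\<lambda>k l. A (skip i k) (skip j l)" for i j])
       (simp add: add.commute)
  finally show ?thesis .
qed

lemma detn_identical_cols:
  assumes "1 \<le> i" "i \<le> n" "1 \<le> j" "j \<le> n" "i \<noteq> j" "\<And>k. 1 \<le> k \<Longrightarrow> k \<le> n \<Longrightarrow> A k i = A k j"
  shows "detn n A = 0"
  unfolding detn_def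
proof (rule det_identical_columns[of _ n "i - 1" "j - 1"])
  show "col (mat n n (\<lambda>(i, j). A (Suc i) (Suc j))) (i - 1) = col (mat n n (\<lambda>(i, j). A (Suc i) (Suc j))) (j - 1)"
    using assms by (intro eq_vecI) auto
qed (use assms in auto)

lemma detn_identical_rows:
  assumes "1 \<le> i" "i \<le> n" "1 \<le> j" "j \<le> n" "i \<noteq> j" "\<And>k. 1 \<le> k \<Longrightarrow> k \<le> n \<Longrightarrow> A i k = A j k"
  shows "detn n A = 0"
  using detn_identical_cols[of i n j "\<lambda>k l. A l k"] assms detn_transpose[of n A] by simp

lemma detn_permute_rows:
  assumes "p permutes {0..<n}"
  shows "detn n (\<lambda>i j. A (Suc (p (i - 1))) j) = signof p * detn n A"
proof -
  have "mat n n (\<lambda>(i, j). A (Suc (p (Suc i - 1))) (Suc j))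
      = mat n n (\<lambda>(i, j). mat n n (\<lambda>(i, j). A (Suc i) (Suc j)) $$ (p i, j))"
    using permutes_in_image[OF assms] by (intro eq_matI) auto
  then show ?thesis
    unfolding detn_def by (metis assms det_permute_rows mat_carrier)
qed

subsection \<open>Falling factorials and the functional\<close>

lemma shifted_power_0 [simp]: "shifted_power x 0 = 1"
  by (simp add: shifted_power_def)

lemma shifted_power_Suc: "shifted_power x (Suc k) = shifted_power x k * (x - of_nat k)"
  by (simp add: shifted_power_def)

abbreviation ff :: "nat \<Rightarrow> 'a :: idom poly" where
  "ff k \<equiv> shifted_power [:0, 1:] k"

lemma poly_ff [simp]: "poly (ff k) x = shifted_power x k"
  by (simp add: shifted_power_def poly_prod)

lemma degree_ff [simp]: "degree (ff k :: 'a :: idom poly) = k"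
  and coeff_ff [simp]: "coeff (ff k :: 'a poly) k = 1"
proof -
  have "degree (ff k :: 'a poly) = k \<and> coeff (ff k :: 'a poly) k = 1"
  proof (induction k)
    case (Suc k)
    have eq: "(ff (Suc k) :: 'a poly) = ff k * [:- of_nat k, 1:]"
      by (simp add: shifted_power_Suc of_nat_poly)
    have "(ff k :: 'a poly) \<noteq> 0"
      using Suc by auto
    then have deg: "degree (ff (Suc k) :: 'a poly) = Suc k"
      unfolding eq using Suc by (subst degree_mult_eq) auto
    moreover have "lead_coeff (ff (Suc k) :: 'a poly) = 1"
      unfolding eq lead_coeff_mult using Suc by simp
    ultimately show ?case by simp
  qed simp
  then show "degree (ff k :: 'a poly) = k" "coeff (ff k :: 'a poly) k = 1" by auto
qed

lemma ff_nonzero [simp]: "ff k \<noteq> (0 :: 'a :: idom poly)"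
  by (metis coeff_0 coeff_ff zero_neq_one)

text \<open>The \<open>ff k\<close> are monic of degree \<open>k\<close>, so subtracting the top
  term lowers the degree. The top coefficient is recorded because later arguments solve for the term
  of highest degree.\<close>

lemma ff_expansion:
  fixes f :: "'a :: idom poly"
  assumes "degree f \<le> d"
  obtains c where "f = (\<Sum>k\<le>d. Polynomial.smult (c k) (ff k))" "c d = coeff f d"
proof -
  have "\<exists>c. f = (\<Sum>k\<le>d. Polynomial.smult (c k) (ff k)) \<and> c d = coeff f d"
    using assms
  proof (induction d arbitrary: f)
    case 0
    then obtain a where "f = [:a:]" by (metis degree_eq_zeroE le_zero_eq)
    then show ?case by (intro exI[of _ "\<lambda>_. a"]) simp
  next
    case (Suc d)
    let ?g = "f - Polynomial.smult (coeff f (Suc d)) (ff (Suc d))"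
    have "degree ?g \<le> Suc d"
      using Suc.prems by (intro degree_diff_le) (metis degree_ff degree_smult_le)+
    moreover have "coeff ?g (Suc d) = 0"
      by simp
    ultimately have "degree ?g \<le> d"
      by (metis Suc_n_not_le_n le_SucE leading_coeff_0_iff degree_0 le0)
    from Suc.IH[OF this] obtain c where c: "?g = (\<Sum>k\<le>d. Polynomial.smult (c k) (ff k))" by auto
    let ?c = "c(Suc d := coeff f (Suc d))"
    have "f = ?g + Polynomial.smult (coeff f (Suc d)) (ff (Suc d))" by simp
    also have "\<dots> = (\<Sum>k\<le>Suc d. Polynomial.smult (?c k) (ff k))"
      unfolding c by (simp add: sum.atMost_Suc)
    finally show ?case by (intro exI[of _ ?c]) simp
  qed
  then show ?thesis using that by blast
qed

text \<open>The denominator in the definition of shifted Schur polynomials. Its columns are monic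
  polynomials of degrees \<open>n - 1\<close> down to 0 evaluated at the \<open>y i\<close>, so this
  is a Vandermonde determinant.\<close>

definition vdet :: "(nat \<Rightarrow> 'a :: idom) \<Rightarrow> nat \<Rightarrow> 'a" where
  "vdet y n = detn n (\<lambda>i j. shifted_power (y i) (n - j))"

text \<open>For \<open>n >= 1\<close> this is a linear functional of \<open>f\<close>. At
  \<open>f = ff (n - 1 + k)\<close> it is the numerator for the one-row shape
  \<open>k\<close>.\<close>

definition ldet :: "(nat \<Rightarrow> 'a :: idom) \<Rightarrow> nat \<Rightarrow> 'a poly \<Rightarrow> 'a" where
  "ldet y n f = detn n (\<lambda>i j. if j = 1 then poly f (y i) else shifted_power (y i) (n - j))"

lemma ldet_eq:
  assumes "n \<ge> 1"
  shows "ldet y n f = (\<Sum>i=1..n. poly f (y i) * ((-1) ^ (i + 1)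
            * detn (n - 1) (\<lambda>k l. shifted_power (y (skip i k)) (n - Suc l))))"
  unfolding ldet_def using assms
  by (subst detn_expand_col[of 1])
     (auto intro!: sum.cong detn_cong simp: skip_def mult_ac)

lemma ldet_add: "n \<ge> 1 \<Longrightarrow> ldet y n (f + g) = ldet y n f + ldet y n g"
  by (simp add: ldet_eq distrib_right flip: sum.distrib del: mult_minus_left mult_minus_right)

lemma ldet_smult: "n \<ge> 1 \<Longrightarrow> ldet y n (Polynomial.smult c f) = c * ldet y n f"
  by (simp add: ldet_eq sum_distrib_left mult_ac)

lemma ldet_0: "n \<ge> 1 \<Longrightarrow> ldet y n 0 = 0"
  by (simp add: ldet_eq)

lemma ldet_sum: "n \<ge> 1 \<Longrightarrow> ldet y n (\<Sum>k\<in>I. f k) = (\<Sum>k\<in>I. ldet y n (f k))"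
  by (induction I rule: infinite_finite_induct) (auto simp: ldet_0 ldet_add)

lemma ldet_ff_less: "Suc k < n \<Longrightarrow> ldet y n (ff k) = 0"
  unfolding ldet_def by (rule detn_identical_cols[of 1 _ "n - k"]) auto

lemma ldet_ff_eq: "n \<ge> 1 \<Longrightarrow> ldet y n (ff (n - 1)) = vdet y n"
  unfolding ldet_def vdet_def by (rule detn_cong) auto

definition root_poly :: "(nat \<Rightarrow> 'a :: idom) \<Rightarrow> nat \<Rightarrow> 'a poly" where
  "root_poly y n = (\<Prod>i=1..n. [:- y i, 1:])"

lemma poly_root_poly: "i \<in> {1..n} \<Longrightarrow> poly (root_poly y n) (y i) = 0"
  by (auto simp: root_poly_def poly_prod intro!: prod_zero bexI[of _ i])

lemma ldet_root_poly: "n \<ge> 1 \<Longrightarrow> ldet y n (root_poly y n * g) = 0"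
  unfolding ldet_eq by (intro sum.neutral) (simp add: poly_root_poly)

lemma degree_root_poly [simp]: "degree (root_poly y n) = n"
  unfolding root_poly_def by (subst degree_prod_eq_sum_degree) auto

lemma coeff_root_poly [simp]: "coeff (root_poly y n) n = 1"
proof -
  have "lead_coeff (root_poly y n) = 1"
    unfolding root_poly_def by (subst lead_coeff_prod) simp
  then show ?thesis by simp
qed

lemma root_poly_nonzero [simp]: "root_poly y n \<noteq> 0"
  by (metis coeff_0 coeff_root_poly zero_neq_one)

text \<open>For \<open>k >= n\<close> the functional kills
  \<open>root_poly y n * ff (k - n)\<close>, which is monic of degree \<open>k\<close>; hence
  \<open>ldet y n (ff k)\<close> is a combination of earlier values. This divisibility is what makes
  the quotient defining \<open>hstar\<close> exist as a polynomial.\<close>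

lemma vdet_dvd_ldet_ff:
  assumes "n \<ge> 1"
  shows "vdet y n dvd ldet y n (ff k)"
proof (induction k rule: less_induct)
  case (less k)
  consider "Suc k < n" | "k = n - 1" | "k \<ge> n" by linarith
  then show ?case
  proof cases
    case 3
    let ?f = "root_poly y n * ff (k - n)"
    have deg: "degree ?f = k"
      using 3 by (simp add: degree_mult_eq)
    moreover have "lead_coeff ?f = 1"
      unfolding lead_coeff_mult by simp
    ultimately obtain c where c: "?f = (\<Sum>j\<le>k. Polynomial.smult (c j) (ff j))" "c k = 1"
      using ff_expansion[of ?f k] by (metis order_refl)
    have "0 = (\<Sum>j\<le>k. c j * ldet y n (ff j))"
      using ldet_root_poly[OF assms, of y "ff (k - n)"] unfolding c(1)
      by (simp add: ldet_sum[OF assms] ldet_smult[OF assms])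
    also have "\<dots> = ldet y n (ff k) + (\<Sum>j<k. c j * ldet y n (ff j))"
      by (simp add: lessThan_Suc_atMost[symmetric] c(2))
    finally have "ldet y n (ff k) = - (\<Sum>j<k. c j * ldet y n (ff j))"
      by (simp add: eq_neg_iff_add_eq_0)
    moreover have "vdet y n dvd (\<Sum>j<k. c j * ldet y n (ff j))"
      using less by (intro dvd_sum dvd_mult) auto
    ultimately show ?thesis by simp
  qed (use assms ldet_ff_less[of k n y] ldet_ff_eq[of n y] in auto)
qed

text \<open>A kernel vector of the matrix would give a polynomial of degree below \<open>n\<close>
  that vanishes at the \<open>n\<close> distinct points \<open>y i\<close>, hence the zero
  polynomial; the \<open>ff k\<close> being independent, the vector is zero.\<close>

lemma vdet_nonzero:
  assumes "inj_on y {1..n}"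
  shows "vdet y n \<noteq> 0"
proof
  assume 0: "vdet y n = 0"
  let ?M = "mat n n (\<lambda>(i, j). shifted_power (y (Suc i)) (n - Suc j))"
  have "det ?M = 0" using 0 unfolding vdet_def detn_def .
  then obtain v where v: "v \<in> carrier_vec n" "v \<noteq> 0\<^sub>v n" "?M *\<^sub>v v = 0\<^sub>v n"
    using det_0_iff_vec_prod_zero[of ?M n] by auto
  define q where "q = (\<Sum>j<n. Polynomial.smult (v $ j) (ff (n - Suc j)))"
  have root: "poly q (y i) = 0" if "i \<in> {1..n}" for i
  proof -
    define i' where "i' = i - 1"
    have i': "i = Suc i'" "i' < n" using that by (auto simp: i'_def)
    have "(?M *\<^sub>v v) $ i' = 0" using v(3) i' by simp
    then show ?thesis
      using i' v(1)
      by (simp add: q_def poly_sum scalar_prod_def atLeast0LessThan mult_ac)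
  qed
  have deg: "degree q \<le> n - 1"
    unfolding q_def
  proof (rule degree_sum_le)
    fix j assume "j \<in> {..<n}"
    then show "degree (Polynomial.smult (v $ j) (ff (n - Suc j))) \<le> n - 1"
      using degree_smult_le[of "v $ j" "ff (n - Suc j)"] by auto
  qed simp
  have "n > 0" using v by (cases n) auto
  have "q = 0"
  proof (rule ccontr)
    assume "q \<noteq> 0"
    then have "card {x. poly q x = 0} \<le> degree q" "finite {x. poly q x = 0}"
      using card_poly_roots_bound poly_roots_finite by blast+
    moreover have "y ` {1..n} \<subseteq> {x. poly q x = 0}" using root by auto
    ultimately have "card (y ` {1..n}) \<le> n - 1"
      using deg by (meson card_mono le_trans)
    then show False using card_image[OF assms] \<open>n > 0\<close> by simp
  qed
  \<comment> \<open>Degrees drop by one from each summand of \<open>q\<close> to the next. Once the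
    earlier coefficients vanish, \<open>v $ j\<close> is the coefficient of \<open>q\<close> in
    degree \<open>n - Suc j\<close>.\<close>
  have "v $ j = 0" if "j < n" for j
    using that
  proof (induction j rule: less_induct)
    case (less j)
    have "coeff (Polynomial.smult (v $ k) (ff (n - Suc k))) (n - Suc j) = (if k = j then v $ j else 0)"
      if "k < n" for k
    proof (cases k j rule: linorder_cases)
      case greater
      then have "degree (ff (n - Suc k) :: 'a poly) < n - Suc j"
        using that greater by auto
      then show ?thesis using greater by (simp add: coeff_eq_0)
    next
      case equal
      then show ?thesis by simp
    qed (use less that in simp)
    then have "coeff q (n - Suc j) = (\<Sum>k<n. if k = j then v $ j else 0)"
      unfolding q_def coeff_sum by (intro sum.cong) auto
    then show ?case using \<open>q = 0\<close> less.prems by simp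
  qed
  then have "v = 0\<^sub>v n" using v(1) by (intro eq_vecI) auto
  then show False using v(2) by simp
qed

text \<open>The columns after the first have all exponents from 0 to \<open>n - 1\<close> except
  \<open>n - r\<close>. With \<open>root_poly\<close> in the first column the determinant vanishes;
  expanding that column in the \<open>ff k\<close> leaves only \<open>k = n\<close>, which is the
  wanted determinant, and \<open>k = n - r\<close>, which is \<open>vdet\<close> up to moving a
  column.\<close>

lemma detn_column_hook:
  fixes y :: "nat \<Rightarrow> 'a :: idom"
  assumes c: "root_poly y n = (\<Sum>k\<le>n. Polynomial.smult (c k) (ff k))" "c n = 1" and r: "1 \<le> r" "r \<le> n"
  shows "detn n (\<lambda>i j. shifted_power (y i) ((if j \<le> r then 1 else 0) + (n - j)))
           = (-1) ^ r * c (n - r) * vdet y n"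
proof -
  define M where "M = (\<lambda>f :: 'a poly. detn n (\<lambda>i j. if j = 1 then poly f (y i)
      else shifted_power (y i) ((if j \<le> r then 1 else 0) + (n - j))))"
  define C where "C = (\<lambda>i. detn (n - 1) (\<lambda>k l. shifted_power (y (skip i k))
      ((if Suc l \<le> r then 1 else 0) + (n - Suc l))))"
  have n: "n \<ge> 1" using r by simp
  have M: "M f = (\<Sum>i=1..n. poly f (y i) * ((-1) ^ (i + 1) * C i))" for f
    unfolding M_def C_def using n
    by (subst detn_expand_col[of 1])
       (auto intro!: sum.cong detn_cong simp: skip_def mult_ac)
  have "0 = M (root_poly y n)"
    unfolding M by (intro sum.neutral[symmetric]) (simp add: poly_root_poly)
  also have "\<dots> = (\<Sum>k\<le>n. c k * M (ff k))"
    unfolding M c(1) by (simp add: poly_sum sum_distrib_left sum_distrib_right mult_ac)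
       (rule sum.swap)
  also have "\<dots> = (\<Sum>k\<in>{n, n - r}. c k * M (ff k))"
  proof (rule sum.mono_neutral_right)
    show "\<forall>k\<in>{..n} - {n, n - r}. c k * M (ff k) = 0"
    proof
      fix k assume k: "k \<in> {..n} - {n, n - r}"
      have "M (ff k) = 0"
      proof (cases "k > n - r")
        case True
        then show ?thesis unfolding M_def using k r
          by (intro detn_identical_cols[of 1 _ "n - k + 1"]) auto
      next
        case False
        then show ?thesis unfolding M_def using k r
          by (intro detn_identical_cols[of 1 _ "n - k"]) auto
      qed
      then show "c k * M (ff k) = 0" by simp
    qed
  qed auto
  also have "\<dots> = M (ff n) + c (n - r) * M (ff (n - r))"
    using r c(2) by simp
  finally have 1: "M (ff n) = - c (n - r) * M (ff (n - r))"
    by (simp add: eq_neg_iff_add_eq_0)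
  \<comment> \<open>Expanding \<open>vdet\<close> along column \<open>r\<close>, the one with
    exponent \<open>n - r\<close>, produces the same minors \<open>C\<close>; only the position of
    the column differs.\<close>
  have 2: "vdet y n = (-1) ^ (r - 1) * M (ff (n - r))"
  proof -
    have "vdet y n = (\<Sum>i=1..n. (-1) ^ (i + r) * shifted_power (y i) (n - r) * C i)"
      unfolding vdet_def C_def using r
      by (subst detn_expand_col[of r]) (auto intro!: sum.cong detn_cong simp: skip_def)
    also have "\<dots> = (-1) ^ (r - 1) * M (ff (n - r))"
      unfolding M sum_distrib_left
    proof (intro sum.cong refl)
      fix i
      obtain r' where "r = Suc r'" using r by (cases r) auto
      then show "(-1) ^ (i + r) * shifted_power (y i) (n - r) * C i =
         (-1) ^ (r - 1) * (poly (ff (n - r)) (y i) * ((-1) ^ (i + 1) * C i))"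
        by (simp add: power_add mult_ac)
    qed
    finally show ?thesis .
  qed
  have "detn n (\<lambda>i j. shifted_power (y i) ((if j \<le> r then 1 else 0) + (n - j))) = M (ff n)"
    unfolding M_def using r by (intro detn_cong) auto
  also have "\<dots> = (-1) ^ r * c (n - r) * vdet y n"
  proof -
    obtain r' where "r = Suc r'" using r by (cases r) auto
    then show ?thesis unfolding 1 2
      by (simp add: mult.assoc mult.left_commute[of "c _"] flip: power_add mult_2)
  qed
  finally show ?thesis .
qed

section \<open>Values of \<open>hstar\<close> and \<open>estar\<close> in \<open>n\<close>
  variables\<close>

lemma of_int_sfun_apply: "(of_int a :: sfun) n = of_int a"
  by (cases a) simp_all

lemma sum_sfun_apply: "(sum f I :: sfun) n = (\<Sum>i\<in>I. f i n)"
  by (induction I rule: infinite_finite_induct) simp_all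

lemma power_sfun_apply: "((f :: sfun) ^ k) n = f n ^ k"
  by (induction k) simp_all

definition pts :: "nat \<Rightarrow> nat \<Rightarrow> cpoly" where
  "pts n i = xvar i + of_nat (n - i)"

lemma lookup_xvar_single: "Poly_Mapping.lookup (xvar i) (Poly_Mapping.single j 1) = (1 when i = j)"
proof -
  have "Poly_Mapping.single i (1::nat) = Poly_Mapping.single j 1 \<longleftrightarrow> i = j"
    by (metis lookup_single_eq lookup_single_not_eq zero_neq_one)
  then show ?thesis
    by (auto simp: xvar_def lookup_single when_def)
qed

text \<open>The points are told apart by their linear coefficients, to which the added constants do
  not contribute.\<close>

lemma inj_on_pts: "inj_on (pts n) A"
proof (rule inj_onI)
  fix i j assume eq: "pts n i = pts n j"
  have "Poly_Mapping.single i (1::nat) \<noteq> 0"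
    by (metis lookup_single_eq lookup_zero zero_neq_one)
  then have "Poly_Mapping.lookup (pts n k) (Poly_Mapping.single i 1) = (1 when k = i)" for k
    unfolding pts_def by (simp add: lookup_add lookup_xvar_single lookup_of_nat del: One_nat_def)
  then have "(1 when i = i) = (1 when j = i :: complex)"
    using eq by metis
  then show "i = j"
    by (auto simp: when_def split: if_splits)
qed

lemma vdet_pts_nonzero: "vdet (pts n) n \<noteq> 0"
  by (rule vdet_nonzero[OF inj_on_pts])

text \<open>The denominator is nonzero in an integral domain, so a quotient is unique; every
  evaluation of a shifted Schur polynomial below goes through this product identity.\<close>

lemma shifted_schur_polyI:
  assumes "q * vdet (pts n) n = detn n (\<lambda>i j. shifted_power (pts n i) (part l j + (n - j)))"
  shows "shifted_schur_poly n l = q"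
  unfolding shifted_schur_poly_def
proof (rule the_equality)
  show "q * detn n (\<lambda>i j. shifted_power (xvar i + of_nat (n - i)) (n - j)) =
    detn n (\<lambda>i j. shifted_power (xvar i + of_nat (n - i)) (part l j + (n - j)))"
    using assms by (simp add: vdet_def pts_def)
next
  fix p assume "p * detn n (\<lambda>i j. shifted_power (xvar i + of_nat (n - i)) (n - j)) =
    detn n (\<lambda>i j. shifted_power (xvar i + of_nat (n - i)) (part l j + (n - j)))"
  then have "p * vdet (pts n) n = q * vdet (pts n) n"
    using assms by (simp add: vdet_def pts_def)
  then show "p = q" using vdet_pts_nonzero[of n] by simp
qed

text \<open>One formula for all signs of \<open>k\<close>: the one-row quotient for
  \<open>k > 0\<close>, the denominator itself for \<open>k = 0\<close>, and for
  \<open>k < 0\<close> a repeated column, in agreement with \<open>hstar k = 0\<close>.\<close>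

lemma hstar_times_vdet:
  assumes n: "n \<ge> 1" and k: "int n - 1 + k \<ge> 0"
  shows "hstar k n * vdet (pts n) n = ldet (pts n) n (ff (nat (int n - 1 + k)))"
proof -
  consider "k > 0" | "k = 0" | "k < 0" by linarith
  then show ?thesis
  proof cases
    case 1
    define r where "r = nat k"
    have r: "nat (int n - 1 + k) = n - 1 + r" "r > 0"
      using n 1 by (auto simp: r_def)
    obtain q where q: "ldet (pts n) n (ff (n - 1 + r)) = vdet (pts n) n * q"
      using vdet_dvd_ldet_ff[OF n] by (metis dvdE)
    have "hstar k n = shifted_schur_poly n [r]"
      using 1 n by (simp add: hstar_def sstar_def r_def)
    also have "\<dots> = q"
    proof (rule shifted_schur_polyI)
      have "ldet (pts n) n (ff (n - 1 + r))
          = detn n (\<lambda>i j. shifted_power (pts n i) (part [r] j + (n - j)))"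
        unfolding ldet_def by (rule detn_cong) (auto simp: part_def add.commute)
      then show "q * vdet (pts n) n = detn n (\<lambda>i j. shifted_power (pts n i) (part [r] j + (n - j)))"
        using q by (simp add: mult.commute)
    qed
    finally show ?thesis using q r by (simp add: mult.commute)
  next
    case 2
    then have "nat (int n - 1 + k) = n - 1" by simp
    then show ?thesis using n ldet_ff_eq[OF n, of "pts n"] 2 by (simp add: hstar_def)
  next
    case 3
    have "Suc (nat (int n - 1 + k)) < n" using 3 k by linarith
    then show ?thesis using 3 by (simp add: hstar_def ldet_ff_less)
  qed
qed

lemma hstar_0_vars: "k > 0 \<Longrightarrow> hstar k 0 = 0"
  by (simp add: hstar_def sstar_def)

lemma estar_0 [simp]: "estar 0 = 1"
  by (simp add: estar_def)

lemma estar_neg [simp]: "k < 0 \<Longrightarrow> estar k = 0"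
  by (simp add: estar_def)

lemma estar_eq_0: "n < s \<Longrightarrow> estar (int s) n = 0"
  by (simp add: estar_def sstar_def)

text \<open>The analogue of reading elementary symmetric polynomials off the product of the
  \<open>v - y i\<close>, with falling factorials in place of powers of \<open>v\<close>.\<close>

lemma estar_eq_coeff:
  assumes c: "root_poly (pts n) n = (\<Sum>k\<le>n. Polynomial.smult (c k) (ff k))" "c n = 1" and s: "s \<le> n"
  shows "estar (int s) n = (-1) ^ s * c (n - s)"
proof (cases "s = 0")
  case False
  have "estar (int s) n = shifted_schur_poly n (replicate s 1)"
    using False s by (simp add: estar_def sstar_def)
  also have "\<dots> = (-1) ^ s * c (n - s)"
  proof (rule shifted_schur_polyI)
    show "(-1) ^ s * c (n - s) * vdet (pts n) n
        = detn n (\<lambda>i j. shifted_power (pts n i) (part (replicate s 1) j + (n - j)))"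
      using s False
      by (subst detn_column_hook[OF c, symmetric]) (auto intro!: detn_cong simp: part_def)
  qed
  finally show ?thesis .
qed (use c in simp)

text \<open>Here \<open>hs r k\<close> stands for \<phi>^r applied to \<open>hstar (k + r)\<close>,
  for both signs of \<open>r\<close>. The determinant arguments refer only to these properties, not
  to the automorphism or its inverse.\<close>

locale shift_family =
  fixes hs :: "int \<Rightarrow> int \<Rightarrow> sfun"
  assumes hs_0: "hs 0 k = hstar k"
    and hs_rec: "hs (r + 1) k = hs r (k + 1) + of_int (k + r) * hs r k"
    and hs_neg: "k + r < 0 \<Longrightarrow> hs r k = 0"
    and hs_diag: "hs r (- r) = 1"
    and hs_closed: "hs r k \<in> shifted_symmetric"
begin

text \<open>With \<open>m = n - 1 + k\<close>, one step of the recurrence multiplies the polynomial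
  \<open>ff m * ...\<close> by \<open>(y - m) + (k + r) = y + r - (n - 1)\<close>. This factor is
  independent of \<open>k\<close>, so under the functional a step in \<open>r\<close> is
  multiplication by a fixed linear polynomial.\<close>

lemma hs_times_vdet:
  assumes n: "n \<ge> 1" and k: "int n - 1 + k \<ge> 0"
  shows "hs (int r) k n * vdet (pts n) n
    = ldet (pts n) n (ff (nat (int n - 1 + k)) * (\<Prod>i<r. [:of_nat i - of_nat (n - 1), 1:]))"
  using k
proof (induction r arbitrary: k)
  case 0
  then show ?case using hstar_times_vdet[OF n] by (simp add: hs_0)
next
  case (Suc r)
  let ?Q = "\<Prod>i<r. [:of_nat i - of_nat (n - 1), 1:] :: cpoly poly"
  define m where "m = nat (int n - 1 + k)"
  have m: "nat (int n - 1 + (k + 1)) = Suc m" using Suc.prems by (simp add: m_def)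
  have km: "k = int m - int (n - 1)" using Suc.prems n by (simp add: m_def of_nat_diff)
  have "hs (int (Suc r)) k = hs (int r) (k + 1) + of_int (k + int r) * hs (int r) k"
    using hs_rec[of "int r" k] by (simp add: add.commute)
  then have "hs (int (Suc r)) k n * vdet (pts n) n
     = hs (int r) (k + 1) n * vdet (pts n) n + of_int (k + int r) * (hs (int r) k n * vdet (pts n) n)"
    by (simp only: plus_fun_apply times_fun_apply of_int_sfun_apply) (simp add: algebra_simps)
  also have "\<dots> = ldet (pts n) n (ff (Suc m) * ?Q) + of_int (k + int r) * ldet (pts n) n (ff m * ?Q)"
    using Suc.IH[of "k + 1"] Suc.IH[of k] Suc.prems unfolding m m_def[symmetric] by simp
  also have "\<dots> = ldet (pts n) n (ff (Suc m) * ?Q + Polynomial.smult (of_int (k + int r)) (ff m * ?Q))"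
    using n by (simp only: ldet_add ldet_smult)
  also have "ff (Suc m) * ?Q + Polynomial.smult (of_int (k + int r)) (ff m * ?Q)
     = ff m * (\<Prod>i<Suc r. [:of_nat i - of_nat (n - 1), 1:])"
  proof -
    have "[:0, 1:] - of_nat m + [:of_int (k + int r):] = [:of_nat r - of_nat (n - 1), 1 :: cpoly:]"
      unfolding km by (simp add: of_nat_poly)
    then have "ff m * (\<Prod>i<Suc r. [:of_nat i - of_nat (n - 1), 1:])
        = ff m * (?Q * ([:0, 1:] - of_nat m + [:of_int (k + int r):]))"
      by (simp only: prod.lessThan_Suc)
    also have "\<dots> = ff (Suc m) * ?Q + [:of_int (k + int r):] * (ff m * ?Q)"
      by (simp only: shifted_power_Suc distrib_left distrib_right mult_ac)
    also have "[:of_int (k + int r):] * (ff m * ?Q) = Polynomial.smult (of_int (k + int r)) (ff m * ?Q)"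
      by simp
    finally show ?thesis by (rule sym)
  qed
  finally show ?case by (simp add: m_def)
qed

text \<open>The case of no variables is treated apart, because \<open>ldet\<close> is linear only
  for \<open>n >= 1\<close>.\<close>

lemma hs_0_vars: "k > 0 \<Longrightarrow> hs (int r) k 0 = 0"
proof (induction r arbitrary: k)
  case (Suc r)
  have "hs (int (Suc r)) k = hs (int r) (k + 1) + of_int (k + int r) * hs (int r) k"
    using hs_rec[of "int r" k] by (simp add: add.commute)
  then show ?case using Suc by simp
qed (simp add: hs_0 hstar_0_vars)

text \<open>Evaluated in \<open>n\<close> variables, this is the statement that the functional kills multiples of
  the polynomial with roots \<open>pts n i\<close>, whose falling factorial coefficients are the \<open>e\<^sup>*\<close>.\<close>

lemma estar_hs_orthogonal:
  "(\<Sum>s\<le>Suc r. (-1) ^ s * estar (int s) * hs (int r) (1 - int s)) = 0"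
proof (rule ext)
  fix n
  have ap: "(\<Sum>s\<le>Suc r. (-1) ^ s * estar (int s) * hs (int r) (1 - int s)) n
      = (\<Sum>s\<le>Suc r. (-1) ^ s * estar (int s) n * hs (int r) (1 - int s) n)"
    by (simp only: sum_sfun_apply times_fun_apply power_sfun_apply uminus_apply one_fun_apply)
  have "(\<Sum>s\<le>Suc r. (-1) ^ s * estar (int s) n * hs (int r) (1 - int s) n) = 0"
  proof (cases "n = 0")
    case True
    \<comment> \<open>In no variables every \<open>estar\<close> of positive index vanishes, and the
      term \<open>s = 0\<close> is \<open>hs r 1\<close>, which vanishes as well.\<close>
    then show ?thesis
      by (subst sum.atMost_Suc_shift) (simp only: hs_0_vars estar_eq_0, simp add: hs_0_vars)
  next
    case False
    obtain c where c: "root_poly (pts n) n = (\<Sum>k\<le>n. Polynomial.smult (c k) (ff k))"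
        "c n = coeff (root_poly (pts n) n) n"
      by (rule ff_expansion[of "root_poly (pts n) n" n]) (simp, blast)
    have c1: "c n = 1" by (simp only: c(2) coeff_root_poly)
    let ?V = "vdet (pts n) n" and ?Q = "\<Prod>i<r. [:of_nat i - of_nat (n - 1), 1:] :: cpoly poly"
    \<comment> \<open>Both ranges contain all nonzero terms: \<open>hs r (1 - s)\<close> is zero for
      \<open>s > r + 1\<close>, and \<open>estar s\<close> is zero in fewer than \<open>s\<close>
      variables.\<close>
    have "(\<Sum>s\<le>Suc r. (-1) ^ s * estar (int s) n * hs (int r) (1 - int s) n)
        = (\<Sum>s\<le>n. (-1) ^ s * estar (int s) n * hs (int r) (1 - int s) n)"
    proof (rule sum.mono_neutral_cong)
      fix s assume "s \<in> {..n} - {..Suc r}"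
      then have "hs (int r) (1 - int s) = 0" by (intro hs_neg) auto
      then show "(-1) ^ s * estar (int s) n * hs (int r) (1 - int s) n = 0" by simp
    next
      fix s assume "s \<in> {..Suc r} - {..n}"
      then have "estar (int s) n = 0" by (intro estar_eq_0) auto
      then show "(-1) ^ s * estar (int s) n * hs (int r) (1 - int s) n = 0" by simp
    qed simp_all
    also have "\<dots> * ?V = (\<Sum>s\<le>n. c (n - s) * ldet (pts n) n (ff (n - s) * ?Q))"
      unfolding sum_distrib_right
    proof (intro sum.cong refl)
      fix s assume "s \<in> {..n}"
      then have s: "s \<le> n" by simp
      have "nat (int n - 1 + (1 - int s)) = n - s" using s by simp
      then have 1: "hs (int r) (1 - int s) n * ?V = ldet (pts n) n (ff (n - s) * ?Q)"
        using hs_times_vdet[of n "1 - int s" r] False s by simp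
      have 2: "(-1) ^ s * ((-1) ^ s * c (n - s)) = c (n - s)"
        by (simp flip: mult.assoc power_mult_distrib)
      show "(-1) ^ s * estar (int s) n * hs (int r) (1 - int s) n * ?V
          = c (n - s) * ldet (pts n) n (ff (n - s) * ?Q)"
        unfolding estar_eq_coeff[OF c(1) c1 s] 2 by (simp only: mult.assoc 1)
    qed
    also have "\<dots> = (\<Sum>k\<le>n. c k * ldet (pts n) n (ff k * ?Q))"
      by (rule sum.reindex_bij_witness[of _ "\<lambda>k. n - k" "\<lambda>k. n - k"]) auto
    also have "\<dots> = ldet (pts n) n (root_poly (pts n) n * ?Q)"
    proof -
      have "n \<ge> 1" using False by simp
      then show ?thesis
        unfolding c(1) sum_distrib_right mult_smult_left by (simp only: ldet_sum ldet_smult)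
    qed
    also have "\<dots> = 0"
      using False by (intro ldet_root_poly) simp
    finally show ?thesis using vdet_pts_nonzero[of n] by (simp only: mult_eq_0_iff) simp
  qed
  then show "(\<Sum>s\<le>Suc r. (-1) ^ s * estar (int s) * hs (int r) (1 - int s)) n = 0 n"
    by (simp only: ap zero_fun_apply)
qed

end

section \<open>The shifted Schur functions span the algebra\<close>

lemma sconst_add: "sconst (a + b) = sconst a + sconst b"
  by (simp add: sconst_def single_add fun_eq_iff)

lemma sconst_mult: "sconst (a * b) = sconst a * sconst b"
  by (simp add: sconst_def mult_single fun_eq_iff)

lemma sconst_0 [simp]: "sconst 0 = 0"
  by (simp add: sconst_def fun_eq_iff)

lemma sconst_1 [simp]: "sconst 1 = 1"
  by (simp add: sconst_def fun_eq_iff)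

lemma sconst_uminus: "sconst (- a) = - sconst a"
  using sconst_add[of "- a" a] by (simp add: eq_neg_iff_add_eq_0)

lemma sconst_of_nat: "sconst (of_nat k) = of_nat k"
  by (induction k) (simp_all add: sconst_add)

lemma sconst_of_int: "sconst (of_int k) = of_int k"
  by (cases k rule: int_cases2) (simp_all add: sconst_of_nat sconst_uminus)

text \<open>As rewrite rules these eta-expand the elements of the ring \<open>sfun\<close>.\<close>

declare plus_fun_apply [simp del] times_fun_apply [simp del] zero_fun_apply [simp del]
  one_fun_apply [simp del] numeral_fun_apply [simp del] of_nat_fun_apply [simp del]
  uminus_apply [simp del] minus_apply [simp del]

text \<open>Scalars act through constant families, so \<open>sfun.span\<close> is the complex linear
  span.\<close>

interpretation sfun: vector_space "\<lambda>c f. sconst c * f"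
  by unfold_locales (simp_all add: sconst_add sconst_mult algebra_simps)

lemma shifted_symmetric_0 [simp]: "0 \<in> shifted_symmetric"
  by (metis sconst_0 shifted_symmetric.const)

lemma shifted_symmetric_1 [simp]: "1 \<in> shifted_symmetric"
  by (metis sconst_1 shifted_symmetric.const)

lemma shifted_symmetric_scale: "f \<in> shifted_symmetric \<Longrightarrow> sconst c * f \<in> shifted_symmetric"
  by (intro shifted_symmetric.mult shifted_symmetric.const)

lemma shifted_symmetric_uminus: "f \<in> shifted_symmetric \<Longrightarrow> - f \<in> shifted_symmetric"
  using shifted_symmetric_scale[of f "- 1"] by (simp add: sconst_uminus)

lemma shifted_symmetric_of_int [simp]: "of_int k \<in> shifted_symmetric"
  by (metis sconst_of_int shifted_symmetric.const)

lemma shifted_symmetric_sum: "(\<And>i. i \<in> I \<Longrightarrow> f i \<in> shifted_symmetric) \<Longrightarrow> sum f I \<in> shifted_symmetric"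
  by (induction I rule: infinite_finite_induct) (auto intro: shifted_symmetric.add)

lemma shifted_symmetric_sign: "f \<in> shifted_symmetric \<Longrightarrow> (-1) ^ k * f \<in> shifted_symmetric"
  by (cases "even k") (auto intro: shifted_symmetric_uminus)

lemma detn_Suc:
  "detn (Suc n) A = (\<Sum>j=1..Suc n. (-1) ^ (1 + j) * (A 1 j * detn n (\<lambda>k l. A (skip 1 k) (skip j l))))"
proof -
  have "1 \<le> Suc n" by simp
  from detn_expand_row[OF order_refl this, of A] show ?thesis
    unfolding mult.assoc diff_Suc_1 .
qed

lemma shifted_symmetric_detn:
  "(\<And>i j. A i j \<in> shifted_symmetric) \<Longrightarrow> detn n A \<in> shifted_symmetric"
proof (induction n arbitrary: A)
  case (Suc n)
  have "(\<Sum>j=1..Suc n. (-1) ^ (1 + j) * (A 1 j * detn n (\<lambda>k l. A (skip 1 k) (skip j l)))) \<in> shifted_symmetric"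
    by (intro shifted_symmetric_sum shifted_symmetric_sign shifted_symmetric.mult Suc.prems Suc.IH)
  then show ?case unfolding detn_Suc .
qed simp

lemma span_mult_closed:
  assumes "f \<in> sfun.span S" "g \<in> sfun.span T" "\<And>s t. s \<in> S \<Longrightarrow> t \<in> T \<Longrightarrow> s * t \<in> sfun.span U"
  shows "f * g \<in> sfun.span U"
proof -
  have 1: "s * g \<in> sfun.span U" if "s \<in> S" for s
    using assms(2)
  proof (induction rule: sfun.span_induct_alt)
    case base
    then show ?case by (simp add: sfun.span_zero)
  next
    case (step c t g)
    have "s * (sconst c * t + g) = sconst c * (s * t) + s * g"
      by (simp add: algebra_simps)
    then show ?case
      using step assms(3)[OF that] by (simp add: sfun.span_add sfun.span_scale)
  qed
  show ?thesis
    using assms(1)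
  proof (induction rule: sfun.span_induct_alt)
    case base
    then show ?case by (simp add: sfun.span_zero)
  next
    case (step c s f)
    have "(sconst c * s + f) * g = sconst c * (s * g) + f * g"
      by (simp add: algebra_simps)
    then show ?case
      using step 1 by (simp add: sfun.span_add sfun.span_scale)
  qed
qed

text \<open>Since \<open>hstar 0 = 1\<close> may occur as a factor, products of fewer than
  \<open>n\<close> factors are included: this is the filtration by the number of factors.\<close>

definition hspan :: "nat \<Rightarrow> sfun set" where
  "hspan n = sfun.span {prod_list (map hstar \<mu>) | \<mu>. length \<mu> = n}"

lemma hspan_mult:
  assumes "f \<in> hspan a" "g \<in> hspan b"
  shows "f * g \<in> hspan (a + b)"
  using assms unfolding hspan_def
proof (rule span_mult_closed)
  fix s t
  assume "s \<in> {prod_list (map hstar \<mu>) | \<mu>. length \<mu> = a}" "t \<in> {prod_list (map hstar \<mu>) | \<mu>. length \<mu> = b}"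
  then obtain \<mu> \<nu> where "s = prod_list (map hstar \<mu>)" "length \<mu> = a"
     "t = prod_list (map hstar \<nu>)" "length \<nu> = b" by auto
  then have "s * t = prod_list (map hstar (\<mu> @ \<nu>)) \<and> length (\<mu> @ \<nu>) = a + b" by simp
  then show "s * t \<in> sfun.span {prod_list (map hstar \<mu>) | \<mu>. length \<mu> = a + b}"
    by (intro sfun.span_base) blast
qed

lemma one_in_hspan: "1 \<in> hspan 0"
  unfolding hspan_def by (rule sfun.span_base) simp

lemma hspan_1: "hspan 1 = sfun.span (range hstar)"
proof -
  have "{prod_list (map hstar \<mu>) | \<mu>. length \<mu> = 1} = range hstar"
    by (fastforce simp: length_Suc_conv image_iff intro: exI[of _ "[_]"])
  then show ?thesis unfolding hspan_def by simp
qed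

lemma span_sign: "f \<in> sfun.span S \<Longrightarrow> (-1) ^ k * f \<in> sfun.span S"
  by (cases "even k") (auto intro: sfun.span_neg)

lemma hspan_detn:
  "(\<And>i j. A i j \<in> hspan 1) \<Longrightarrow> detn n A \<in> hspan n"
proof (induction n arbitrary: A)
  case (Suc n)
  have "(-1) ^ (1 + j) * A 1 j * detn n (\<lambda>k l. A (skip 1 k) (skip j l)) \<in> hspan (Suc n)" for j
  proof -
    have "A 1 j * detn n (\<lambda>k l. A (skip 1 k) (skip j l)) \<in> hspan (1 + n)"
      by (intro hspan_mult Suc)
    then show ?thesis unfolding hspan_def mult.assoc by (intro span_sign) simp
  qed
  then have "(\<Sum>j=1..Suc n. (-1) ^ (1 + j) * A 1 j * detn n (\<lambda>k l. A (skip 1 k) (skip j l))) \<in> hspan (Suc n)"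
    unfolding hspan_def by (intro sfun.span_sum)
  then show ?case
    unfolding detn_Suc mult.assoc .
qed (simp add: one_in_hspan)

lemma shifted_symmetric_subset_hspan:
  "f \<in> shifted_symmetric \<Longrightarrow> f \<in> sfun.span (range (\<lambda>\<mu>. prod_list (map hstar \<mu>)))"
proof (induction rule: shifted_symmetric.induct)
  case (const c)
  have "1 \<in> range (\<lambda>\<mu>. prod_list (map hstar \<mu>))"
    by (rule image_eqI[of _ _ "[]"]) auto
  from sfun.span_scale[OF sfun.span_base[OF this], of c] show ?case by simp
next
  case (hstar r)
  have "hstar r \<in> range (\<lambda>\<mu>. prod_list (map hstar \<mu>))"
    by (rule image_eqI[of _ _ "[r]"]) auto
  then show ?case by (rule sfun.span_base)
next
  case (mult f g)
  show ?case
  proof (rule span_mult_closed[OF mult.IH])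
    fix s t assume "s \<in> range (\<lambda>\<mu>. prod_list (map hstar \<mu>))" "t \<in> range (\<lambda>\<mu>. prod_list (map hstar \<mu>))"
    then obtain \<mu> \<nu> where "s = prod_list (map hstar \<mu>)" "t = prod_list (map hstar \<nu>)" by auto
    then have "s * t = prod_list (map hstar (\<mu> @ \<nu>))" by simp
    then show "s * t \<in> sfun.span (range (\<lambda>\<mu>. prod_list (map hstar \<mu>)))"
      by (intro sfun.span_base) blast
  qed
qed (auto intro: sfun.span_add)

section \<open>Straightening, and spanning by Jacobi-Trudi determinants\<close>

context shift_family
begin

definition sv :: "int list \<Rightarrow> sfun" where
  "sv l = detn (length l) (\<lambda>i j. hs (int j - 1) (part l i - int i + 1))"

text \<open>The Jacobi-Trudi determinant in terms of its row indices instead of the parts: permuting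
  the list permutes the rows.\<close>

definition rows_det :: "int list \<Rightarrow> sfun" where
  "rows_det cs = detn (length cs) (\<lambda>i j. hs (int j - 1) (cs ! (i - 1)))"

lemma sv_eq_rows_det: "sv l = rows_det (map (\<lambda>i. l ! i - int i) [0..<length l])"
  unfolding sv_def rows_det_def by (auto intro!: detn_cong simp: part_def of_nat_diff algebra_simps)

text \<open>Each use of the recurrence keeps the top term and adds \<open>hstar\<close> of smaller
  index only. The second conjunct is what bounds the lower-order term in the induction.\<close>

lemma hs_leading:
  "hs (int r) k - hstar (k + int r) \<in> sfun.span (hstar ` {..<k + int r})
   \<and> hs (int r) k \<in> sfun.span (hstar ` {..k + int r})"
proof (induction r arbitrary: k)
  case 0
  then show ?case by (simp add: hs_0 sfun.span_zero sfun.span_base)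
next
  case (Suc r)
  have eq: "hs (int (Suc r)) k = hs (int r) (k + 1) + of_int (k + int r) * hs (int r) k"
    using hs_rec[of "int r" k] by (simp add: add.commute)
  have "of_int (k + int r) * hs (int r) k \<in> sfun.span (hstar ` {..k + int r})"
    using sfun.span_scale[of "hs (int r) k" _ "of_int (k + int r)"] Suc[of k]
    unfolding sconst_of_int by blast
  moreover have "{..k + int r} = {..<k + int (Suc r)}" by auto
  moreover have "hs (int r) (k + 1) - hstar (k + int (Suc r)) \<in> sfun.span (hstar ` {..<k + int (Suc r)})"
    using Suc[of "k + 1"] by (simp add: add_ac)
  ultimately have 1: "hs (int (Suc r)) k - hstar (k + int (Suc r)) \<in> sfun.span (hstar ` {..<k + int (Suc r)})"
    unfolding eq by (metis (no_types, lifting) add_diff_eq add.commute sfun.span_add)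
  have "hs (int (Suc r)) k - hstar (k + int (Suc r)) \<in> sfun.span (hstar ` {..k + int (Suc r)})"
    using 1 sfun.span_mono[OF image_mono[of "{..<k + int (Suc r)}" "{..k + int (Suc r)}" hstar]]
    by (meson lessThan_subset_iff less_imp_le lessThan_iff atMost_iff subset_iff)
  moreover have "hstar (k + int (Suc r)) \<in> sfun.span (hstar ` {..k + int (Suc r)})"
    by (intro sfun.span_base) auto
  ultimately have "hs (int (Suc r)) k \<in> sfun.span (hstar ` {..k + int (Suc r)})"
    using sfun.span_add by fastforce
  then show ?case using 1 by simp
qed

lemma hs_in_hspan: "hs (int r) k \<in> hspan 1"
  unfolding hspan_1 using hs_leading[of r k] sfun.span_mono[OF image_mono[of _ UNIV hstar]] by blast

definition sspan :: "nat \<Rightarrow> sfun set" where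
  "sspan n = sfun.span {sv l | l. is_partition l \<and> length l = n}"

text \<open>Straightening: sorting the rows changes only the sign, and a strictly decreasing sequence of
  row indices whose last one is too small makes the last row vanish.\<close>

lemma rows_det_in_sspan: "rows_det cs \<in> sspan (length cs)"
proof -
  define n where "n = length cs"
  show ?thesis
  proof (cases "distinct cs")
    case False
    then obtain i j where ij: "i < n" "j < n" "i \<noteq> j" "cs ! i = cs ! j"
      unfolding distinct_conv_nth n_def by blast
    then have "rows_det cs = 0"
      unfolding rows_det_def n_def by (intro detn_identical_rows[of "Suc i" _ "Suc j"]) auto
    then show ?thesis by (simp add: sspan_def sfun.span_zero)
  next
    case True
    define ds where "ds = rev (sort cs)"
    have len: "length ds = n" by (simp add: ds_def n_def)
    have "mset ds = mset cs" by (simp add: ds_def)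
    then obtain p where p: "p permutes {..<n}" "permute_list p cs = ds"
      using mset_eq_permutation[of ds cs] n_def by metis
    have "rows_det ds = detn n (\<lambda>i j. hs (int j - 1) (cs ! (Suc (p (i - 1)) - 1)))"
      unfolding rows_det_def len
      by (intro detn_cong) (auto simp: p(2)[symmetric] permute_list_nth n_def[symmetric] p(1))
    also have "\<dots> = signof p * rows_det cs"
      unfolding rows_det_def n_def[symmetric]
      by (rule detn_permute_rows) (use p(1) in \<open>simp add: atLeast0LessThan\<close>)
    finally have eq: "rows_det cs = rows_det ds \<or> rows_det cs = - rows_det ds"
      by (auto simp: sign_def split: if_splits)
    have strict: "ds ! j < ds ! i" if "i < j" "j < n" for i j
    proof -
      have "distinct ds" using True by (simp add: ds_def)
      then have "ds ! i \<noteq> ds ! j" using that len by (simp add: nth_eq_iff_index_eq)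
      moreover have "sorted (rev ds)" by (simp add: ds_def)
      then have "ds ! i \<ge> ds ! j"
        using that len by (intro sorted_rev_nth_mono) auto
      ultimately show ?thesis by simp
    qed
    \<comment> \<open>Strictly decreasing integers stay weakly decreasing after adding the position;
      the numbers \<open>ds ! i + i\<close> will be the parts of the partition.\<close>
    have gap: "ds ! j + int j \<le> ds ! i + int i" if "i \<le> j" "j < n" for i j
      using that
    proof (induction j rule: dec_induct)
      case (step j)
      then show ?case using strict[of j "Suc j"] by simp
    qed simp
    have "rows_det ds \<in> sspan n"
    \<comment> \<open>The last row has its largest degree in its last column, namely the tested
      number; if that is negative the whole row vanishes, otherwise all parts are
      nonnegative.\<close>
    proof (cases "n > 0 \<and> ds ! (n - 1) + int (n - 1) < 0")
      case True
      then have "hs (int j - 1) (ds ! (n - 1)) = 0" if "j \<le> n" for j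
        using that by (intro hs_neg) auto
      then have "rows_det ds = 0"
        unfolding rows_det_def len using True
        by (subst detn_expand_row[of n]) (auto intro!: sum.neutral)
      then show ?thesis by (simp add: sspan_def sfun.span_zero)
    next
      case False
      define l where "l = map (\<lambda>i. ds ! i + int i) [0..<n]"
      have "ds = map (\<lambda>i. l ! i - int i) [0..<length l]"
        using len by (intro nth_equalityI) (auto simp: l_def)
      then have "rows_det ds = sv l"
        unfolding sv_eq_rows_det by simp
      moreover have "is_partition l"
      proof -
        have "sorted_wrt (\<ge>) l"
          unfolding sorted_wrt_iff_nth_less using gap by (auto simp: l_def)
        moreover have "a \<ge> 0" if "a \<in> set l" for a
        proof -
          from that obtain i where i: "a = ds ! i + int i" "i < n" by (auto simp: l_def)
          then have "ds ! (n - 1) + int (n - 1) \<le> a" using gap[of i "n - 1"] by simp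
          then show ?thesis using False i(2) by linarith
        qed
        ultimately show ?thesis by (auto simp: is_partition_def)
      qed
      moreover have "length l = n" by (simp add: l_def)
      ultimately show ?thesis unfolding sspan_def by (intro sfun.span_base) blast
    qed
    then show ?thesis using eq by (auto simp: n_def sspan_def intro: sfun.span_neg)
  qed
qed

lemma sv_in_sspan: "sv l \<in> sspan (length l)"
  using rows_det_in_sspan[of "map (\<lambda>i. l ! i - int i) [0..<length l]"] by (simp add: sv_eq_rows_det)

lemma minor_in_hspan:
  assumes "\<And>l. l \<ge> 1 \<Longrightarrow> f l \<ge> 1"
  shows "detn n (\<lambda>k l. hs (int (f l) - 1) (g k)) \<in> hspan n"
proof -
  \<comment> \<open>\<open>hspan_detn\<close> asks for all entries, including those outside the
    matrix; \<open>max 1 l\<close> makes the upper index a natural number there too.\<close>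
  have "detn n (\<lambda>k l. hs (int (f l) - 1) (g k)) = detn n (\<lambda>k l. hs (int (f (max 1 l) - 1)) (g k))"
    using assms by (intro detn_cong) (simp add: max_def of_nat_diff)
  also have "\<dots> \<in> hspan n"
    by (intro hspan_detn hs_in_hspan)
  finally show ?thesis .
qed

text \<open>Outer induction on the number of factors, inner induction on the index \<open>a\<close>
  of the additional factor. Expanding the determinant of \<open>l @ [a]\<close> along its last row
  gives \<open>hstar a * sv l\<close> plus products of \<open>hstar\<close> of index below
  \<open>a\<close> with elements of \<open>hspan n\<close>.\<close>

lemma hspan_subset_sspan: "hspan n \<subseteq> sspan n"
proof (induction n)
  case 0
  have "sv [] = 1" by (simp add: sv_def)
  then have "1 \<in> sspan 0"
    using sv_in_sspan[of "[]"] by simp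
  then show ?case
    unfolding hspan_def sspan_def by (intro sfun.span_minimal) auto
next
  case (Suc n)
  \<comment> \<open>The inner induction runs over all \<open>g\<close> in \<open>hspan n\<close>,
    since the minors met in the expansion are not themselves values of \<open>sv\<close>.\<close>
  have main: "hstar a * g \<in> sspan (Suc n)" if "g \<in> hspan n" for a g
    using that
  proof (induction "nat (a + 1)" arbitrary: a g rule: less_induct)
    case (less a g)
    show ?case
    proof (cases "a < 0")
      case True
      then show ?thesis by (simp add: hstar_def sspan_def sfun.span_zero)
    next
      case False
      have low: "f * g \<in> sspan (Suc n)" if "f \<in> sfun.span (hstar ` {..<a})" "g \<in> hspan n" for f g
        unfolding sspan_def
      proof (rule span_mult_closed[OF that(1)])
        show "g \<in> sfun.span (hspan n)" using that(2) by (rule sfun.span_base)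
        fix s t assume "s \<in> hstar ` {..<a}" "t \<in> hspan n"
        then show "s * t \<in> sfun.span {sv l | l. is_partition l \<and> length l = Suc n}"
          using less.hyps False unfolding sspan_def by auto
      qed
      have base: "hstar a * sv l \<in> sspan (Suc n)" if "length l = n" for l
      proof -
        define M where "M = (\<lambda>j. detn n (\<lambda>k m. hs (int (skip j m) - 1) (part l k - int k + 1)))"
        have M: "M j \<in> hspan n" if "j \<ge> 1" for j
          unfolding M_def by (rule minor_in_hspan) (use that in \<open>auto simp: skip_def\<close>)
        have svl: "sv l = M (Suc n)"
          unfolding sv_def M_def that by (intro detn_cong) (auto simp: skip_def)
        \<comment> \<open>The list \<open>l @ [a]\<close> need not be a partition; straightening
          still places its determinant in \<open>sspan (Suc n)\<close>.\<close>
        define A where "A = (\<lambda>i j. hs (int j - 1) (part (l @ [a]) i - int i + 1))"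
        have A: "A (Suc n) j = hs (int j - 1) (a - int n)" for j
          by (simp add: A_def part_def that nth_append)
        have minor: "detn n (\<lambda>k m. A (skip (Suc n) k) (skip j m)) = M j" for j
          unfolding M_def A_def by (intro detn_cong) (auto simp: skip_def part_def nth_append that)
        have "sv (l @ [a]) = detn (Suc n) A"
          by (simp add: sv_def A_def that)
        also have "\<dots> = (\<Sum>j=1..Suc n. (-1) ^ (Suc n + j) * hs (int j - 1) (a - int n) * M j)"
          by (rule detn_expand_row[of "Suc n" "Suc n" A, unfolded diff_Suc_1 minor A]) simp_all
        finally have exp: "sv (l @ [a]) = (\<Sum>j=1..Suc n. (-1) ^ (Suc n + j) * hs (int j - 1) (a - int n) * M j)" .
        \<comment> \<open>Column \<open>j\<close> of the last row has leading term
          \<open>hstar (a - n + j - 1)\<close>, so the columns up to \<open>n\<close> involve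
          indices below \<open>a\<close> only.\<close>
        define R where "R = (\<Sum>j=1..n. (-1) ^ (Suc n + j) * hs (int j - 1) (a - int n) * M j)"
        have sgn: "(-1 :: sfun) ^ (Suc n + Suc n) = 1"
          by (simp add: minus_one_power_iff)
        have "sv (l @ [a]) = R + hs (int n) (a - int n) * sv l"
          unfolding exp R_def svl by (subst sum.cl_ivl_Suc) (simp add: sgn del: power_Suc add_Suc add_Suc_right)
        then have eq: "hstar a * sv l = sv (l @ [a]) - R - (hs (int n) (a - int n) - hstar a) * sv l"
          by (simp add: algebra_simps)
        have mem1: "(hs (int n) (a - int n) - hstar a) * sv l \<in> sspan (Suc n)"
        proof (rule low)
          show "hs (int n) (a - int n) - hstar a \<in> sfun.span (hstar ` {..<a})"
            using hs_leading[of n "a - int n"] by simp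
          show "sv l \<in> hspan n" unfolding svl by (rule M) simp
        qed
        have mem2: "sv (l @ [a]) \<in> sspan (Suc n)"
          using sv_in_sspan[of "l @ [a]"] that by simp
        have mem3: "R \<in> sspan (Suc n)"
          unfolding R_def sspan_def
        proof (rule sfun.span_sum)
          fix j assume j: "j \<in> {1..n}"
          have e: "int j - 1 = int (j - 1)" using j by (simp add: of_nat_diff)
          have "{..a - int n + int (j - 1)} \<subseteq> {..<a}" using j by auto
          then have "hs (int j - 1) (a - int n) \<in> sfun.span (hstar ` {..<a})"
            using hs_leading[of "j - 1" "a - int n"] sfun.span_mono[OF image_mono]
            unfolding e by blast
          then have "hs (int j - 1) (a - int n) * M j \<in> sspan (Suc n)"
            by (rule low) (use j M in simp)
          then show "(-1) ^ (Suc n + j) * hs (int j - 1) (a - int n) * M j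
              \<in> sfun.span {sv l | l. is_partition l \<and> length l = Suc n}"
            unfolding sspan_def mult.assoc by (rule span_sign)
        qed
        show ?thesis
          using mem1 mem2 mem3 unfolding eq sspan_def by (intro sfun.span_diff)
      qed
      have "g \<in> sspan n" using less.prems Suc by auto
      then have g: "g \<in> sfun.span {sv l | l. is_partition l \<and> length l = n}"
        unfolding sspan_def .
      have "hstar a * g \<in> sfun.span (sspan (Suc n))"
      proof (rule span_mult_closed[OF _ g])
        show "hstar a \<in> sfun.span {hstar a}" by (rule sfun.span_base) simp
        fix s t assume "s \<in> {hstar a}" "t \<in> {sv l | l. is_partition l \<and> length l = n}"
        then show "s * t \<in> sfun.span (sspan (Suc n))"
          using base sfun.span_base by blast
      qed
      then show ?thesis unfolding sspan_def sfun.span_span .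
    qed
  qed
  show ?case
    unfolding hspan_def[of "Suc n"] sspan_def[of "Suc n"]
  proof (rule sfun.span_minimal)
    show "{prod_list (map hstar \<mu>) | \<mu>. length \<mu> = Suc n} \<subseteq> sfun.span {sv l | l. is_partition l \<and> length l = Suc n}"
    proof safe
      fix \<mu> :: "int list" assume "length \<mu> = Suc n"
      then obtain a \<nu> where \<mu>: "\<mu> = a # \<nu>" "length \<nu> = n" by (cases \<mu>) auto
      then have "prod_list (map hstar \<nu>) \<in> hspan n"
        unfolding hspan_def by (intro sfun.span_base) auto
      then show "prod_list (map hstar \<mu>) \<in> sfun.span {sv l | l. is_partition l \<and> length l = Suc n}"
        using main[of _ a] unfolding sspan_def by (simp add: \<mu>)
    qed
  qed (rule sfun.subspace_span)
qed

lemma sv_closed: "sv l \<in> shifted_symmetric"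
  unfolding sv_def by (rule shifted_symmetric_detn) (rule hs_closed)

text \<open>The operators are prescribed only on the determinants \<open>sv l\<close> and extended
  linearly; as these span, identities linear in the argument can be checked on them.\<close>

lemma shifted_symmetric_sv_induct [consumes 1, case_names sv add scale]:
  assumes f: "f \<in> shifted_symmetric"
    and sv: "\<And>l. is_partition l \<Longrightarrow> P (sv l)"
    and add: "\<And>f g. f \<in> shifted_symmetric \<Longrightarrow> g \<in> shifted_symmetric \<Longrightarrow> P f \<Longrightarrow> P g \<Longrightarrow> P (f + g)"
    and scale: "\<And>c f. f \<in> shifted_symmetric \<Longrightarrow> P f \<Longrightarrow> P (sconst c * f)"
  shows "P f"
proof -
  have "range (\<lambda>\<mu>. prod_list (map hstar \<mu>)) \<subseteq> sfun.span {sv l | l. is_partition l}"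
  proof safe
    fix \<mu> :: "int list"
    have "prod_list (map hstar \<mu>) \<in> hspan (length \<mu>)"
      unfolding hspan_def by (intro sfun.span_base) auto
    then have "prod_list (map hstar \<mu>) \<in> sspan (length \<mu>)"
      using hspan_subset_sspan by auto
    then show "prod_list (map hstar \<mu>) \<in> sfun.span {sv l | l. is_partition l}"
      unfolding sspan_def
      using sfun.span_mono[of "{sv l | l. is_partition l \<and> length l = length \<mu>}" "{sv l | l. is_partition l}"]
      by auto
  qed
  then have "f \<in> sfun.span {sv l | l. is_partition l}"
    using shifted_symmetric_subset_hspan[OF f] sfun.span_minimal[OF _ sfun.subspace_span] by blast
  then have "f \<in> shifted_symmetric \<and> P f"
  proof (induction rule: sfun.span_induct_alt)
    case base
    \<comment> \<open>The zero vector is obtained as 0 times the determinant of the empty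
      partition.\<close>
    have "is_partition []" by (simp add: is_partition_def)
    then show ?case using scale[OF sv_closed sv, of "[]" 0] by simp
  next
    case (step c s g)
    then show ?case
      by (auto intro: add scale sv sv_closed shifted_symmetric_scale shifted_symmetric.add)
  qed
  then show ?thesis by simp
qed

end

section \<open>Realization of the family by powers of the automorphism\<close>

locale shift_automorphism =
  fixes \<phi> :: "sfun \<Rightarrow> sfun"
  assumes shift: "is_shift_automorphism \<phi>"
begin

definition inv_phi :: "sfun \<Rightarrow> sfun" where
  "inv_phi = the_inv_into shifted_symmetric \<phi>"

lemma bij: "bij_betw \<phi> shifted_symmetric shifted_symmetric"
  using shift by (simp add: is_shift_automorphism_def)

lemma phi_closed: "f \<in> shifted_symmetric \<Longrightarrow> \<phi> f \<in> shifted_symmetric"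
  using bij bij_betwE by blast

lemma phi_add: "f \<in> shifted_symmetric \<Longrightarrow> g \<in> shifted_symmetric \<Longrightarrow> \<phi> (f + g) = \<phi> f + \<phi> g"
  and phi_mult: "f \<in> shifted_symmetric \<Longrightarrow> g \<in> shifted_symmetric \<Longrightarrow> \<phi> (f * g) = \<phi> f * \<phi> g"
  and phi_const: "\<phi> (sconst c) = sconst c"
  and phi_hstar: "\<phi> (hstar k) = hstar k + of_int (k - 1) * hstar (k - 1)"
  using shift by (auto simp: is_shift_automorphism_def)

lemma inv_closed: "f \<in> shifted_symmetric \<Longrightarrow> inv_phi f \<in> shifted_symmetric"
  unfolding inv_phi_def using bij_betw_the_inv_into[OF bij] bij_betwE by blast

lemma phi_inv: "f \<in> shifted_symmetric \<Longrightarrow> \<phi> (inv_phi f) = f"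
  unfolding inv_phi_def by (rule f_the_inv_into_f_bij_betw[OF bij])

lemma inv_phi: "f \<in> shifted_symmetric \<Longrightarrow> inv_phi (\<phi> f) = f"
  unfolding inv_phi_def using bij by (intro the_inv_into_f_f) (auto simp: bij_betw_def)

lemma phi_of_int: "\<phi> (of_int k) = of_int k"
  by (metis phi_const sconst_of_int)

lemma phi_lin:
  "f \<in> shifted_symmetric \<Longrightarrow> g \<in> shifted_symmetric \<Longrightarrow> \<phi> (f + of_int k * g) = \<phi> f + of_int k * \<phi> g"
  by (simp add: phi_add phi_mult phi_of_int shifted_symmetric.mult)

lemma inv_lin:
  "f \<in> shifted_symmetric \<Longrightarrow> g \<in> shifted_symmetric \<Longrightarrow> inv_phi (f + of_int k * g) = inv_phi f + of_int k * inv_phi g"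
  using inv_phi[of "inv_phi f + of_int k * inv_phi g"]
  by (simp add: phi_lin phi_inv inv_closed shifted_symmetric.add shifted_symmetric.mult)

lemma phi_pow: "f \<in> shifted_symmetric \<Longrightarrow> (\<phi> ^^ r) f \<in> shifted_symmetric"
  by (induction r) (auto simp: phi_closed)

lemma inv_pow: "f \<in> shifted_symmetric \<Longrightarrow> (inv_phi ^^ r) f \<in> shifted_symmetric"
  by (induction r) (auto simp: inv_closed)

lemma phi_pow_lin: "f \<in> shifted_symmetric \<Longrightarrow> g \<in> shifted_symmetric \<Longrightarrow>
   (\<phi> ^^ r) (f + of_int k * g) = (\<phi> ^^ r) f + of_int k * (\<phi> ^^ r) g"
  by (induction r) (auto simp: phi_lin phi_pow)

lemma inv_pow_lin: "f \<in> shifted_symmetric \<Longrightarrow> g \<in> shifted_symmetric \<Longrightarrow>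
   (inv_phi ^^ r) (f + of_int k * g) = (inv_phi ^^ r) f + of_int k * (inv_phi ^^ r) g"
  by (induction r) (auto simp: inv_lin inv_pow)

lemma inv_phi_of_int: "inv_phi (of_int k) = of_int k"
  by (metis inv_phi phi_of_int shifted_symmetric_of_int)

lemma pow_of_int: "(\<phi> ^^ r) (of_int k) = of_int k" "(inv_phi ^^ r) (of_int k) = of_int k"
  by (induction r) (auto simp: phi_of_int inv_phi_of_int)

text \<open>The recurrence is the \<open>r\<close>-th power of \<phi> applied to the defining
  relation for \<phi> on \<open>hstar (k + r + 1)\<close>. For negative \<open>r\<close> the power
  is one of \<open>inv_phi\<close>, and \<phi> cancels one of its factors.\<close>

sublocale shift_family "hshift \<phi>"
proof
  fix k r :: int
  show "hshift \<phi> 0 k = hstar k"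
    by (simp add: hshift_def)
  show "hshift \<phi> r k \<in> shifted_symmetric"
    unfolding hshift_def inv_phi_def[symmetric]
    by (simp add: phi_pow inv_pow shifted_symmetric.hstar)
  have "(\<phi> ^^ n) 0 = 0" "(inv_phi ^^ n) 0 = 0" "(\<phi> ^^ n) 1 = 1" "(inv_phi ^^ n) 1 = 1" for n
    using pow_of_int[of n 0] pow_of_int[of n 1] by simp_all
  then show "hshift \<phi> r (- r) = 1" "k + r < 0 \<Longrightarrow> hshift \<phi> r k = 0"
    by (simp_all add: hshift_def hstar_def inv_phi_def[symmetric])
  have hstar_eq: "\<phi> (hstar (k + r + 1)) = hstar (k + 1 + r) + of_int (k + r) * hstar (k + r)"
    by (simp add: phi_hstar add_ac)
  show "hshift \<phi> (r + 1) k = hshift \<phi> r (k + 1) + of_int (k + r) * hshift \<phi> r k"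
  proof (cases "r \<ge> 0")
    case True
    then have "nat (r + 1) = Suc (nat r)" by simp
    then have "hshift \<phi> (r + 1) k = (\<phi> ^^ nat r) (\<phi> (hstar (k + r + 1)))"
      using True by (simp add: hshift_def funpow_swap1 add_ac)
    then show ?thesis
      unfolding hstar_eq using True by (simp add: hshift_def phi_pow_lin shifted_symmetric.hstar add_ac del: of_int_add)
  next
    case False
    \<comment> \<open>With \<open>r = - (q + 1)\<close>, the left-hand side involves
      \<open>q\<close> inverses and the right-hand side \<open>q + 1\<close> of them.\<close>
    define q where "q = nat (- (r + 1))"
    have q: "nat (- r) = Suc q" using False by (simp add: q_def)
    have "hshift \<phi> (r + 1) k = (inv_phi ^^ q) (hstar (k + r + 1))"
    proof (cases "r + 1 = 0")
      case True
      then have r: "r = - 1" by simp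
      show ?thesis by (simp add: hshift_def q_def r)
    qed (use False in \<open>simp add: hshift_def q_def inv_phi_def add_ac\<close>)
    also have "\<dots> = (inv_phi ^^ Suc q) (\<phi> (hstar (k + r + 1)))"
      by (simp add: funpow_swap1 inv_phi shifted_symmetric.hstar phi_closed)
    finally show ?thesis
      unfolding hstar_eq q[symmetric]
      using False by (simp add: hshift_def inv_pow_lin shifted_symmetric.hstar inv_phi_def[symmetric] add_ac del: of_int_add)
  qed
qed

lemma sv_eq: "sv = svec \<phi>"
  by (auto simp: sv_def svec_def)

end

section \<open>Coefficients of the operators\<close>

definition int_sign :: "int \<Rightarrow> 'a :: ring_1" where
  "int_sign k = (if even k then 1 else - 1)"

lemma int_sign_add_1: "int_sign (k + 1) = - int_sign k"
  by (simp add: int_sign_def)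

lemma int_sign_of_nat: "int_sign (int k) = (-1) ^ k"
  by (simp add: int_sign_def minus_one_power_iff)

text \<open>The counterpart of \<open>hs\<close> for \<open>estar\<close>: same recurrence, with
  \<open>estar\<close> as initial family.\<close>

primrec estar_shift :: "nat \<Rightarrow> int \<Rightarrow> sfun" where
  "estar_shift 0 a = estar a"
| "estar_shift (Suc p) a = estar_shift p (a + 1) + of_int (a + int p) * estar_shift p a"

lemma estar_shift_neg: "a + int p < 0 \<Longrightarrow> estar_shift p a = 0"
  by (induction p arbitrary: a) auto

text \<open>The entries of the inverse of the matrix \<open>hs (- q - 1) c\<close>. For
  \<open>p = 0\<close> they are the signed \<open>estar\<close>, as in the classical relation H(t)
  E(-t) = 1.\<close>

definition dual_coeff :: "nat \<Rightarrow> int \<Rightarrow> sfun" where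
  "dual_coeff p c = int_sign (int p + 1 - c) * estar_shift p (1 - c)"

lemma dual_coeff_eq_0: "c > int p + 1 \<Longrightarrow> dual_coeff p c = 0"
  by (simp add: dual_coeff_def estar_shift_neg)

lemma dual_coeff_0: "dual_coeff 0 c = int_sign (1 - c) * estar (1 - c)"
  by (simp add: dual_coeff_def)

lemma dual_coeff_Suc:
  "dual_coeff (Suc p) c = dual_coeff p (c - 1) - of_int (int p + 1 - c) * dual_coeff p c"
proof -
  have "int_sign (int (Suc p) + 1 - c) = (- int_sign (int p + 1 - c) :: sfun)"
    using int_sign_add_1[of "int p + 1 - c", where 'a = sfun] by (simp add: algebra_simps)
  moreover have "int_sign (int p + 1 - (c - 1)) = (- int_sign (int p + 1 - c) :: sfun)"
    using int_sign_add_1[of "int p + 1 - c", where 'a = sfun] by (simp add: algebra_simps)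
  moreover have "1 - c + 1 = 1 - (c - 1)" "1 - c + int p = int p + 1 - c" by simp_all
  ultimately show ?thesis
    unfolding dual_coeff_def estar_shift.simps by (simp only: ring_distribs minus_mult_left mult_ac) (simp add: mult_ac)
qed

context shift_family
begin

text \<open>Nonzero terms need \<open>q + 1 <= c <= 1\<close>. This range is empty for
  \<open>q > 0\<close>, a single point for \<open>q = 0\<close>, and for \<open>q < 0\<close> it
  gives the orthogonality relation with \<open>r = - q - 1\<close>. Any window containing the range
  is allowed, so that windows can be shifted later.\<close>

lemma hs_dual_coeff_0:
  assumes "lo \<le> q + 1" "hi \<ge> 1"
  shows "(\<Sum>c=lo..hi. hs (- q - 1) c * dual_coeff 0 c) = (if q = 0 then 1 else 0)"
proof -
  have "(\<Sum>c=lo..hi. hs (- q - 1) c * dual_coeff 0 c) = (\<Sum>c=q+1..1. hs (- q - 1) c * dual_coeff 0 c)"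
  proof (rule sum.mono_neutral_right)
    show "\<forall>c\<in>{lo..hi} - {q + 1..1}. hs (- q - 1) c * dual_coeff 0 c = 0"
    proof
      fix c assume "c \<in> {lo..hi} - {q + 1..1}"
      then have "c < q + 1 \<or> c > 1" by auto
      then show "hs (- q - 1) c * dual_coeff 0 c = 0"
        by (auto simp: hs_neg dual_coeff_eq_0)
    qed
  qed (use assms in auto)
  also have "\<dots> = (if q = 0 then 1 else 0)"
  proof (cases q "0 :: int" rule: linorder_cases)
    case less
    define r where "r = nat (- q - 1)"
    have r: "- q - 1 = int r" using less by (simp add: r_def)
    have "(\<Sum>c=q+1..1. hs (- q - 1) c * dual_coeff 0 c)
        = (\<Sum>s\<le>Suc r. (-1) ^ s * estar (int s) * hs (int r) (1 - int s))"
    proof (rule sum.reindex_bij_witness[of _ "\<lambda>s. 1 - int s" "\<lambda>c. nat (1 - c)"])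
      fix c assume "c \<in> {q + 1..1}"
      then have c: "int (nat (1 - c)) = 1 - c" by simp
      show "(-1) ^ nat (1 - c) * estar (int (nat (1 - c))) * hs (int r) (1 - int (nat (1 - c)))
          = hs (- q - 1) c * dual_coeff 0 c"
        unfolding dual_coeff_0 r int_sign_of_nat[symmetric] c by (simp add: mult_ac)
    qed (use less in \<open>auto simp: r_def\<close>)
    then show ?thesis using estar_hs_orthogonal[of r] less by simp
  next
    case equal
    then show ?thesis using hs_diag[of "- 1"] by (simp add: dual_coeff_0 int_sign_def)
  qed simp
  finally show ?thesis .
qed

text \<open>Induction on \<open>p\<close> by summation by parts: the shift in
  \<open>dual_coeff p (c - 1)\<close> moves to \<open>hs\<close>, where the recurrence replaces
  \<open>q\<close> by \<open>q - 1\<close>. The two leftover sums have factors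
  \<open>c - q - 1\<close> and \<open>p + 1 - c\<close>, which add up to the constant
  \<open>p - q\<close>; this kills the remaining Kronecker delta.\<close>

lemma hs_dual_coeff:
  assumes "lo \<le> q + 1" "hi \<ge> int p + 1"
  shows "(\<Sum>c=lo..hi. hs (- q - 1) c * dual_coeff p c) = (if q = int p then 1 else 0)"
  using assms
proof (induction p arbitrary: q lo hi)
  case 0
  then show ?case using hs_dual_coeff_0[of lo q hi] by simp
next
  case (Suc p)
  let ?I = "{lo - 1..hi - 1}"
  have "(\<Sum>c=lo..hi. hs (- q - 1) c * dual_coeff p (c - 1))
      = (\<Sum>c\<in>?I. hs (- q - 1) (c + 1) * dual_coeff p c)"
    by (rule sum.reindex_bij_witness[of _ "\<lambda>c. c + 1" "\<lambda>c. c - 1"]) auto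
  also have "\<dots> = (\<Sum>c\<in>?I. hs (- (q - 1) - 1) c * dual_coeff p c)
      - (\<Sum>c\<in>?I. of_int (c - q - 1) * (hs (- q - 1) c * dual_coeff p c))"
    unfolding sum_subtractf[symmetric]
  proof (intro sum.cong refl)
    fix c
    have "hs (- (q - 1) - 1) c = hs (- q - 1) (c + 1) + of_int (c - q - 1) * hs (- q - 1) c"
      using hs_rec[of "- q - 1" c] by (simp add: algebra_simps del: of_int_add of_int_diff)
    then show "hs (- q - 1) (c + 1) * dual_coeff p c
       = hs (- (q - 1) - 1) c * dual_coeff p c - of_int (c - q - 1) * (hs (- q - 1) c * dual_coeff p c)"
      by (simp add: algebra_simps del: of_int_add of_int_diff)
  qed
  finally have 1: "(\<Sum>c=lo..hi. hs (- q - 1) c * dual_coeff p (c - 1))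
     = (if q - 1 = int p then 1 else 0)
       - (\<Sum>c\<in>?I. of_int (c - q - 1) * (hs (- q - 1) c * dual_coeff p c))"
    using Suc.IH[of "lo - 1" "q - 1" "hi - 1"] Suc.prems by simp
  have "(\<Sum>c=lo..hi. of_int (int p + 1 - c) * (hs (- q - 1) c * dual_coeff p c))
      = (\<Sum>c\<in>?I. of_int (int p + 1 - c) * (hs (- q - 1) c * dual_coeff p c))"
  proof (rule sum.mono_neutral_cong)
    fix c assume "c \<in> ?I - {lo..hi}"
    then have "hs (- q - 1) c = 0" using Suc.prems by (intro hs_neg) auto
    then show "of_int (int p + 1 - c) * (hs (- q - 1) c * dual_coeff p c) = 0" by simp
  next
    fix c assume "c \<in> {lo..hi} - ?I"
    then have "dual_coeff p c = 0" using Suc.prems by (intro dual_coeff_eq_0) auto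
    then show "of_int (int p + 1 - c) * (hs (- q - 1) c * dual_coeff p c) = 0" by simp
  qed simp_all
  then have "(\<Sum>c=lo..hi. hs (- q - 1) c * dual_coeff (Suc p) c)
    = (if q - 1 = int p then 1 else 0)
       - ((\<Sum>c\<in>?I. of_int (c - q - 1) * (hs (- q - 1) c * dual_coeff p c))
       + (\<Sum>c\<in>?I. of_int (int p + 1 - c) * (hs (- q - 1) c * dual_coeff p c)))"
    using 1 unfolding dual_coeff_Suc right_diff_distrib sum_subtractf mult.left_commute[of "hs _ _" "of_int _"]
    by (simp only: diff_diff_eq)
  also have "(\<Sum>c\<in>?I. of_int (c - q - 1) * (hs (- q - 1) c * dual_coeff p c))
       + (\<Sum>c\<in>?I. of_int (int p + 1 - c) * (hs (- q - 1) c * dual_coeff p c))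
     = of_int (int p - q) * (\<Sum>c\<in>?I. hs (- q - 1) c * dual_coeff p c)"
    unfolding sum_distrib_left sum.distrib[symmetric]
    by (intro sum.cong refl) (simp only: distrib_right[symmetric] of_int_add[symmetric], simp)
  also have "\<dots> = 0"
    using Suc.IH[of "lo - 1" q "hi - 1"] Suc.prems by simp
  finally show ?case by auto
qed

text \<open>The matrix of the \<open>hs (- q - 1) c\<close> is unitriangular, so the one-sided inverse relation
  \<open>hs_dual_coeff\<close> suffices to invert it.\<close>

lemma hs_inversion:
  fixes Y Z :: "int \<Rightarrow> sfun"
  assumes Y: "\<And>c. c > c0 \<Longrightarrow> Y c = 0"
    and Z: "\<And>q. Z q = (\<Sum>c=q+1..c0. hs (- q - 1) c * Y c)"
    and Z_neg: "\<And>q. q < 0 \<Longrightarrow> Z q = 0"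
    and P: "c0 \<le> int P + 1"
  shows "Y c = (\<Sum>p\<le>P. dual_coeff p c * Z (int p))"
proof -
  \<comment> \<open>The defect of the claimed formula; it is shown to satisfy the homogeneous
    triangular system.\<close>
  define X where "X = (\<lambda>c. Y c - (\<Sum>p\<le>P. dual_coeff p c * Z (int p)))"
  define M where "M = int P + 1"
  have X_high: "X c = 0" if "c > M" for c
  proof -
    have "dual_coeff p c = 0" if "p \<le> P" for p
      using that \<open>c > M\<close> by (intro dual_coeff_eq_0) (auto simp: M_def)
    then show ?thesis using that P by (simp add: X_def Y M_def)
  qed
  have killed: "(\<Sum>c=q+1..M. hs (- q - 1) c * X c) = 0" for q
  proof -
    have "(\<Sum>c=q+1..M. hs (- q - 1) c * (\<Sum>p\<le>P. dual_coeff p c * Z (int p)))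
        = (\<Sum>p\<le>P. Z (int p) * (\<Sum>c=q+1..M. hs (- q - 1) c * dual_coeff p c))"
      unfolding sum_distrib_left by (subst sum.swap) (simp only: mult_ac)
    also have "\<dots> = (\<Sum>p\<le>P. Z (int p) * (if q = int p then 1 else 0))"
      by (intro sum.cong refl, subst hs_dual_coeff) (auto simp: M_def)
    also have "\<dots> = Z q"
    proof (cases "0 \<le> q \<and> q \<le> int P")
      case True
      then have "(\<Sum>p\<le>P. Z (int p) * (if q = int p then 1 else 0)) = (\<Sum>p\<in>{nat q}. Z (int p))"
        by (intro sum.mono_neutral_cong_right) auto
      then show ?thesis using True by simp
    next
      case False
      \<comment> \<open>For \<open>q > P\<close> the defining sum of \<open>Z q\<close> is empty,
        because \<open>c0 <= P + 1\<close>.\<close>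
      then have "Z q = 0" using Z_neg Z[of q] P by (cases "q < 0") auto
      moreover have "(\<Sum>p\<le>P. Z (int p) * (if q = int p then 1 else 0)) = 0"
        using False by (intro sum.neutral) auto
      ultimately show ?thesis by simp
    qed
    also have "\<dots> = (\<Sum>c=q+1..M. hs (- q - 1) c * Y c)"
      unfolding Z using P by (intro sum.mono_neutral_left) (auto simp: M_def Y)
    finally show ?thesis
      unfolding X_def right_diff_distrib sum_subtractf by simp
  qed
  have "X c = 0" for c
  proof (induction "nat (M - c)" arbitrary: c rule: less_induct)
    case less
    show ?case
    proof (cases "c > M")
      case False
      \<comment> \<open>Descending induction on \<open>c\<close>: in equation
        \<open>q = c - 1\<close> the diagonal entry \<open>hs (- c) c\<close> is 1 and all higher
        values of \<open>X\<close> are already zero.\<close>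
      have "(\<Sum>c'=c..M. hs (- c) c' * X c') = (\<Sum>c'\<in>{c}. hs (- c) c' * X c')"
        using False less by (intro sum.mono_neutral_right) auto
      then show ?thesis using killed[of "c - 1"] hs_diag[of "- c"] by simp
    qed (rule X_high)
  qed
  then show ?thesis by (simp add: X_def)
qed

section \<open>Expansions of the Jacobi-Trudi determinants along a row or a column\<close>

definition lower :: "int \<Rightarrow> int list \<Rightarrow> sfun" where
  "lower p l = detn (length l) (\<lambda>i j. hs (if int j - 1 < p then int j - 1 else int j) (part l i - int i))"

text \<open>Deleting the first row lowers the position of every part of \<open>l\<close> by one, and
  deleting column \<open>p + 1\<close> omits the upper index \<open>p\<close>: the minors are the
  values of \<open>D p\<close>.\<close>

lemma sv_Cons: "sv (a # l) = (\<Sum>p\<le>length l. (-1) ^ p * hs (int p) a * lower (int p) l)"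
proof -
  define A where "A = (\<lambda>i j. hs (int j - 1) (part (a # l) i - int i + 1))"
  have A: "A 1 (Suc p) = hs (int p) a" for p
    by (simp add: A_def part_def)
  have minor: "detn (length l) (\<lambda>k m. A (skip 1 k) (skip (Suc p) m)) = lower (int p) l" for p
    unfolding lower_def A_def
  proof (rule detn_cong)
    fix i j assume ij: "1 \<le> i" "i \<le> length l" "1 \<le> j" "j \<le> length l"
    have 1: "part (a # l) (skip 1 i) - int (skip 1 i) + 1 = part l i - int i"
      using ij by (simp add: part_def skip_def)
    have 2: "int (skip (Suc p) j) - 1 = (if int j - 1 < int p then int j - 1 else int j)"
      by (auto simp: skip_def)
    show "hs (int (skip (Suc p) j) - 1) (part (a # l) (skip 1 i) - int (skip 1 i) + 1)
        = hs (if int j - 1 < int p then int j - 1 else int j) (part l i - int i)"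
      unfolding 1 2 ..
  qed
  have "sv (a # l) = detn (Suc (length l)) A"
    by (simp add: sv_def A_def)
  also have "\<dots> = (\<Sum>j=1..Suc (length l). (-1) ^ (1 + j) * (A 1 j * detn (length l) (\<lambda>k m. A (skip 1 k) (skip j m))))"
    by (rule detn_Suc)
  also have "\<dots> = (\<Sum>p\<le>length l. (-1) ^ p * hs (int p) a * lower (int p) l)"
    unfolding lessThan_Suc_atMost[symmetric] sum.atLeast1_atMost_eq[folded One_nat_def] A minor
    by (simp add: mult.assoc)
  finally show ?thesis .
qed

text \<open>A zero part in position \<open>n + 1\<close> adds a row with entries
  \<open>hs (j - 1) (- n)\<close>, which are zero up to column \<open>n\<close> and 1 in column
  \<open>n + 1\<close>.\<close>

lemma sv_pad:
  "length l \<le> n \<Longrightarrow> detn n (\<lambda>i j. hs (int j - 1) (part l i - int i + 1)) = sv l"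
proof (induction n rule: dec_induct)
  case base
  then show ?case by (simp add: sv_def)
next
  case (step n)
  define A where "A = (\<lambda>i j. hs (int j - 1) (part l i - int i + 1))"
  have "detn (Suc n) A = (\<Sum>j=1..Suc n. (-1) ^ (Suc n + j) * A (Suc n) j * detn n (\<lambda>k m. A (skip (Suc n) k) (skip j m)))"
    using detn_expand_row[of "Suc n" "Suc n" A] by simp
  also have "\<dots> = (\<Sum>j\<in>{Suc n}. (-1) ^ (Suc n + j) * A (Suc n) j * detn n (\<lambda>k m. A (skip (Suc n) k) (skip j m)))"
  proof (rule sum.mono_neutral_right)
    show "\<forall>j\<in>{1..Suc n} - {Suc n}. (-1) ^ (Suc n + j) * A (Suc n) j * detn n (\<lambda>k m. A (skip (Suc n) k) (skip j m)) = 0"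
    proof
      fix j assume "j \<in> {1..Suc n} - {Suc n}"
      then have "A (Suc n) j = 0"
        unfolding A_def using step.hyps by (intro hs_neg) (auto simp: part_def)
      then show "(-1) ^ (Suc n + j) * A (Suc n) j * detn n (\<lambda>k m. A (skip (Suc n) k) (skip j m)) = 0"
        by simp
    qed
  qed auto
  also have "\<dots> = detn n (\<lambda>k m. A (skip (Suc n) k) (skip (Suc n) m))"
  proof -
    have "A (Suc n) (Suc n) = 1"
      using step.hyps hs_diag[of "int n"] by (simp add: A_def part_def)
    moreover have "(-1 :: sfun) ^ (Suc n + Suc n) = 1"
      by (simp add: minus_one_power_iff)
    ultimately show ?thesis by (simp del: power_Suc add_Suc add_Suc_right)
  qed
  also have "\<dots> = detn n A"
    by (intro detn_cong) (auto simp: skip_def)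
  finally show ?case using step.IH by (simp add: A_def)
qed

lemma part_remove_part:
  assumes "1 \<le> t" "1 \<le> k"
  shows "part (remove_part l t) k = (if k < t then part l k + 1 else part l (Suc k))"
proof (cases "k < t")
  case True
  then have "k - 1 < t - 1" using assms by simp
  then show ?thesis using assms True by (auto simp: part_def remove_part_def nth_append)
next
  case False
  have "k - 1 - (t - 1) = k - t" using assms False by simp
  then show ?thesis using assms False by (auto simp: part_def remove_part_def nth_append)
qed

text \<open>The lower index that goes with the removal of part \<open>t\<close>; the Kronecker delta
  in \<open>is_psi_star\<close> says that it equals \<open>k - m + 1\<close>.\<close>

definition hook :: "int list \<Rightarrow> nat \<Rightarrow> int" where
  "hook l t = part l t - int t + 2"

text \<open>Read backwards, this is expansion along the first column: the other columns carry the
  upper indices 0, 1, 2 and so on, and deleting row \<open>t\<close> leaves the padded determinant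
  of \<open>remove_part l t\<close>.\<close>

lemma sum_remove_part:
  assumes N: "length l \<le> N" "1 \<le> N"
  shows "(\<Sum>t=1..N. (-1) ^ (t + 1) * hs q (hook l t) * sv (remove_part l t))
     = detn N (\<lambda>i j. hs (if j = 1 then q else int j - 2) (hook l i))"
proof -
  define A where "A = (\<lambda>i j. hs (if j = 1 then q else int j - 2) (hook l i))"
  have minor: "detn (N - 1) (\<lambda>k m. A (skip t k) (skip 1 m)) = sv (remove_part l t)"
    if t: "t \<in> {1..N}" for t
  proof -
    have len: "length (remove_part l t) \<le> N - 1"
      using t N by (auto simp: remove_part_def)
    show ?thesis
      unfolding sv_pad[OF len, symmetric] A_def
    proof (rule detn_cong)
      fix i j assume "1 \<le> i" "i \<le> N - 1" "1 \<le> j" "j \<le> N - 1"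
      moreover from this have "hook l (skip t i) = part (remove_part l t) i - int i + 1"
        using t by (subst part_remove_part) (auto simp: hook_def skip_def)
      ultimately show "hs (if skip 1 j = 1 then q else int (skip 1 j) - 2) (hook l (skip t i))
          = hs (int j - 1) (part (remove_part l t) i - int i + 1)"
        by (simp add: skip_def)
    qed
  qed
  have "detn N A = (\<Sum>t=1..N. (-1) ^ (t + 1) * A t 1 * detn (N - 1) (\<lambda>k m. A (skip t k) (skip 1 m)))"
    by (rule detn_expand_col) (use N in auto)
  also have "\<dots> = (\<Sum>t=1..N. (-1) ^ (t + 1) * hs q (hook l t) * sv (remove_part l t))"
    using minor by (intro sum.cong refl) (simp add: A_def)
  finally show ?thesis by (simp add: A_def)
qed

definition upper :: "int \<Rightarrow> int list \<Rightarrow> sfun" where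
  "upper q l = Sum_any (\<lambda>t. if 1 \<le> t
      then (- 1) ^ (t + 1) * hs q (part l t - int t + 2) * sv (remove_part l t) else 0)"

lemma upper_eq_sum:
  assumes N: "length l \<le> N" "q + 2 \<le> int N"
  shows "upper q l = (\<Sum>t=1..N. (-1) ^ (t + 1) * hs q (hook l t) * sv (remove_part l t))"
proof -
  let ?g = "\<lambda>t. if 1 \<le> t then (- 1) ^ (t + 1) * hs q (part l t - int t + 2) * sv (remove_part l t) else 0"
  have "?g t = 0" if "t \<notin> {1..N}" for t
  proof (cases "t \<ge> 1")
    case True
    then have "hs q (part l t - int t + 2) = 0"
      using that N by (intro hs_neg) (auto simp: part_def)
    then show ?thesis by simp
  qed simp
  then have "{t. ?g t \<noteq> 0} \<subseteq> {1..N}" by blast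
  then have "upper q l = sum ?g {1..N}"
    unfolding upper_def by (intro Sum_any.expand_superset) auto
  then show ?thesis by (auto simp: hook_def intro!: sum.cong)
qed

text \<open>As soon as the matrix is large enough to have a column \<open>q + 2\<close>, that column
  repeats the first one.\<close>

lemma upper_nonneg:
  assumes "q \<ge> 0"
  shows "upper q l = 0"
proof -
  define N where "N = max (length l) (nat q + 2)"
  have "upper q l = detn N (\<lambda>i j. hs (if j = 1 then q else int j - 2) (hook l i))"
    using sum_remove_part[of l N q] upper_eq_sum[of l N q] assms by (simp add: N_def)
  also have "\<dots> = 0"
    using assms by (intro detn_identical_cols[of 1 _ "nat q + 2"]) (auto simp: N_def)
  finally show ?thesis .
qed

text \<open>The \<open>Y\<close> of the inversion: \<psi>* of index \<open>k\<close> sends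
  \<open>sv l\<close> in charge \<open>m\<close> to \<open>removal l (k - m + 1)\<close> in charge
  \<open>m - 1\<close>.\<close>

definition removal :: "int list \<Rightarrow> int \<Rightarrow> sfun" where
  "removal l c = (\<Sum>t\<in>{t. 1 \<le> t \<and> c = hook l t}. (- 1) ^ (t + 1) * sv (remove_part l t))"

lemma part_le_part_1: "is_partition l \<Longrightarrow> t \<ge> 1 \<Longrightarrow> part l t \<le> part l 1"
proof -
  assume l: "is_partition l" and t: "t \<ge> 1"
  show ?thesis
  proof (cases "t = 1 \<or> t > length l")
    case True
    then show ?thesis using l t by (cases l) (auto simp: part_def is_partition_def)
  next
    case False
    then show ?thesis using l t unfolding is_partition_def sorted_wrt_iff_nth_less
      by (auto simp: part_def)
  qed
qed

lemma removal_high: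
  assumes l: "is_partition l" and "c > part l 1 + 1"
  shows "removal l c = 0"
proof -
  have "{t. 1 \<le> t \<and> c = hook l t} = {}"
    using assms part_le_part_1[OF l] by (force simp: hook_def)
  then show ?thesis unfolding removal_def by (simp only: sum.empty)
qed

text \<open>The terms are grouped by the value of \<open>hook\<close>. Values below
  \<open>- q\<close> contribute nothing because \<open>hs q\<close> vanishes there, and the largest
  possible value is the one for \<open>t = 1\<close>.\<close>

lemma upper_eq_removal:
  assumes l: "is_partition l"
  shows "upper q l = (\<Sum>c=- q..part l 1 + 1. hs q c * removal l c)"
proof -
  define N where "N = max (length l) (nat (q + 2))"
  let ?h = "\<lambda>t. (-1) ^ (t + 1) * hs q (hook l t) * sv (remove_part l t)"
  define S where "S = {t \<in> {1..N}. hook l t \<ge> - q}"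
  have "upper q l = (\<Sum>t=1..N. ?h t)"
    by (rule upper_eq_sum) (auto simp: N_def)
  also have "\<dots> = sum ?h S"
    by (rule sum.mono_neutral_right) (auto simp: S_def hs_neg)
  also have "\<dots> = (\<Sum>c=- q..part l 1 + 1. \<Sum>t\<in>{t \<in> S. hook l t = c}. ?h t)"
  proof (rule sum.group[symmetric])
    show "hook l ` S \<subseteq> {- q..part l 1 + 1}"
    proof safe
      fix t assume "t \<in> S"
      then show "hook l t \<in> {- q..part l 1 + 1}"
        using part_le_part_1[OF l, of t] by (auto simp: S_def hook_def)
    qed
  qed (auto simp: S_def)
  also have "\<dots> = (\<Sum>c=- q..part l 1 + 1. hs q c * removal l c)"
  proof (intro sum.cong refl)
    fix c assume c: "c \<in> {- q..part l 1 + 1}"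
    have "t \<le> N" if "c = hook l t" for t
    proof (rule ccontr)
      assume "\<not> t \<le> N"
      then have "hook l t = 2 - int t" "int t > q + 2" by (auto simp: hook_def part_def N_def)
      then show False using c that by auto
    qed
    then have "{t \<in> S. hook l t = c} = {t. 1 \<le> t \<and> c = hook l t}"
      using c by (auto simp: S_def)
    then show "(\<Sum>t\<in>{t \<in> S. hook l t = c}. ?h t) = hs q c * removal l c"
      unfolding removal_def sum_distrib_left by (auto intro!: sum.cong simp: mult_ac)
  qed
  finally show ?thesis .
qed

lemma upper_low:
  assumes "is_partition l" "- q > part l 1 + 1"
  shows "upper q l = 0"
  using assms by (simp add: upper_eq_removal)

text \<open>Inversion of the preceding triangular system; the vanishing of \<open>upper q l\<close>
  for \<open>q >= 0\<close> is what limits the sum to natural \<open>p\<close>.\<close>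

lemma removal_eq_upper:
  assumes l: "is_partition l" and P: "part l 1 \<le> int P"
  shows "removal l c = (\<Sum>p\<le>P. dual_coeff p c * upper (- int p - 1) l)"
proof (rule hs_inversion[where Z = "\<lambda>q. upper (- q - 1) l" and ?c0.0 = "part l 1 + 1"])
  show "upper (- q - 1) l = (\<Sum>c=q+1..part l 1 + 1. hs (- q - 1) c * removal l c)" for q
    using upper_eq_removal[OF l, of "- q - 1"] by (simp add: add.commute)
qed (use l P removal_high upper_nonneg in auto)

end

section \<open>Extension of the expansions from the determinants to the whole algebra\<close>

context shift_automorphism
begin

lemma sum_extend:
  fixes f :: "nat \<Rightarrow> sfun"
  assumes "P \<le> Q" "\<And>p. p > P \<Longrightarrow> f p = 0"
  shows "sum f {..P} = sum f {..Q}"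
  using assms by (intro sum.mono_neutral_left) auto

lemma single_in_fock_space: "f \<in> shifted_symmetric \<Longrightarrow> Poly_Mapping.single m f \<in> fock_space"
  by (auto simp: fock_space_def lookup_single when_def)

lemma single_scale:
  "Poly_Mapping.single m (sconst c * f) = Poly_Mapping.single 0 (sconst c) * Poly_Mapping.single m f"
  by (simp add: mult_single)

text \<open>One cutoff \<open>P\<close> serves all \<open>k\<close> at once, which later allows the
  finite sum over \<open>p\<close> to be exchanged with the infinite sum over
  \<open>k\<close>.\<close>

definition lower_expansion :: "(int \<Rightarrow> fock \<Rightarrow> fock) \<Rightarrow> (int \<Rightarrow> sfun \<Rightarrow> sfun) \<Rightarrow> int \<Rightarrow> nat \<Rightarrow> sfun \<Rightarrow> bool" where
  "lower_expansion \<psi> D m P f \<longleftrightarrow> (\<forall>p. p < 0 \<or> p > int P \<longrightarrow> D p f = 0) \<and>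
    (\<forall>k. \<psi> k (Poly_Mapping.single m f) = Poly_Mapping.single (m + 1)
        (\<Sum>p\<le>P. (-1) ^ p * hshift \<phi> (int p) (k - m - 1) * D (int p) f))"

lemma lower_expansion_mono:
  assumes "lower_expansion \<psi> D m P f" "P \<le> Q"
  shows "lower_expansion \<psi> D m Q f"
proof -
  have "(\<Sum>p\<le>P. (-1) ^ p * hshift \<phi> (int p) (k - m - 1) * D (int p) f)
      = (\<Sum>p\<le>Q. (-1) ^ p * hshift \<phi> (int p) (k - m - 1) * D (int p) f)" for k
    using assms by (intro sum_extend) (auto simp: lower_expansion_def)
  then show ?thesis using assms by (auto simp: lower_expansion_def)
qed

text \<open>On \<open>sv l\<close> the cutoff is the length of \<open>l\<close>, by the first-row
  expansion. A sum takes the larger of two cutoffs, which is possible because enlarging a cutoff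
  adds zero terms.\<close>

lemma ex_lower_expansion:
  assumes psi: "is_psi \<phi> \<psi>" and D: "is_D_lower \<phi> D" and f: "f \<in> shifted_symmetric"
  shows "\<exists>P. lower_expansion \<psi> D m P f"
  using f
proof (induction rule: shifted_symmetric_sv_induct)
  case (sv l)
  have "D p (sv l) = (if 0 \<le> p \<and> p \<le> int (length l) then lower p l else 0)" for p
    using D sv by (simp add: is_D_lower_def sv_eq lower_def)
  moreover have "\<psi> k (Poly_Mapping.single m (sv l)) = Poly_Mapping.single (m + 1) (sv ((k - m - 1) # l))" for k
    using psi sv by (simp add: is_psi_def sv_eq)
  ultimately have "lower_expansion \<psi> D m (length l) (sv l)"
    by (simp add: lower_expansion_def sv_Cons)
  then show ?case ..
next
  case (add f g)
  then obtain P Q where "lower_expansion \<psi> D m P f" "lower_expansion \<psi> D m Q g" by auto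
  then have f: "lower_expansion \<psi> D m (max P Q) f" and g: "lower_expansion \<psi> D m (max P Q) g"
    using lower_expansion_mono by (meson max.cobounded1 max.cobounded2)+
  have "D p (f + g) = D p f + D p g" for p
    using D add by (simp add: is_D_lower_def linear_operator_def)
  moreover have "\<psi> k (Poly_Mapping.single m (f + g)) = \<psi> k (Poly_Mapping.single m f) + \<psi> k (Poly_Mapping.single m g)" for k
    using psi add by (simp add: is_psi_def linear_operator_def single_add single_in_fock_space)
  ultimately have "lower_expansion \<psi> D m (max P Q) (f + g)"
    using f g unfolding lower_expansion_def
    by (simp add: single_add[symmetric] sum.distrib[symmetric] distrib_left)
  then show ?case ..
next
  case (scale c f)
  then obtain P where P: "lower_expansion \<psi> D m P f" by auto
  have "D p (sconst c * f) = sconst c * D p f" for p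
    using D scale by (simp add: is_D_lower_def linear_operator_def)
  moreover have "\<psi> k (Poly_Mapping.single m (sconst c * f))
      = Poly_Mapping.single 0 (sconst c) * \<psi> k (Poly_Mapping.single m f)" for k
    unfolding single_scale
    using psi scale by (simp add: is_psi_def linear_operator_def single_in_fock_space)
  ultimately have "lower_expansion \<psi> D m P (sconst c * f)"
    using P unfolding lower_expansion_def
    by (simp add: mult_single sum_distrib_left mult_ac)
  then show ?case ..
qed

definition upper_expansion :: "(int \<Rightarrow> fock \<Rightarrow> fock) \<Rightarrow> (int \<Rightarrow> sfun \<Rightarrow> sfun) \<Rightarrow> int \<Rightarrow> nat \<Rightarrow> sfun \<Rightarrow> bool" where
  "upper_expansion \<psi>' D' m P f \<longleftrightarrow> (\<forall>p. p \<ge> 0 \<or> - p - 1 > int P \<longrightarrow> D' p f = 0) \<and>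
    (\<forall>k. \<psi>' k (Poly_Mapping.single m f) = Poly_Mapping.single (m - 1)
        (\<Sum>p\<le>P. dual_coeff p (k - m + 1) * D' (- int p - 1) f))"

lemma upper_expansion_mono:
  assumes "upper_expansion \<psi>' D' m P f" "P \<le> Q"
  shows "upper_expansion \<psi>' D' m Q f"
proof -
  have "(\<Sum>p\<le>P. dual_coeff p (k - m + 1) * D' (- int p - 1) f)
      = (\<Sum>p\<le>Q. dual_coeff p (k - m + 1) * D' (- int p - 1) f)" for k
    using assms by (intro sum_extend) (auto simp: upper_expansion_def)
  then show ?thesis using assms by (auto simp: upper_expansion_def)
qed

text \<open>On \<open>sv l\<close> the cutoff is the first part of \<open>l\<close>: beyond it, and
  for nonnegative index, the values of \<open>upper\<close> vanish, and in between the inverted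
  system applies.\<close>

lemma ex_upper_expansion:
  assumes psi: "is_psi_star \<phi> \<psi>'" and D: "is_D_upper \<phi> D'" and f: "f \<in> shifted_symmetric"
  shows "\<exists>P. upper_expansion \<psi>' D' m P f"
  using f
proof (induction rule: shifted_symmetric_sv_induct)
  case (sv l)
  have D': "D' p (sv l) = upper p l" for p
    using D sv unfolding is_D_upper_def upper_def sv_eq by blast
  have "k - m - 1 = part l t - int t \<longleftrightarrow> k - m + 1 = hook l t" for k t
    by (auto simp: hook_def)
  then have psi': "\<psi>' k (Poly_Mapping.single m (sv l)) = Poly_Mapping.single (m - 1) (removal l (k - m + 1))" for k
    using psi sv unfolding is_psi_star_def by (simp add: sv_eq removal_def)
  define P where "P = nat (part l 1)"
  have "upper_expansion \<psi>' D' m P (sv l)"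
    unfolding upper_expansion_def
  proof (intro conjI allI impI)
    fix p :: int assume "0 \<le> p \<or> int P < - p - 1"
    then have "p \<ge> 0 \<or> - p > part l 1 + 1" by (auto simp: P_def split: if_splits)
    then show "D' p (sv l) = 0"
      unfolding D' using upper_nonneg[of p l] upper_low[OF sv, of p] by blast
  next
    fix k
    show "\<psi>' k (Poly_Mapping.single m (sv l)) =
         Poly_Mapping.single (m - 1) (\<Sum>p\<le>P. dual_coeff p (k - m + 1) * D' (- int p - 1) (sv l))"
      unfolding psi' D' by (subst removal_eq_upper[OF sv, of P]) (auto simp: P_def)
  qed
  then show ?case ..
next
  case (add f g)
  then obtain P Q where "upper_expansion \<psi>' D' m P f" "upper_expansion \<psi>' D' m Q g" by auto
  then have f: "upper_expansion \<psi>' D' m (max P Q) f" and g: "upper_expansion \<psi>' D' m (max P Q) g"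
    using upper_expansion_mono by (meson max.cobounded1 max.cobounded2)+
  have "D' p (f + g) = D' p f + D' p g" for p
    using D add by (simp add: is_D_upper_def linear_operator_def)
  moreover have "\<psi>' k (Poly_Mapping.single m (f + g)) = \<psi>' k (Poly_Mapping.single m f) + \<psi>' k (Poly_Mapping.single m g)" for k
    using psi add by (simp add: is_psi_star_def linear_operator_def single_add single_in_fock_space)
  ultimately have "upper_expansion \<psi>' D' m (max P Q) (f + g)"
    using f g unfolding upper_expansion_def
    by (simp add: single_add[symmetric] sum.distrib[symmetric] distrib_left)
  then show ?case ..
next
  case (scale c f)
  then obtain P where P: "upper_expansion \<psi>' D' m P f" by auto
  have "D' p (sconst c * f) = sconst c * D' p f" for p
    using D scale by (simp add: is_D_upper_def linear_operator_def)
  moreover have "\<psi>' k (Poly_Mapping.single m (sconst c * f))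
      = Poly_Mapping.single 0 (sconst c) * \<psi>' k (Poly_Mapping.single m f)" for k
    unfolding single_scale
    using psi scale by (simp add: is_psi_star_def linear_operator_def single_in_fock_space)
  ultimately have "upper_expansion \<psi>' D' m P (sconst c * f)"
    using P unfolding upper_expansion_def
    by (simp add: mult_single sum_distrib_left mult_ac)
  then show ?case ..
qed

end

section \<open>Formal series\<close>

subsection \<open>Convergence of formal Laurent series\<close>

lemma dist_fls_less:
  fixes f g :: "'a :: group_add fls"
  assumes "\<And>i. i \<le> int n \<Longrightarrow> fls_nth f i = fls_nth g i"
  shows "dist f g < inverse (2 ^ n)"
proof (cases "f = g")
  case False
  have "fls_subdegree (f - g) > int n"
    using False assms by (intro fls_subdegree_greaterI) auto
  then have "dist f g = inverse (2 ^ nat (fls_subdegree (f - g)))" "nat (fls_subdegree (f - g)) > n"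
    using False by (auto simp: dist_fls_def)
  then show ?thesis by (simp add: power_strict_increasing)
qed simp

lemma fls_nth_eq_if_dist_less:
  fixes f g :: "'a :: group_add fls"
  assumes "dist f g < inverse (2 ^ n)" "i \<le> int n"
  shows "fls_nth f i = fls_nth g i"
proof (rule ccontr)
  assume "fls_nth f i \<noteq> fls_nth g i"
  then have neq: "f \<noteq> g" and le: "fls_subdegree (f - g) \<le> i"
    by (auto intro!: fls_subdegree_leI)
  show False
  proof (cases "fls_subdegree (f - g) \<ge> 0")
    case True
    then have "nat (fls_subdegree (f - g)) \<le> n" using le assms(2) by simp
    then have "inverse (2 ^ n) \<le> (inverse (2 ^ nat (fls_subdegree (f - g))) :: real)"
      by (intro le_imp_inverse_le power_increasing) auto
    then show False using assms(1) neq True by (simp add: dist_fls_def)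
  next
    case False
    have "inverse (2 ^ n) \<le> (1 :: real)" by (simp add: inverse_le_1_iff)
    also have "\<dots> \<le> 2 ^ nat (- fls_subdegree (f - g))" by simp
    finally show False using assms(1) neq False by (simp add: dist_fls_def)
  qed
qed

text \<open>Convergence means that all coefficients up to any given degree are eventually constant;
  continuity of the operations is reduced to this.\<close>

lemma tendsto_fls_iff:
  fixes f :: "'b \<Rightarrow> 'a :: group_add fls"
  shows "(f \<longlongrightarrow> S) F \<longleftrightarrow> (\<forall>n. eventually (\<lambda>x. \<forall>i\<le>n. fls_nth (f x) i = fls_nth S i) F)"
proof safe
  fix n assume "(f \<longlongrightarrow> S) F"
  then have "eventually (\<lambda>x. dist (f x) S < inverse (2 ^ nat n)) F"
    by (rule tendstoD) simp
  then show "eventually (\<lambda>x. \<forall>i\<le>n. fls_nth (f x) i = fls_nth S i) F"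
    by eventually_elim (auto intro: fls_nth_eq_if_dist_less)
next
  assume ev: "\<forall>n. eventually (\<lambda>x. \<forall>i\<le>n. fls_nth (f x) i = fls_nth S i) F"
  show "(f \<longlongrightarrow> S) F"
  proof (rule tendstoI)
    fix e :: real assume "e > 0"
    then obtain n where "(1 / 2) ^ n < e"
      using reals_power_lt_ex[of e 2] by auto
    then have n: "inverse (2 ^ n) < e"
      by (simp add: power_one_over inverse_eq_divide)
    show "eventually (\<lambda>x. dist (f x) S < e) F"
      using ev[rule_format, of "int n"]
      by eventually_elim (use n dist_fls_less in \<open>meson less_trans\<close>)
  qed
qed

lemma tendsto_fls_add:
  fixes f g :: "'b \<Rightarrow> 'a :: ab_group_add fls"
  assumes "(f \<longlongrightarrow> S) F" "(g \<longlongrightarrow> T) F"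
  shows "((\<lambda>x. f x + g x) \<longlongrightarrow> S + T) F"
  unfolding tendsto_fls_iff
proof
  fix n
  show "eventually (\<lambda>x. \<forall>i\<le>n. fls_nth (f x + g x) i = fls_nth (S + T) i) F"
    using assms[unfolded tendsto_fls_iff, rule_format, of n] by eventually_elim simp
qed

text \<open>The coefficients of \<open>y * G\<close> up to degree \<open>n\<close> depend only on
  those of \<open>G\<close> up to degree \<open>n - fls_subdegree y\<close>.\<close>

lemma tendsto_fls_mult_left:
  fixes f :: "'b \<Rightarrow> 'a :: comm_ring_1 fls"
  assumes "(f \<longlongrightarrow> S) F"
  shows "((\<lambda>x. y * f x) \<longlongrightarrow> y * S) F"
  unfolding tendsto_fls_iff
proof
  fix n
  show "eventually (\<lambda>x. \<forall>i\<le>n. fls_nth (y * f x) i = fls_nth (y * S) i) F"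
    using assms[unfolded tendsto_fls_iff, rule_format, of "n - fls_subdegree y"]
  proof eventually_elim
    case (elim x)
    show ?case
    proof (intro allI impI)
      fix i assume "i \<le> n"
      have "fls_nth (y * (f x - S)) i = 0"
      proof (cases "f x = S")
        case False
        have "fls_subdegree (f x - S) > n - fls_subdegree y"
          using False elim by (intro fls_subdegree_greaterI) auto
        then show ?thesis using \<open>i \<le> n\<close> by (intro fls_times_nth_eq0) simp
      qed simp
      then show "fls_nth (y * f x) i = fls_nth (y * S) i"
        by (simp add: right_diff_distrib)
    qed
  qed
qed

lemma fls_nth_deriv_u: "fls_nth (deriv_u G) i = - (of_int (i - 1) * fls_nth G (i - 1))"
proof -
  have "fls_X ^ 2 * fls_deriv G = fls_shift (- 2) (fls_deriv G)"
    using fls_X_power_times_conv_shift(1)[of 2 "fls_deriv G"] by simp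
  then show ?thesis unfolding deriv_u_def by simp
qed

lemma tendsto_deriv_u:
  assumes "(f \<longlongrightarrow> S) F"
  shows "((\<lambda>x. deriv_u (f x)) \<longlongrightarrow> deriv_u S) F"
  unfolding tendsto_fls_iff fls_nth_deriv_u
proof
  fix n
  show "eventually (\<lambda>x. \<forall>i\<le>n. - (of_int (i - 1) * fls_nth (f x) (i - 1)) = - (of_int (i - 1) * fls_nth S (i - 1))) F"
    using assms[unfolded tendsto_fls_iff, rule_format, of "n - 1"] by eventually_elim auto
qed

lemma deriv_u_add: "deriv_u (f + g) = deriv_u f + deriv_u g"
  by (simp add: deriv_u_def algebra_simps)

lemma deriv_u_0 [simp]: "deriv_u 0 = 0"
  by (simp add: deriv_u_def)

lemma deriv_u_sum: "deriv_u (sum f I) = (\<Sum>i\<in>I. deriv_u (f i))"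
  by (induction I rule: infinite_finite_induct) (simp_all add: deriv_u_add)

lemma deriv_u_mult: "deriv_u (f * g) = deriv_u f * g + f * deriv_u g"
  by (simp add: deriv_u_def algebra_simps)

lemma has_sum_fls_unique:
  fixes f :: "'b \<Rightarrow> 'a :: ab_group_add fls"
  assumes "(f has_sum S) A" "(f has_sum T) A"
  shows "S = T"
  using infsumI[OF assms(1)] infsumI[OF assms(2)] by simp

lemma has_sum_fls_add:
  fixes f g :: "'b \<Rightarrow> 'a :: ab_group_add fls"
  shows "(f has_sum S) A \<Longrightarrow> (g has_sum T) A \<Longrightarrow> ((\<lambda>x. f x + g x) has_sum S + T) A"
  unfolding has_sum_def sum.distrib by (rule tendsto_fls_add)

lemma has_sum_fls_mult_left:
  fixes f :: "'b \<Rightarrow> 'a :: comm_ring_1 fls"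
  shows "(f has_sum S) A \<Longrightarrow> ((\<lambda>x. y * f x) has_sum y * S) A"
  unfolding has_sum_def sum_distrib_left[symmetric] by (rule tendsto_fls_mult_left)

lemma has_sum_deriv_u:
  "(f has_sum S) A \<Longrightarrow> ((\<lambda>x. deriv_u (f x)) has_sum deriv_u S) A"
  unfolding has_sum_def deriv_u_sum[symmetric] by (rule tendsto_deriv_u)

lemma has_sum_fls_sum:
  fixes f :: "'c \<Rightarrow> 'b \<Rightarrow> 'a :: ab_group_add fls"
  assumes "\<And>i. i \<in> I \<Longrightarrow> (f i has_sum S i) A"
  shows "((\<lambda>x. \<Sum>i\<in>I. f i x) has_sum (\<Sum>i\<in>I. S i)) A"
  using assms
  by (induction I rule: infinite_finite_induct) (auto intro: has_sum_fls_add)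

subsection \<open>Scalar series\<close>

abbreviation fconst :: "complex \<Rightarrow> fock" where
  "fconst c \<equiv> Poly_Mapping.single 0 (sconst c)"

lemma fconst_add: "fconst (a + b) = fconst a + fconst b"
  by (simp add: sconst_add single_add)

lemma fconst_mult: "fconst (a * b) = fconst a * fconst b"
  by (simp add: sconst_mult mult_single)

lemma fconst_0 [simp]: "fconst 0 = 0"
  by simp

lemma fconst_1 [simp]: "fconst 1 = 1"
  by simp

lemma fconst_sum: "fconst (sum f I) = (\<Sum>i\<in>I. fconst (f i))"
  by (induction I rule: infinite_finite_induct) (simp_all only: sum.infinite sum.empty sum.insert fconst_0 fconst_add not_False_eq_True simp_thms)

lemma fconst_eq_0_iff: "fconst c = 0 \<longleftrightarrow> c = 0"
proof
  assume "fconst c = 0"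
  then have "sconst c 0 = 0" by (metis lookup_single_eq lookup_zero zero_fun_apply)
  then show "c = 0" unfolding sconst_def by (metis lookup_single_eq lookup_zero)
qed simp

lemma fls_nth_scalar: "fls_nth (scalar a) n = fconst (fls_nth a n)"
proof -
  have "\<exists>N. \<forall>n<N. fconst (fls_nth a n) = 0"
    by (intro exI[of _ "fls_subdegree a"]) simp
  then show ?thesis unfolding scalar_def by (rule nth_Abs_fls_ex_lower_bound)
qed

lemma scalar_add: "scalar (a + b) = scalar a + scalar b"
  by (rule fls_eqI) (simp only: fls_nth_scalar fls_plus_nth fconst_add)

lemma scalar_0 [simp]: "scalar 0 = 0"
  by (rule fls_eqI) (simp add: fls_nth_scalar)

lemma scalar_const: "scalar (fls_const c) = fls_const (fconst c)"
  by (rule fls_eqI) (simp add: fls_nth_scalar)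

lemma scalar_1 [simp]: "scalar 1 = 1"
  using scalar_const[of 1] by simp

text \<open>Equal subdegrees make the finite convolution sums of both products in
  \<open>scalar_mult\<close> run over the same range.\<close>

lemma fls_subdegree_scalar: "fls_subdegree (scalar a) = fls_subdegree a"
proof (cases "a = 0")
  case False
  then show ?thesis
    by (intro fls_subdegree_eqI) (simp_all only: fls_nth_scalar fconst_eq_0_iff nth_fls_subdegree_nonzero fls_eq0_below_subdegree fconst_0 not_False_eq_True)
qed simp

lemma scalar_mult: "scalar (a * b) = scalar a * scalar b"
proof (rule fls_eqI)
  fix n
  show "fls_nth (scalar (a * b)) n = fls_nth (scalar a * scalar b) n"
    unfolding fls_nth_scalar fls_times_nth(2) fls_subdegree_scalar fconst_sum fconst_mult ..
qed

lemma scalar_uminus: "scalar (- a) = - scalar a"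
  using scalar_add[of "- a" a] by (simp add: eq_neg_iff_add_eq_0)

lemma scalar_of_nat: "scalar (of_nat k) = of_nat k"
  by (induction k) (simp_all add: scalar_add)

lemma scalar_of_int: "scalar (of_int k) = of_int k"
  by (cases k rule: int_cases2) (simp_all add: scalar_of_nat scalar_uminus)

lemma fconst_of_int: "fconst (of_int k) = of_int k"
proof -
  have "fls_const (fconst (of_int k)) = (fls_const (of_int k) :: fock fls)"
    using scalar_of_int[of k] by (simp add: fls_of_int scalar_const)
  then show ?thesis by (metis fls_const_nth)
qed

definition du :: "complex fls \<Rightarrow> complex fls" where
  "du X = - (fls_X ^ 2 * fls_deriv X)"

lemma fls_nth_du: "fls_nth (du G) i = - (of_int (i - 1) * fls_nth G (i - 1))"
proof -
  have "fls_X ^ 2 * fls_deriv G = fls_shift (- 2) (fls_deriv G)"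
    using fls_X_power_times_conv_shift(1)[of 2 "fls_deriv G"] by simp
  then show ?thesis unfolding du_def by simp
qed

lemma deriv_u_scalar: "deriv_u (scalar X) = scalar (du X)"
proof (rule fls_eqI)
  fix i
  have "fls_nth (scalar (du X)) i = fconst (of_int (- (i - 1)) * fls_nth X (i - 1))"
    by (simp only: fls_nth_scalar fls_nth_du of_int_minus mult_minus_left)
  also have "\<dots> = of_int (- (i - 1)) * fls_nth (scalar X) (i - 1)"
    unfolding fconst_mult fconst_of_int fls_nth_scalar ..
  finally show "fls_nth (deriv_u (scalar X)) i = fls_nth (scalar (du X)) i"
    by (simp only: fls_nth_deriv_u of_int_minus mult_minus_left)
qed

lemma deriv_u_const [simp]: "deriv_u (fls_const c) = 0"
  by (simp add: deriv_u_def)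

lemma du_u: "du u = 1"
  by (rule fls_eqI) (auto simp: fls_nth_du)

lemma du_mult: "du (f * g) = du f * g + f * du g"
  by (simp add: du_def algebra_simps)

lemma du_1: "du 1 = 0"
  by (simp add: du_def)

lemma u_powi_add_1: "u powi (n + 1) = u powi n * u"
  by (simp add: power_int_add)

lemma du_powi: "du (u powi n) = of_int n * u powi (n - 1)"
proof (induction n rule: int_induct[where k = 0])
  case base
  then show ?case by (simp add: du_1)
next
  case (step1 n)
  have "of_int n * u powi (n - 1) * u = of_int n * u powi n"
    using u_powi_add_1[of "n - 1"] by simp
  then show ?case
    unfolding u_powi_add_1 du_mult step1.IH du_u by (simp add: algebra_simps)
next
  case (step2 n)
  have 1: "u powi n = u powi (n - 1) * u" "u powi (n - 1) = u powi (n - 2) * u"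
    using u_powi_add_1[of "n - 1"] u_powi_add_1[of "n - 2"] by simp_all
  \<comment> \<open>The product rule for \<open>u powi n = u powi (n - 1) * u\<close>, solved for
    the derivative of the lower power.\<close>
  have "du (u powi (n - 1)) * u = of_int n * u powi (n - 1) - u powi (n - 1)"
    using step2.IH unfolding 1(1) du_mult du_u by (simp add: algebra_simps)
  also have "\<dots> = of_int (n - 1) * u powi (n - 1 - 1) * u"
    using 1(2) by (simp add: algebra_simps)
  finally show ?case by simp
qed

subsection \<open>Series in a basis of scalar series\<close>

definition bounded_below :: "(int \<Rightarrow> sfun) \<Rightarrow> bool" where
  "bounded_below b \<longleftrightarrow> (\<exists>a0. \<forall>a<a0. b a = 0)"

text \<open>The order of \<open>X a\<close> in 1/u grows with \<open>a\<close>. Together with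
  \<open>bounded_below\<close> this leaves finitely many terms in each degree.\<close>

definition graded :: "(int \<Rightarrow> complex fls) \<Rightarrow> bool" where
  "graded X \<longleftrightarrow> (\<exists>d. \<forall>a. \<forall>n<a + d. fls_nth (X a) n = 0)"

definition series :: "(int \<Rightarrow> sfun) \<Rightarrow> (int \<Rightarrow> complex fls) \<Rightarrow> fock fls" where
  "series b X = (\<Sum>\<^sub>\<infinity>a\<in>UNIV. elt_B (b a) * scalar (X a))"

text \<open>Degree \<open>n\<close> receives contributions only from \<open>a\<close> between
  \<open>a0\<close> and \<open>n - d\<close>, so finite sums over sets containing this interval
  agree through degree \<open>n\<close>.\<close>

lemma has_sum_series:
  assumes "bounded_below b" "graded X"
  shows "((\<lambda>a. elt_B (b a) * scalar (X a)) has_sum series b X) UNIV"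
proof -
  obtain a0 where a0: "\<And>a. a < a0 \<Longrightarrow> b a = 0" using assms(1) by (auto simp: bounded_below_def)
  obtain d where d: "\<And>a n. n < a + d \<Longrightarrow> fls_nth (X a) n = 0" using assms(2) by (auto simp: graded_def)
  let ?f = "\<lambda>a. elt_B (b a) * scalar (X a)"
  have zero: "fls_nth (?f a) n = 0" if "a \<notin> {a0..n - d}" for a n
  proof (cases "a < a0")
    case False
    then have "fls_nth (X a) n = 0" using that by (intro d) auto
    then show ?thesis by (simp add: fls_nth_scalar)
  qed (simp add: a0)
  define S where "S = Abs_fls (\<lambda>n. \<Sum>a=a0..n - d. fls_nth (?f a) n)"
  have "\<exists>N. \<forall>n<N. (\<Sum>a=a0..n - d. fls_nth (?f a) n) = 0"
    by (intro exI[of _ "a0 + d"]) auto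
  then have S: "fls_nth S n = (\<Sum>a=a0..n - d. fls_nth (?f a) n)" for n
    unfolding S_def by (rule nth_Abs_fls_ex_lower_bound)
  have "(?f has_sum S) UNIV"
    unfolding has_sum_def tendsto_fls_iff
  proof
    fix n
    show "\<forall>\<^sub>F F in finite_subsets_at_top UNIV. \<forall>i\<le>n. fls_nth (sum ?f F) i = fls_nth S i"
      unfolding eventually_finite_subsets_at_top
    proof (intro exI[of _ "{a0..n - d}"] conjI allI impI)
      fix F i assume F: "finite F \<and> {a0..n - d} \<subseteq> F \<and> F \<subseteq> UNIV" and i: "i \<le> n"
      have "(\<Sum>a\<in>F. fls_nth (?f a) i) = (\<Sum>a=a0..i - d. fls_nth (?f a) i)"
        using F i by (intro sum.mono_neutral_right ballI zero) auto
      then show "fls_nth (sum ?f F) i = fls_nth S i"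
        unfolding fls_nth_sum S .
    qed auto
  qed
  moreover from this have "series b X = S"
    unfolding series_def by (rule infsumI)
  ultimately show ?thesis by blast
qed

lemma seriesI:
  "((\<lambda>a. elt_B (b a) * scalar (X a)) has_sum S) UNIV \<Longrightarrow> series b X = S"
  unfolding series_def by (rule infsumI)

lemma bounded_below_shift: "bounded_below b \<Longrightarrow> bounded_below (\<lambda>a. b (a + k))"
proof -
  assume "bounded_below b"
  then obtain a0 where "\<forall>a<a0. b a = 0" by (auto simp: bounded_below_def)
  then have "\<forall>a<a0 - k. b (a + k) = 0" by auto
  then show ?thesis unfolding bounded_below_def by blast
qed

lemma graded_shift: "graded X \<Longrightarrow> graded (\<lambda>a. X (a + k))"
proof -
  assume "graded X"
  then obtain d where "\<forall>a. \<forall>n<a + d. fls_nth (X a) n = 0" by (auto simp: graded_def)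
  then have "\<forall>a. \<forall>n<a + (k + d). fls_nth (X (a + k)) n = 0" by (simp add: add.assoc)
  then show ?thesis unfolding graded_def by blast
qed

lemma graded_subdegree: "(\<And>a. fls_subdegree (X a) \<ge> a + d) \<Longrightarrow> graded X"
  unfolding graded_def by (intro exI[of _ d]) (auto intro!: fls_eq0_below_subdegree elim: less_le_trans)

lemma series_shift:
  assumes "bounded_below b" "graded X"
  shows "series (\<lambda>a. b (a + 1)) X = series b (\<lambda>a. X (a - 1))"
proof -
  have "bij_betw (\<lambda>a. a + 1) (UNIV :: int set) UNIV"
    by (rule bij_betwI[of _ _ _ "\<lambda>a. a - 1"]) auto
  from infsum_reindex_bij_betw[OF this, of "\<lambda>a. elt_B (b a) * scalar (X (a - 1))"]
  show ?thesis by (simp add: series_def)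
qed

text \<open>The recurrence that is satisfied both by the \<open>hs p\<close> and by the \<open>dual_coeff p\<close>.\<close>

lemma has_sum_series_rec:
  assumes b: "bounded_below b" and X: "graded X"
    and b': "\<And>a. b' a = b (a + 1) + of_int (g a) * b a"
  shows "((\<lambda>a. elt_B (b a) * scalar (X (a - 1) + of_int (g a) * X a)) has_sum series b' X) UNIV"
    (is "(?f has_sum _) _")
proof -
  have g: "graded (\<lambda>a. of_int (g a) * X a)"
    using X unfolding graded_def fls_of_int fls_mult_const_nth by (metis mult_zero_right)
  have sc: "elt_B (b a) * scalar (of_int (g a) * X a) = elt_B (of_int (g a) * b a) * scalar (X a)" for a
  proof -
    have 1: "scalar (of_int (g a) :: complex fls) = elt_B (of_int (g a))"
      unfolding fls_of_int scalar_const sconst_of_int ..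
    have 2: "elt_B (of_int (g a) * b a) = elt_B (of_int (g a)) * elt_B (b a)"
      by (simp only: fls_const_mult_const mult_single add_0)
    show ?thesis unfolding 2 scalar_mult 1 by (simp only: mult_ac)
  qed
  have bb: "bounded_below (\<lambda>a. of_int (g a) * b a)"
    using b unfolding bounded_below_def by (metis mult_zero_right)
  have 1: "((\<lambda>a. elt_B (b (a + 1)) * scalar (X a)) has_sum series (\<lambda>a. b (a + 1)) X) UNIV"
    by (intro has_sum_series bounded_below_shift b X)
  have 2: "((\<lambda>a. elt_B (of_int (g a) * b a) * scalar (X a)) has_sum series (\<lambda>a. of_int (g a) * b a) X) UNIV"
    by (intro has_sum_series bb X)
  have "series b' X = series (\<lambda>a. b (a + 1)) X + series (\<lambda>a. of_int (g a) * b a) X"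
  proof (rule seriesI)
    show "((\<lambda>a. elt_B (b' a) * scalar (X a)) has_sum series (\<lambda>a. b (a + 1)) X + series (\<lambda>a. of_int (g a) * b a) X) UNIV"
      using has_sum_fls_add[OF 1 2]
      by (simp add: b' single_add distrib_right flip: fls_plus_const)
  qed
  moreover have "((\<lambda>a. elt_B (b a) * scalar (X (a - 1))) has_sum series b (\<lambda>a. X (a - 1))) UNIV"
    using graded_shift[OF X, of "- 1"] by (intro has_sum_series b) simp
  from has_sum_fls_add[OF this 2[folded sc]]
  have "(?f has_sum series b (\<lambda>a. X (a - 1)) + series (\<lambda>a. of_int (g a) * b a) X) UNIV"
    by (simp add: scalar_add distrib_left)
  ultimately show ?thesis using series_shift[OF b X] by simp
qed

text \<open>Moving the shift from \<open>b\<close> to \<open>X\<close> turns the recurrence into a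
  condition on \<open>X\<close>. If it only multiplies each \<open>X a\<close> by the same
  \<open>y\<close>, so it does the whole series; this is the case of shifted powers.\<close>

lemma series_rec_multiple:
  assumes "bounded_below b" "graded X" "\<And>a. b' a = b (a + 1) + of_int (g a) * b a"
    and y: "\<And>a. X (a - 1) + of_int (g a) * X a = y * X a"
  shows "series b' X = scalar y * series b X"
proof -
  have "((\<lambda>a. scalar y * (elt_B (b a) * scalar (X a))) has_sum series b' X) UNIV"
    using has_sum_series_rec[OF assms(1-3)]
    unfolding y scalar_mult mult.left_commute[of "elt_B _" "scalar y"] .
  moreover have "((\<lambda>a. scalar y * (elt_B (b a) * scalar (X a))) has_sum scalar y * series b X) UNIV"
    by (intro has_sum_fls_mult_left has_sum_series assms)
  ultimately show ?thesis by (rule has_sum_fls_unique)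
qed

text \<open>The variant for ordinary powers of \<open>u\<close>, where the factor depending on
  \<open>a\<close> is produced by differentiation.\<close>

lemma series_rec_derivation:
  assumes "bounded_below b" "graded X" "\<And>a. b' a = b (a + 1) + of_int (g a) * b a"
    and y: "\<And>a. X (a - 1) + of_int (g a) * X a = y * X a + w * du (X a)"
  shows "series b' X = scalar y * series b X + scalar w * deriv_u (series b X)"
proof -
  have hs: "((\<lambda>a. elt_B (b a) * scalar (X a)) has_sum series b X) UNIV"
    by (intro has_sum_series assms)
  have "((\<lambda>a. scalar y * (elt_B (b a) * scalar (X a)) + scalar w * deriv_u (elt_B (b a) * scalar (X a)))
     has_sum scalar y * series b X + scalar w * deriv_u (series b X)) UNIV"
    by (intro has_sum_fls_add has_sum_fls_mult_left has_sum_deriv_u hs)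
  moreover have "scalar y * (elt_B (b a) * scalar (X a)) + scalar w * deriv_u (elt_B (b a) * scalar (X a))
     = elt_B (b a) * scalar (X (a - 1) + of_int (g a) * X a)" for a
    unfolding y by (simp add: deriv_u_mult deriv_u_scalar scalar_add scalar_mult algebra_simps)
  ultimately have "((\<lambda>a. elt_B (b a) * scalar (X (a - 1) + of_int (g a) * X a))
     has_sum scalar y * series b X + scalar w * deriv_u (series b X)) UNIV"
    by (simp only:)
  with has_sum_series_rec[OF assms(1-3)] show ?thesis
    by (rule has_sum_fls_unique)
qed

lemma series_cmult:
  assumes "bounded_below b" "graded X"
  shows "((\<lambda>a. elt_B (b a) * scalar (y * X a)) has_sum scalar y * series b X) UNIV"
  using has_sum_fls_mult_left[OF has_sum_series[OF assms], of "scalar y"]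
  unfolding scalar_mult mult.left_commute[of "elt_B _" "scalar y"] .

subsection \<open>Shifted powers of Laurent series\<close>

lemma subdegree_add_of_int:
  fixes x :: "complex fls"
  assumes "fls_subdegree x = - 1"
  shows "fls_subdegree (x + of_int k) = - 1"
proof (rule fls_subdegree_eqI)
  have "x \<noteq> 0" using assms by auto
  then show "fls_nth (x + of_int k) (- 1) \<noteq> 0"
    using assms nth_fls_subdegree_nonzero[of x] by (simp add: fls_of_int_nth)
qed (use assms in \<open>simp add: fls_of_int_nth\<close>)

lemma subdegree_diff_of_int:
  "fls_subdegree (x :: complex fls) = - 1 \<Longrightarrow> fls_subdegree (x - of_int k) = - 1"
  using subdegree_add_of_int[of x "- k"] by simp

lemma add_of_int_nonzero: "fls_subdegree (x :: complex fls) = - 1 \<Longrightarrow> x + of_int k \<noteq> 0"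
  using subdegree_add_of_int[of x k] by auto

lemma diff_of_int_nonzero: "fls_subdegree (x :: complex fls) = - 1 \<Longrightarrow> x - of_int k \<noteq> 0"
  using subdegree_diff_of_int[of x k] by auto

lemma shifted_power_int_0 [simp]: "shifted_power_int x 0 = 1"
  by (simp add: shifted_power_int_def)

lemma shifted_power_int_add_1:
  fixes x :: "complex fls"
  assumes "fls_subdegree x = - 1"
  shows "shifted_power_int x (k + 1) = shifted_power_int x k * (x - of_int k)"
proof (cases "k \<ge> 0")
  case True
  then have "nat (k + 1) = Suc (nat k)" by simp
  then show ?thesis using True by (simp add: shifted_power_int_def shifted_power_Suc)
next
  case False
  define j where "j = nat (- k - 1)"
  have k: "k = - int (Suc j)" using False by (simp add: j_def)
  have "shifted_power_int x (k + 1) = 1 / (\<Prod>i=1..j. x + of_nat i)"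
  proof (cases "j = 0")
    case True
    then show ?thesis by (simp add: k)
  next
    case False
    then have "\<not> k + 1 \<ge> 0" "nat (- (k + 1)) = j" by (auto simp: k)
    then show ?thesis by (simp add: shifted_power_int_def)
  qed
  moreover have 2: "shifted_power_int x k = 1 / ((\<Prod>i=1..j. x + of_nat i) * (x + of_nat (Suc j)))"
  proof -
    have "\<not> k \<ge> 0" "nat (- k) = Suc j" by (auto simp: k)
    then show ?thesis by (simp add: shifted_power_int_def)
  qed
  moreover have 3: "x + of_nat (Suc j) \<noteq> 0" "x - of_int k = x + of_nat (Suc j)"
    using add_of_int_nonzero[OF assms, of "int (Suc j)"] by (simp_all add: k)
  ultimately show ?thesis
    unfolding 2 3(2) by (simp del: of_nat_Suc)
qed

lemma shifted_power_int_diff_1: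
  fixes x :: "complex fls"
  assumes "fls_subdegree x = - 1"
  shows "shifted_power_int x (k - 1) = shifted_power_int x k / (x - of_int (k - 1))"
proof -
  have eq: "shifted_power_int x k = shifted_power_int x (k - 1) * (x - of_int (k - 1))"
    using shifted_power_int_add_1[OF assms, of "k - 1"] by simp
  show ?thesis
    unfolding eq nonzero_mult_div_cancel_right[OF diff_of_int_nonzero[OF assms]] ..
qed

lemma subdegree_shifted_power_int:
  fixes x :: "complex fls"
  assumes x: "fls_subdegree x = - 1"
  shows "fls_subdegree (shifted_power_int x k) = - k \<and> shifted_power_int x k \<noteq> 0"
proof (induction k rule: int_induct[where k = 0])
  case (step1 k)
  have "x - of_int k \<noteq> 0" by (rule diff_of_int_nonzero[OF x])
  then show ?case
    using step1 subdegree_diff_of_int[OF x, of k] unfolding shifted_power_int_add_1[OF x] by simp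
next
  case (step2 k)
  have "x - of_int (k - 1) \<noteq> 0" by (rule diff_of_int_nonzero[OF x])
  then show ?case
    using step2 subdegree_diff_of_int[OF x, of "k - 1"] unfolding shifted_power_int_diff_1[OF x]
    by (simp add: fls_divide_subdegree)
qed simp

lemma shifted_power_int_add:
  fixes x :: "complex fls"
  assumes x: "fls_subdegree x = - 1"
  shows "shifted_power_int x (a + b) = shifted_power_int x a * shifted_power_int (x - of_int a) b"
proof (induction b rule: int_induct[where k = 0])
  case (step1 b)
  have "shifted_power_int x (a + (b + 1)) = shifted_power_int x (a + b) * (x - of_int (a + b))"
    using shifted_power_int_add_1[OF x, of "a + b"] by (simp add: add.assoc)
  then show ?case
    unfolding step1 shifted_power_int_add_1[OF subdegree_diff_of_int[OF x]] by (simp add: algebra_simps)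
next
  case (step2 b)
  have "shifted_power_int x (a + (b - 1)) = shifted_power_int x (a + b) / (x - of_int (a + b - 1))"
    using shifted_power_int_diff_1[OF x, of "a + b"] by (simp add: algebra_simps)
  then show ?case
    unfolding step2 shifted_power_int_diff_1[OF subdegree_diff_of_int[OF x]] by (simp add: algebra_simps)
qed simp

lemma shifted_power_int_uminus:
  "shifted_power_int (x :: complex fls) (- int p) = 1 / (\<Prod>i<p. x + of_nat (Suc i))"
proof (cases "p = 0")
  case False
  then show ?thesis
    by (simp add: shifted_power_int_def prod.atLeast1_atMost_eq)
qed simp

text \<open>Raising \<open>r\<close> by one takes the factor \<open>r - v\<close> from the first
  power and gives \<open>v - r\<close> to the second. This turns shifted powers of
  \<open>- v\<close> into the reciprocals occurring in \<open>E_tilde v\<close>.\<close>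

lemma shifted_power_int_reflect:
  fixes v :: "complex fls"
  assumes v: "fls_subdegree v = - 1"
  shows "shifted_power_int (- v) (1 - r) * shifted_power_int v r = int_sign r * (- v)"
proof -
  have v': "fls_subdegree (- v) = - 1" using v by simp
  have step: "shifted_power_int (- v) (1 - (r + 1)) * shifted_power_int v (r + 1)
      = - (shifted_power_int (- v) (1 - r) * shifted_power_int v r)" for r
  proof -
    have "shifted_power_int (- v) (1 - r) = shifted_power_int (- v) (1 - (r + 1)) * (- v - of_int (- r))"
      using shifted_power_int_add_1[OF v', of "1 - (r + 1)"] by simp
    then have "shifted_power_int (- v) (1 - r) = shifted_power_int (- v) (1 - (r + 1)) * - (v - of_int r)"
      by simp
    then show ?thesis
      unfolding shifted_power_int_add_1[OF v] by (simp only: mult_ac mult_minus_left mult_minus_right minus_minus)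
  qed
  show ?thesis
  proof (induction r rule: int_induct[where k = 0])
    case base
    then show ?case
      using shifted_power_int_add_1[OF v', of 0] by (simp add: int_sign_def)
  next
    case (step1 r)
    then show ?case unfolding step int_sign_add_1 by simp
  next
    case (step2 r)
    then show ?case
      using step[of "r - 1"] int_sign_add_1[of "r - 1", where 'a = "complex fls"] by simp
  qed
qed

lemma inverse_u_powi: "(1 / u) powi n = u powi (- n)"
  by (simp add: power_int_minus power_int_inverse divide_inverse del: fls_inverse_X_inv)

lemma graded_powi: "graded (\<lambda>a. u powi (- a - k))"
  by (rule graded_subdegree[where d = k]) simp

lemma graded_shifted_power:
  assumes "fls_subdegree w = - 1"
  shows "graded (\<lambda>a. 1 / shifted_power_int w a)" "graded (\<lambda>a. shifted_power_int w (- a))"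
proof -
  show "graded (\<lambda>a. 1 / shifted_power_int w a)"
    using subdegree_shifted_power_int[OF assms]
    by (intro graded_subdegree[where d = 0]) (simp add: fls_divide_subdegree)
  show "graded (\<lambda>a. shifted_power_int w (- a))"
    using subdegree_shifted_power_int[OF assms]
    by (intro graded_subdegree[where d = 0]) simp
qed

lemma u_times_du_power:
  assumes "u * du w = w"
  shows "u * du (w ^ p) = of_nat p * w ^ p"
proof (induction p)
  case (Suc p)
  have "u * du (w ^ Suc p) = (u * du w) * w ^ p + w * (u * du (w ^ p))"
    by (simp only: power_Suc du_mult distrib_left mult_ac)
  then show ?case unfolding Suc.IH assms by (simp add: algebra_simps)
qed (simp add: du_1)

lemma u_times_du_u: "u * du u = u" "u * du (- u) = - u"
proof -
  have "du (- u) = - du u" by (simp add: du_def)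
  then show "u * du u = u" "u * du (- u) = - u" by (simp_all add: du_u)
qed

subsection \<open>Generating series of the coefficient families\<close>

context shift_family
begin

lemma bounded_below_hs: "bounded_below (hs r)"
  unfolding bounded_below_def by (intro exI[of _ "- r"]) (auto intro: hs_neg)

lemma bounded_below_dual_coeff: "bounded_below (\<lambda>a. dual_coeff p (- a))"
  unfolding bounded_below_def by (intro exI[of _ "- int p - 1"]) (auto intro: dual_coeff_eq_0)

lemma hs_Suc: "hs (int (Suc p)) a = hs (int p) (a + 1) + of_int (a + int p) * hs (int p) a"
  using hs_rec[of "int p" a] by (simp add: add.commute)

lemma dual_coeff_Suc_uminus:
  "dual_coeff (Suc p) (- a) = dual_coeff p (- (a + 1)) + of_int (- (int p + 1 + a)) * dual_coeff p (- a)"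
proof -
  have e: "- (a + 1) = - a - 1" by simp
  show ?thesis unfolding dual_coeff_Suc e by (simp add: algebra_simps)
qed

text \<open>The factor \<open>a\<close> acts on \<open>u powi (- a)\<close> as
  \<open>- u * du\<close>, so a step in \<open>p\<close> applies \<open>u + p - u * du\<close>. The
  term \<open>p\<close> cancels against the derivative of \<open>(- u) ^ p\<close>.\<close>

lemma series_hs_powi:
  "series (hs (int p)) (\<lambda>a. u powi (- a)) = scalar ((- u) ^ p) * ((\<lambda>G. deriv_u G - G) ^^ p) (H_series (1 / u))"
proof (induction p)
  case 0
  then show ?case
    unfolding series_def H_series_def inverse_u_powi by (simp add: hs_0)
next
  case (Suc p)
  let ?X = "\<lambda>a. u powi (- a)" and ?K = "((\<lambda>G. deriv_u G - G) ^^ p) (H_series (1 / u))"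
  have rec: "?X (a - 1) + of_int (a + int p) * ?X a = (u + of_nat p) * ?X a + (- u) * du (?X a)" for a
  proof -
    have 1: "?X (a - 1) = u * ?X a" using u_powi_add_1[of "- a"] by (simp add: mult.commute add.commute)
    have 2: "u * u powi (- a - 1) = ?X a"
      using u_powi_add_1[of "- a - 1"] by (simp only: diff_add_cancel mult.commute)
    have "u * du (?X a) = of_int (- a) * (u * u powi (- a - 1))"
      unfolding du_powi by (simp only: mult_ac)
    then have "u * du (?X a) = - (of_int a * ?X a)"
      unfolding 2 by simp
    then show ?thesis unfolding 1 by (simp add: algebra_simps)
  qed
  have "series (hs (int (Suc p))) ?X
      = scalar (u + of_nat p) * series (hs (int p)) ?X + scalar (- u) * deriv_u (series (hs (int p)) ?X)"
    by (rule series_rec_derivation[OF bounded_below_hs _ hs_Suc rec]) (use graded_powi[of 0] in simp)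
  also have "\<dots> = scalar ((u + of_nat p) * (- u) ^ p) * ?K - scalar (u * du ((- u) ^ p)) * ?K
      + scalar ((- u) ^ Suc p) * deriv_u ?K"
    unfolding Suc.IH deriv_u_mult deriv_u_scalar scalar_mult power_Suc scalar_uminus
    by (simp add: algebra_simps)
  also have "\<dots> = scalar ((- u) ^ Suc p) * (deriv_u ?K - ?K)"
    unfolding u_times_du_power[OF u_times_du_u(2)]
    by (simp only: distrib_right scalar_add scalar_mult power_Suc) (simp add: scalar_uminus algebra_simps)
  finally show ?case by simp
qed

text \<open>Passing from \<open>a\<close> to \<open>a - 1\<close> multiplies the reciprocal by
  \<open>w - a + 1\<close>; adding \<open>a + p\<close> gives \<open>w + p + 1\<close>, free of
  \<open>a\<close>. These factors accumulate to the reciprocal of \<open>(w|-p)\<close>.\<close>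

lemma series_hs_shifted:
  assumes w: "fls_subdegree w = - 1"
  shows "series (hs (int p)) (\<lambda>a. 1 / shifted_power_int w a)
    = scalar (1 / shifted_power_int w (- int p)) * H_tilde w"
proof (induction p)
  case 0
  then show ?case by (simp add: series_def H_tilde_def hs_0)
next
  case (Suc p)
  let ?X = "\<lambda>a. 1 / shifted_power_int w a"
  have rec: "?X (a - 1) + of_int (a + int p) * ?X a = (w + of_nat (Suc p)) * ?X a" for a
  proof -
    have 1: "?X (a - 1) = (w - of_int (a - 1)) * ?X a"
      unfolding shifted_power_int_diff_1[OF w] by simp
    show ?thesis
      unfolding 1 distrib_right[symmetric] by (intro arg_cong2[where f = "(*)"] refl) simp
  qed
  have "series (hs (int (Suc p))) ?X = scalar (w + of_nat (Suc p)) * series (hs (int p)) ?X"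
    by (rule series_rec_multiple[OF bounded_below_hs graded_shifted_power(1)[OF w] hs_Suc rec])
  then show ?case
    unfolding Suc.IH shifted_power_int_uminus by (simp add: scalar_mult mult_ac)
qed

lemma series_dual_coeff_0:
  assumes "\<And>r. int_sign r * X (r - 1) = y * Y r"
  shows "series (\<lambda>a. dual_coeff 0 (- a)) X = (\<Sum>\<^sub>\<infinity>r. elt_B (estar r) * scalar (y * Y r))"
proof -
  have bij: "bij_betw (\<lambda>r. r - 1) (UNIV :: int set) UNIV"
    by (rule bij_betwI[of _ _ _ "\<lambda>a. a + 1"]) auto
  have "elt_B (dual_coeff 0 (- (r - 1))) * scalar (X (r - 1)) = elt_B (estar r) * scalar (y * Y r)" for r
  proof -
    have "dual_coeff 0 (- (r - 1)) = int_sign r * estar r"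
      by (simp add: dual_coeff_0)
    moreover have uminus: "elt_B (- f) = - elt_B f" for f
      by (rule fls_eqI) (simp add: single_uminus)
    ultimately show ?thesis
      unfolding assms[symmetric]
      by (cases "even r") (simp_all add: int_sign_def scalar_uminus uminus)
  qed
  then show ?thesis
    unfolding series_def
    using infsum_reindex_bij_betw[OF bij, of "\<lambda>a. elt_B (dual_coeff 0 (- a)) * scalar (X a)"] by simp
qed

text \<open>As for \<open>hs\<close>, with opposite signs: a step applies
  \<open>u - p + u * du\<close>, and the \<open>p\<close> cancels against the derivative of
  \<open>u ^ p\<close>.\<close>

lemma series_dual_coeff_powi:
  "series (\<lambda>a. dual_coeff p (- a)) (\<lambda>a. u powi (- a - 1))
    = scalar (u ^ p) * ((\<lambda>G. deriv_u G + G) ^^ p) (E_series (- (1 / u)))"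
proof (induction p)
  case 0
  have "int_sign r * u powi (- (r - 1) - 1) = 1 * (- (1 / u)) powi r" for r
    unfolding power_int_minus_left inverse_u_powi by (simp add: int_sign_def)
  from series_dual_coeff_0[of "\<lambda>a. u powi (- a - 1)", OF this] show ?case
    by (simp add: E_series_def)
next
  case (Suc p)
  let ?X = "\<lambda>a. u powi (- a - 1)" and ?K = "((\<lambda>G. deriv_u G + G) ^^ p) (E_series (- (1 / u)))"
  let ?b = "\<lambda>p a. dual_coeff p (- a)"
  have rec: "?X (a - 1) + of_int (- (int p + 1 + a)) * ?X a = (u - of_nat p) * ?X a + u * du (?X a)" for a
  proof -
    have 1: "?X (a - 1) = u * ?X a" using u_powi_add_1[of "- a - 1"] by (simp add: mult.commute)
    have 2: "u * u powi (- a - 1 - 1) = ?X a"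
      using u_powi_add_1[of "- a - 1 - 1"] by (simp only: diff_add_cancel mult.commute)
    have "u * du (?X a) = of_int (- a - 1) * (u * u powi (- a - 1 - 1))"
      unfolding du_powi by (simp only: mult_ac)
    then have 3: "u * du (?X a) = of_int (- a - 1) * ?X a"
      unfolding 2 .
    show ?thesis unfolding 1 3 by (simp add: algebra_simps)
  qed
  have "series (?b (Suc p)) ?X
      = scalar (u - of_nat p) * series (?b p) ?X + scalar u * deriv_u (series (?b p) ?X)"
    by (rule series_rec_derivation[OF bounded_below_dual_coeff graded_powi dual_coeff_Suc_uminus rec])
  also have "\<dots> = scalar ((u - of_nat p) * u ^ p) * ?K + scalar (u * du (u ^ p)) * ?K
      + scalar (u ^ Suc p) * deriv_u ?K"
    unfolding Suc.IH deriv_u_mult deriv_u_scalar scalar_mult power_Suc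
    by (simp add: algebra_simps)
  also have "\<dots> = scalar (u ^ Suc p) * (deriv_u ?K + ?K)"
    unfolding u_times_du_power[OF u_times_du_u(1)] diff_conv_add_uminus
    by (simp only: distrib_right scalar_add scalar_mult power_Suc scalar_uminus) (simp add: algebra_simps)
  finally show ?case by simp
qed

text \<open>A step multiplies by \<open>a - v\<close> minus \<open>p + 1 + a\<close>, that is by
  \<open>- (v + p + 1)\<close>. The base case already carries a factor \<open>- v\<close>; taking
  the shifted power at \<open>v - 1\<close> absorbs it.\<close>

lemma series_dual_coeff_shifted:
  assumes v: "fls_subdegree v = - 1"
  shows "series (\<lambda>a. dual_coeff p (- a)) (\<lambda>a. shifted_power_int (- v) (- a))
    = scalar ((- 1) ^ Suc p / shifted_power_int (v - 1) (- int p - 1)) * E_tilde v"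
proof (induction p)
  case 0
  have "int_sign r * shifted_power_int (- v) (- (r - 1)) = - v * (1 / shifted_power_int v r)" for r
    using shifted_power_int_reflect[OF v, of r] subdegree_shifted_power_int[OF v, of r]
    by (auto simp: field_simps int_sign_def split: if_splits)
  from series_dual_coeff_0[of "\<lambda>a. shifted_power_int (- v) (- a)", OF this]
  have "series (\<lambda>a. dual_coeff 0 (- a)) (\<lambda>a. shifted_power_int (- v) (- a))
      = (\<Sum>\<^sub>\<infinity>r. elt_B (estar r) * scalar (- v * (1 / shifted_power_int v r)))" .
  also have "(\<Sum>\<^sub>\<infinity>r. elt_B (estar r) * scalar (- v * (1 / shifted_power_int v r))) = scalar (- v) * E_tilde v"
  proof (rule infsumI)
    have "bounded_below estar" by (auto simp: bounded_below_def intro: exI[of _ 0])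
    from series_cmult[OF this graded_shifted_power(1)[OF v], of "- v"]
    show "((\<lambda>r. elt_B (estar r) * scalar (- v * (1 / shifted_power_int v r))) has_sum scalar (- v) * E_tilde v) UNIV"
      by (simp only: series_def E_tilde_def)
  qed
  finally have "series (\<lambda>a. dual_coeff 0 (- a)) (\<lambda>a. shifted_power_int (- v) (- a)) = scalar (- v) * E_tilde v" .
  moreover have "(- 1) ^ Suc 0 / shifted_power_int (v - 1) (- int 0 - 1) = - v"
    using shifted_power_int_uminus[of "v - 1" 1] by simp
  ultimately show ?case by (simp only:)
next
  case (Suc p)
  let ?X = "\<lambda>a. shifted_power_int (- v) (- a)" and ?b = "\<lambda>p a. dual_coeff p (- a)"
  have v': "fls_subdegree (- v) = - 1" using v by simp
  have rec: "?X (a - 1) + of_int (- (int p + 1 + a)) * ?X a = - (v + of_nat (Suc p)) * ?X a" for a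
    using shifted_power_int_add_1[OF v', of "- a"] by (simp add: algebra_simps)
  have "series (?b (Suc p)) ?X = scalar (- (v + of_nat (Suc p))) * series (?b p) ?X"
    by (rule series_rec_multiple[OF bounded_below_dual_coeff graded_shifted_power(2)[OF v'] dual_coeff_Suc_uminus rec])
  also have "\<dots> = scalar (- (v + of_nat (Suc p)) * ((- 1) ^ Suc p / shifted_power_int (v - 1) (- int p - 1))) * E_tilde v"
    unfolding Suc.IH by (simp only: scalar_mult mult.assoc)
  also have "- (v + of_nat (Suc p)) * ((- 1) ^ Suc p / shifted_power_int (v - 1) (- int p - 1))
      = (- 1) ^ Suc (Suc p) / shifted_power_int (v - 1) (- int (Suc p) - 1)"
  proof -
    have 1: "- int p - 1 = - int (Suc p)" "- int (Suc p) - 1 = - int (Suc (Suc p))" by simp_all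
    show ?thesis unfolding 1 shifted_power_int_uminus by (simp add: algebra_simps)
  qed
  finally show ?case .
qed

end

section \<open>Assembly of the four generating series\<close>

text \<open>The common frame of the four formulas: a bijection \<open>r\<close> of the index
  \<open>k\<close>, a finite sum over \<open>p\<close>, and a factor \<open>y\<close> that collects
  the dependence on the charge.\<close>

lemma has_sum_assemble:
  assumes r: "bij r" and b: "\<And>p. bounded_below (b p)" and X: "graded X"
    and f: "\<And>k. f k = z_power s * (\<Sum>p\<le>P. c p * (elt_B (b p (r k)) * scalar (y * X (r k))))"
  shows "(f has_sum z_power s * scalar y * (\<Sum>p\<le>(P :: nat). c p * series (b p) X)) UNIV"
proof -
  have "((\<lambda>a. z_power s * (\<Sum>p\<le>P. c p * (elt_B (b p a) * scalar (y * X a))))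
      has_sum z_power s * (\<Sum>p\<le>P. c p * (scalar y * series (b p) X))) UNIV"
    by (intro has_sum_fls_mult_left has_sum_fls_sum series_cmult b X)
  then have "(f has_sum z_power s * (\<Sum>p\<le>P. c p * (scalar y * series (b p) X))) UNIV"
    unfolding f by (subst has_sum_reindex_bij_betw[OF r])
  also have "z_power s * (\<Sum>p\<le>P. c p * (scalar y * series (b p) X))
      = z_power s * scalar y * (\<Sum>p\<le>P. c p * series (b p) X)"
    by (simp add: sum_distrib_left mult_ac)
  finally show ?thesis .
qed

lemma elt_single_sum:
  "elt (Poly_Mapping.single (s + m) (\<Sum>p\<le>P. g p * d p))
    = z_power s * (\<Sum>p\<le>P. elt (Poly_Mapping.single m (d p)) * elt_B (g p))"
proof -
  have "elt (Poly_Mapping.single (s + m) (\<Sum>p\<in>I. g p * d p))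
      = z_power s * (\<Sum>p\<in>I. elt (Poly_Mapping.single m (d p)) * elt_B (g p))" for I
    by (induction I rule: infinite_finite_induct)
       (simp_all add: single_add distrib_left mult_single mult_ac flip: fls_plus_const)
  then show ?thesis .
qed

lemma infsum_nat_bounded:
  fixes f :: "nat \<Rightarrow> fock fls"
  assumes "\<And>p. p > P \<Longrightarrow> f p = 0"
  shows "infsum f UNIV = (\<Sum>p\<le>P. f p)"
  by (rule infsumI, rule has_sum_finite_neutralI[of "{..P}"]) (use assms in auto)

lemma infsum_int_bounded:
  fixes f :: "int \<Rightarrow> fock fls"
  assumes "inj g" "\<And>p. p \<notin> g ` {..P} \<Longrightarrow> f p = 0"
  shows "infsum f UNIV = (\<Sum>p\<le>(P :: nat). f (g p))"
proof (rule infsumI, rule has_sum_finite_neutralI[of "g ` {..P}"])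
  show "(\<Sum>p\<le>P. f (g p)) = sum f (g ` {..P})"
    using assms(1) by (subst sum.reindex) (auto intro: inj_on_subset)
qed (use assms in auto)

lemma extend_single:
  assumes "linear_on_B T"
  shows "extend T (Poly_Mapping.single m f) = Poly_Mapping.single m (T f)"
proof -
  \<comment> \<open>\<open>Poly_Mapping.map\<close> leaves zero coefficients at zero, so the formula
    for \<open>f = 0\<close> requires \<open>T 0 = 0\<close>.\<close>
  have "T (sconst 0 * 0) = sconst 0 * T 0"
    using assms unfolding linear_operator_def by (blast intro: shifted_symmetric_0)
  then have "T 0 = 0" by simp
  then show ?thesis
    by (intro poly_mapping_eqI) (auto simp: map.rep_eq lookup_single when_def)
qed

theorem proposition5p3:
  fixes \<phi> :: "sfun \<Rightarrow> sfun"
    and \<psi> \<psi>' :: "int \<Rightarrow> fock \<Rightarrow> fock"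
    and D D' :: "int \<Rightarrow> sfun \<Rightarrow> sfun"
    and m :: int and F :: fock
  assumes "is_shift_automorphism \<phi>"
    and "is_psi \<phi> \<psi>" and "is_psi_star \<phi> \<psi>'"
    and "is_D_lower \<phi> D" and "is_D_upper \<phi> D'"
    and "F \<in> charge_space m"
  shows
    "(\<lambda>k. elt (\<psi> k F) * scalar ((1 / u) powi k)) summable_on UNIV \<and>
     Psi \<psi> (1 / u) F =
       z_power 1 * scalar (u powi (- m - 1)) *
         (\<Sum>\<^sub>\<infinity>p\<in>(UNIV :: nat set).
            ((\<lambda>G. deriv_u G - G) ^^ p) (H_series (1 / u)) * elt (extend (D (int p)) F)
              * scalar (u ^ p)) \<and>
     (\<lambda>k. elt (\<psi>' k F) * scalar ((1 / u) powi (- k))) summable_on UNIV \<and>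
     Psi_star \<psi>' (1 / u) F =
       z_power (- 1) * scalar (u powi m) *
         (\<Sum>\<^sub>\<infinity>p\<in>(UNIV :: nat set).
            ((\<lambda>G. deriv_u G + G) ^^ p) (E_series (- (1 / u))) * elt (extend (D' (- int p - 1)) F)
              * scalar (u ^ p)) \<and>
     (\<lambda>k. elt (\<psi> k F) * scalar (1 / shifted_power_int u (k - 1))) summable_on UNIV \<and>
     Psi_tilde \<psi> u F =
       z_power 1 * scalar (1 / shifted_power_int u m) *
         H_tilde (u - of_int m) * DE_tilde D (u - of_int m) F \<and>
     (\<lambda>k. elt (\<psi>' k F) * scalar (shifted_power_int (- u) (k + 1))) summable_on UNIV \<and>
     Psi_star_tilde \<psi>' u F =
       z_power (- 1) * scalar (shifted_power_int (- u) m) *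
         E_tilde (u + of_int m) * DH_tilde D' (u + of_int m - 1) F"
proof -
  interpret shift_automorphism \<phi> by unfold_locales (rule assms(1))
  let ?h = "hshift \<phi>" and ?b = "\<lambda>p a. dual_coeff p (- a)"
  obtain f where f: "f \<in> shifted_symmetric" and F: "F = Poly_Mapping.single m f"
    using assms(6) by (auto simp: charge_space_def)
  obtain P where P: "lower_expansion \<psi> D m P f"
    using ex_lower_expansion[OF assms(2,4) f] by blast
  obtain Q where Q: "upper_expansion \<psi>' D' m Q f"
    using ex_upper_expansion[OF assms(3,5) f] by blast
  have D: "extend (D p) F = Poly_Mapping.single m (D p f)" for p
    unfolding F using assms(4) by (intro extend_single) (simp add: is_D_lower_def)
  have D': "extend (D' p) F = Poly_Mapping.single m (D' p f)" for p
    unfolding F using assms(5) by (intro extend_single) (simp add: is_D_upper_def)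
  have D_zero: "D p f = 0" if "p < 0 \<or> p > int P" for p
    using P that by (auto simp: lower_expansion_def)
  have D'_zero: "D' p f = 0" if "p \<ge> 0 \<or> - p - 1 > int Q" for p
    using Q that by (auto simp: upper_expansion_def)
  \<comment> \<open>The sign of the first-row expansion is kept in \<open>d\<close>; it later
    cancels the sign of \<open>(- u) ^ p\<close> and supplies that of
    \<open>DE_tilde\<close>.\<close>
  define d where "d = (\<lambda>p :: nat. elt (Poly_Mapping.single m ((-1) ^ p * D (int p) f)))"
  define d' where "d' = (\<lambda>p :: nat. elt (Poly_Mapping.single m (D' (- int p - 1) f)))"
  have d: "d p = (-1) ^ p * elt (extend (D (int p)) F)" for p
  proof -
    have uminus: "elt (Poly_Mapping.single m (- g)) = - elt (Poly_Mapping.single m g)" for g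
      by (rule fls_eqI) (simp add: single_uminus)
    show ?thesis unfolding d_def D by (cases "even p") (simp_all add: uminus)
  qed
  have d': "d' p = elt (extend (D' (- int p - 1)) F)" for p
    unfolding d'_def D' ..
  have psi: "elt (\<psi> k F) = z_power 1 * (\<Sum>p\<le>P. d p * elt_B (?h (int p) (k - m - 1)))" for k
  proof -
    have "\<psi> k F = Poly_Mapping.single (1 + m) (\<Sum>p\<le>P. ?h (int p) (k - m - 1) * ((-1) ^ p * D (int p) f))"
      using P unfolding F lower_expansion_def by (simp add: mult_ac add.commute)
    then show ?thesis unfolding d_def elt_single_sum[symmetric] by simp
  qed
  have psi': "elt (\<psi>' k F) = z_power (- 1) * (\<Sum>p\<le>Q. d' p * elt_B (?b p (m - 1 - k)))" for k
  proof -
    have "\<psi>' k F = Poly_Mapping.single (- 1 + m) (\<Sum>p\<le>Q. ?b p (m - 1 - k) * D' (- int p - 1) f)"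
      using Q unfolding F upper_expansion_def by (simp add: algebra_simps)
    then show ?thesis unfolding d'_def elt_single_sum[symmetric] by simp
  qed
  \<comment> \<open>The starred coefficients are taken at \<open>k - m + 1 = - (m - 1 - k)\<close>,
    hence the index reversing substitution in the second case.\<close>
  have bij: "bij (\<lambda>k. k - m - 1)" "bij (\<lambda>k. m - 1 - k)"
    by (rule bij_betwI[of _ _ _ "\<lambda>a. a + m + 1"]; simp) (rule bij_betwI[of _ _ _ "\<lambda>a. m - 1 - a"]; simp)
  have u: "fls_subdegree u = - 1" "fls_subdegree (- u) = - 1" by simp_all
  \<comment> \<open>Splitting \<open>(u|m)\<close> off \<open>(u|k-1)\<close>, and
    \<open>(-u|m)\<close> off \<open>(-u|k+1)\<close>, leaves shifted powers of \<open>w\<close> and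
    of \<open>- v\<close>.\<close>
  define w where "w = u - of_int m"
  define v where "v = u + of_int m"
  have w: "fls_subdegree w = - 1" and v: "fls_subdegree v = - 1"
    unfolding w_def v_def using subdegree_diff_of_int subdegree_add_of_int u(1) by blast+
  then have v': "fls_subdegree (- v) = - 1" by simp

  have "((\<lambda>k. elt (\<psi> k F) * scalar ((1 / u) powi k)) has_sum
      z_power 1 * scalar (u powi (- m - 1)) * (\<Sum>p\<le>P. d p * series (?h (int p)) (\<lambda>a. u powi (- a)))) UNIV"
  proof (rule has_sum_assemble[OF bij(1) bounded_below_hs])
    show "graded (\<lambda>a. u powi (- a))" using graded_powi[of 0] by simp
    fix k
    have "(1 / u) powi k = u powi (- m - 1) * u powi (- (k - m - 1))"
      unfolding inverse_u_powi by (subst power_int_add[symmetric]) simp_all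
    then show "elt (\<psi> k F) * scalar ((1 / u) powi k) = z_power 1 *
        (\<Sum>p\<le>P. d p * (elt_B (?h (int p) (k - m - 1)) * scalar (u powi (- m - 1) * u powi (- (k - m - 1)))))"
      unfolding psi by (simp add: sum_distrib_right mult.assoc)
  qed
  also have "(\<Sum>p\<le>P. d p * series (?h (int p)) (\<lambda>a. u powi (- a)))
     = (\<Sum>\<^sub>\<infinity>p\<in>(UNIV :: nat set). ((\<lambda>G. deriv_u G - G) ^^ p) (H_series (1 / u))
          * elt (extend (D (int p)) F) * scalar (u ^ p))"
  proof (subst infsum_nat_bounded[of P])
    fix p assume "P < p"
    then show "((\<lambda>G. deriv_u G - G) ^^ p) (H_series (1 / u)) * elt (extend (D (int p)) F) * scalar (u ^ p) = 0"
      unfolding D by (subst D_zero) auto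
  next
    have "scalar ((- u) ^ p) = (-1) ^ p * scalar (u ^ p)" for p
      by (cases "even p") (simp_all add: scalar_uminus)
    then have 1: "d p * scalar ((- u) ^ p) = elt (extend (D (int p)) F) * scalar (u ^ p)" for p
      unfolding d by (cases "even p") (simp_all add: scalar_uminus)
    show "(\<Sum>p\<le>P. d p * series (?h (int p)) (\<lambda>a. u powi (- a)))
     = (\<Sum>p\<le>P. ((\<lambda>G. deriv_u G - G) ^^ p) (H_series (1 / u)) * elt (extend (D (int p)) F) * scalar (u ^ p))"
      unfolding series_hs_powi mult.assoc[symmetric] 1 by (simp only: mult_ac)
  qed
  finally have 1: "((\<lambda>k. elt (\<psi> k F) * scalar ((1 / u) powi k)) has_sum
      z_power 1 * scalar (u powi (- m - 1)) *
         (\<Sum>\<^sub>\<infinity>p\<in>(UNIV :: nat set). ((\<lambda>G. deriv_u G - G) ^^ p) (H_series (1 / u))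
            * elt (extend (D (int p)) F) * scalar (u ^ p))) UNIV" .

  have "((\<lambda>k. elt (\<psi>' k F) * scalar ((1 / u) powi (- k))) has_sum
      z_power (- 1) * scalar (u powi m) * (\<Sum>p\<le>Q. d' p * series (?b p) (\<lambda>a. u powi (- a - 1)))) UNIV"
  proof (rule has_sum_assemble[OF bij(2) bounded_below_dual_coeff graded_powi])
    fix k
    have "(1 / u) powi (- k) = u powi m * u powi (- (m - 1 - k) - 1)"
      unfolding inverse_u_powi by (subst power_int_add[symmetric]) simp_all
    then show "elt (\<psi>' k F) * scalar ((1 / u) powi (- k)) = z_power (- 1) *
        (\<Sum>p\<le>Q. d' p * (elt_B (?b p (m - 1 - k)) * scalar (u powi m * u powi (- (m - 1 - k) - 1))))"
      unfolding psi' by (simp add: sum_distrib_right mult.assoc)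
  qed
  also have "(\<Sum>p\<le>Q. d' p * series (?b p) (\<lambda>a. u powi (- a - 1)))
     = (\<Sum>\<^sub>\<infinity>p\<in>(UNIV :: nat set). ((\<lambda>G. deriv_u G + G) ^^ p) (E_series (- (1 / u)))
          * elt (extend (D' (- int p - 1)) F) * scalar (u ^ p))"
  proof (subst infsum_nat_bounded[of Q])
    fix p assume "Q < p"
    then show "((\<lambda>G. deriv_u G + G) ^^ p) (E_series (- (1 / u))) * elt (extend (D' (- int p - 1)) F) * scalar (u ^ p) = 0"
      unfolding D' by (subst D'_zero) auto
  next
    show "(\<Sum>p\<le>Q. d' p * series (?b p) (\<lambda>a. u powi (- a - 1)))
     = (\<Sum>p\<le>Q. ((\<lambda>G. deriv_u G + G) ^^ p) (E_series (- (1 / u))) * elt (extend (D' (- int p - 1)) F) * scalar (u ^ p))"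
      unfolding series_dual_coeff_powi d' by (simp only: mult_ac)
  qed
  finally have 2: "((\<lambda>k. elt (\<psi>' k F) * scalar ((1 / u) powi (- k))) has_sum
      z_power (- 1) * scalar (u powi m) *
         (\<Sum>\<^sub>\<infinity>p\<in>(UNIV :: nat set). ((\<lambda>G. deriv_u G + G) ^^ p) (E_series (- (1 / u)))
            * elt (extend (D' (- int p - 1)) F) * scalar (u ^ p))) UNIV" .

  have "((\<lambda>k. elt (\<psi> k F) * scalar (1 / shifted_power_int u (k - 1))) has_sum
      z_power 1 * scalar (1 / shifted_power_int u m) * (\<Sum>p\<le>P. d p * series (?h (int p)) (\<lambda>a. 1 / shifted_power_int w a))) UNIV"
  proof (rule has_sum_assemble[OF bij(1) bounded_below_hs graded_shifted_power(1)[OF w]])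
    fix k
    have "shifted_power_int u (k - 1) = shifted_power_int u m * shifted_power_int w (k - m - 1)"
      using shifted_power_int_add[OF u(1), of m "k - m - 1"] by (simp add: w_def)
    then have "1 / shifted_power_int u (k - 1)
        = 1 / shifted_power_int u m * (1 / shifted_power_int w (k - m - 1))"
      by simp
    then show "elt (\<psi> k F) * scalar (1 / shifted_power_int u (k - 1)) = z_power 1 *
        (\<Sum>p\<le>P. d p * (elt_B (?h (int p) (k - m - 1))
          * scalar (1 / shifted_power_int u m * (1 / shifted_power_int w (k - m - 1)))))"
      unfolding psi by (simp only: sum_distrib_right mult.assoc)
  qed
  also have "(\<Sum>p\<le>P. d p * series (?h (int p)) (\<lambda>a. 1 / shifted_power_int w a))
      = H_tilde w * DE_tilde D w F"
  proof -
    have "DE_tilde D w F = (\<Sum>p\<le>P. elt (extend (D (int p)) F)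
        * scalar ((- 1) powi int p / shifted_power_int w (- int p)))"
      unfolding DE_tilde_def
    proof (rule infsum_int_bounded)
      fix p assume p: "p \<notin> int ` {..P}"
      have "p < 0 \<or> p > int P"
      proof (rule ccontr)
        assume "\<not> ?thesis"
        then have "p = int (nat p)" "nat p \<le> P" by auto
        then show False using p by blast
      qed
      then have "extend (D p) F = 0" unfolding D by (subst D_zero) auto
      then show "elt (extend (D p) F) * scalar ((- 1) powi p / shifted_power_int w (- p)) = 0" by simp
    qed (simp add: inj_def)
    moreover have "elt (extend (D (int p)) F) * scalar ((- 1) powi int p / shifted_power_int w (- int p))
        = d p * scalar (1 / shifted_power_int w (- int p))" for p
      unfolding d by (cases "even p") (simp_all add: scalar_uminus)
    ultimately show ?thesis
      unfolding series_hs_shifted[OF w] by (simp add: sum_distrib_left mult_ac)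
  qed
  finally have 3: "((\<lambda>k. elt (\<psi> k F) * scalar (1 / shifted_power_int u (k - 1))) has_sum
      z_power 1 * scalar (1 / shifted_power_int u m) * (H_tilde w * DE_tilde D w F)) UNIV" .

  have "((\<lambda>k. elt (\<psi>' k F) * scalar (shifted_power_int (- u) (k + 1))) has_sum
      z_power (- 1) * scalar (shifted_power_int (- u) m) * (\<Sum>p\<le>Q. d' p * series (?b p) (\<lambda>a. shifted_power_int (- v) (- a)))) UNIV"
  proof (rule has_sum_assemble[OF bij(2) bounded_below_dual_coeff graded_shifted_power(2)[OF v']])
    fix k
    have "- u - of_int m = - v" by (simp add: v_def)
    then have "shifted_power_int (- u) (k + 1) = shifted_power_int (- u) m * shifted_power_int (- v) (- (m - 1 - k))"
      using shifted_power_int_add[OF u(2), of m "- (m - 1 - k)"] by (simp add: add.commute)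
    then show "elt (\<psi>' k F) * scalar (shifted_power_int (- u) (k + 1)) = z_power (- 1) *
        (\<Sum>p\<le>Q. d' p * (elt_B (?b p (m - 1 - k))
          * scalar (shifted_power_int (- u) m * shifted_power_int (- v) (- (m - 1 - k)))))"
      unfolding psi' by (simp only: sum_distrib_right mult.assoc)
  qed
  also have "(\<Sum>p\<le>Q. d' p * series (?b p) (\<lambda>a. shifted_power_int (- v) (- a)))
      = E_tilde v * DH_tilde D' (v - 1) F"
  proof -
    have "DH_tilde D' (v - 1) F = (\<Sum>p\<le>Q. elt (extend (D' (- int p - 1)) F)
        * scalar ((- 1) powi (- int p - 1) / shifted_power_int (v - 1) (- int p - 1)))"
      unfolding DH_tilde_def
    proof (rule infsum_int_bounded)
      fix p assume p: "p \<notin> (\<lambda>p. - int p - 1) ` {..Q}"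
      have "p \<ge> 0 \<or> - p - 1 > int Q"
      proof (rule ccontr)
        assume "\<not> ?thesis"
        then have "p = - int (nat (- p - 1)) - 1" "nat (- p - 1) \<le> Q" by auto
        then show False using p by blast
      qed
      then have "extend (D' p) F = 0" unfolding D' by (subst D'_zero) auto
      then show "elt (extend (D' p) F) * scalar ((- 1) powi p / shifted_power_int (v - 1) p) = 0" by simp
    qed (simp add: inj_def)
    \<comment> \<open>The sign in \<open>DH_tilde\<close> at index \<open>- p - 1\<close> must be
      matched with the power \<open>Suc p\<close> of -1 in
      \<open>series_dual_coeff_shifted\<close>.\<close>
    moreover have "((- 1) powi (- int p - 1) :: complex fls) = (- 1) ^ Suc p" for p
    proof -
      have "((- 1) powi (- int p - 1) :: complex fls) = inverse ((- 1) ^ Suc p)"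
      proof -
        have e: "- int p - 1 = - int (Suc p)" by simp
        show ?thesis unfolding e power_int_minus power_int_of_nat ..
      qed
      then show ?thesis by (cases "even p") simp_all
    qed
    ultimately show ?thesis
      unfolding series_dual_coeff_shifted[OF v] d' by (simp add: sum_distrib_left mult_ac)
  qed
  finally have 4: "((\<lambda>k. elt (\<psi>' k F) * scalar (shifted_power_int (- u) (k + 1))) has_sum
      z_power (- 1) * scalar (shifted_power_int (- u) m) * (E_tilde v * DH_tilde D' (v - 1) F)) UNIV" .

  show ?thesis
    unfolding Psi_def Psi_star_def Psi_tilde_def Psi_star_tilde_def w_def[symmetric] v_def[symmetric]
      infsumI[OF 1] infsumI[OF 2] infsumI[OF 3] infsumI[OF 4]
    using 1 2 3 4 by (auto simp: summable_on_def mult.assoc)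
qed

end
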